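(* Let $\sigma>0$. For $n\in\mathbb{N}$ let $$V_n(x)=\sum_{j=0}^{n}a_j\cos(jx),\qquad x\in(0,2\pi),$$ where $a_0,\ldots,a_n$ are real random variables such that (i) the coefficients $a_0,a_1,\ldots,a_{\lceil n/2\rceil-1}$, together with $a_n$ in the case that $n$ is even, form a family of i.i.d. random variables with Gaussian distribution $\mathcal{N}(0,\sigma^2)$; (ii) $a_j=a_{j+\lceil n/2\rceil}$ for all $j=0,\ldots,\lceil n/2\rceil-1$. Then $$\mathbb{E}[N_n(0,2\pi)]=\frac{n}{2}+\frac{\sqrt{13}}{2\sqrt{3}}\,n+O\!\left(n^{5/6}\right)\quad\text{as }n\to\infty .$$
   Context: $N_n(0,2\pi)$ denotes the number of real zeros of $V_n$ in the interval $(0,2\pi)$, and $\mathbb{E}$ denotes mathematical expectation. Condition (ii) says that the two blocks of coefficients $A_0=(a_0,\ldots,a_{\lceil n/2\rceil-1})$ and $A_1=(a_{\lceil n/2\rceil},\ldots,a_{2\lceil n/2\rceil-1})$ are equal; when $n$ is even the only remaining coefficient is $a_n$, and when $n$ is odd there is no remaining coefficient. *)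

theory Defs
  imports "HOL-Probability.Probability" "HOL-Library.Landau_Symbols"
begin

definition cos_poly :: "nat \<Rightarrow> (nat \<Rightarrow> real) \<Rightarrow> real \<Rightarrow> real" where
  "cos_poly n c x = (\<Sum>j\<le>n. c j * cos (real j * x))"

text \<open>
  Zeros are counted without multiplicity. If the polynomial vanishes identically, the set is infinite
  and \<^const>\<open>card\<close> yields 0; under nondegenerate Gaussian coefficients this is a null event.
\<close>
definition num_zeros :: "nat \<Rightarrow> (nat \<Rightarrow> real) \<Rightarrow> nat" where
  "num_zeros n c = card {x \<in> {0<..<2 * pi}. cos_poly n c x = 0}"

definition block_len :: "nat \<Rightarrow> nat" where
  "block_len n = nat \<lceil>real n / 2\<rceil>"

definition free_indices :: "nat \<Rightarrow> nat set" where
  "free_indices n = {..<block_len n} \<union> (if even n then {n} else {})"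

end

theory Submission
  imports Defs
begin

text \<open>
  Write \<open>m\<close> for the block length and \<open>\<omega>\<^sub>j = j + m/2\<close>. Since
  \<open>cos (j x) + cos ((j + m) x) = 2 cos (m x / 2) cos (\<omega>\<^sub>j x)\<close>, the equality of the two blocks turns the
  random polynomial into \<open>c W\<close> for odd \<open>n\<close> and into \<open>c W + a\<^sub>n cos (n x)\<close> for even \<open>n\<close>, where
  \<open>c x = 2 cos (m x / 2)\<close> and \<open>W x = \<Sum>\<^sub>j a\<^sub>j cos (\<omega>\<^sub>j x)\<close>. The factor \<open>c\<close> has exactly \<open>m\<close> zeros in
  \<open>(0, 2\<pi>)\<close>, which explains the term \<open>n/2\<close>. The frequencies of \<open>W\<close> fill \<open>[m/2, 3m/2]\<close>, and a Gaussian
  sum with such frequencies has about \<open>2 m\<close> times the square root of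
  \<open>\<integral> t\<^sup>2 dt\<close> over \<open>[1/2, 3/2]\<close>, that is \<open>2 m \<surd>(13/12)\<close>, zeros. For even \<open>n\<close> the summand
  \<open>a\<^sub>n cos (n x)\<close> displaces the zeros of \<open>c\<close>, but near them \<open>W\<close> has size \<open>\<surd>m\<close>, so that each of them still
  accounts for one zero on average.

  Expectations are computed by integral geometry. Let \<open>f = \<Sum>\<^sub>i \<xi>\<^sub>i f\<^sub>i\<close> with independent centred normal
  \<open>\<xi>\<^sub>i\<close> of equal variance and let \<open>v x = (f\<^sub>i x)\<^sub>i\<close>. The values of \<open>f\<close> at two points have opposite
  signs with probability \<open>\<theta>/\<pi>\<close>, where \<open>\<theta>\<close> is the angle between the vectors \<open>v\<close> at these points
  (\<open>prob_sign_change\<close>). Adding up over a mesh and refining it, the expected number of zeros becomes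
  \<open>1/\<pi>\<close> times the length of the curve \<open>v/|v|\<close> on the unit sphere (\<open>expected_zeros_upper\<close>,
  \<open>expected_zeros_lower\<close>); sign changes find all zeros in the limit because almost surely no zero is double
  (\<open>AE_no_double_zero\<close>).

  The interval \<open>(0, 2\<pi>)\<close> is cut into the \<open>m\<close> periods of \<open>c\<^sup>2\<close>, each with one zero of \<open>c\<close> at its
  centre. Where \<open>m |sin x|\<close> is large, geometric sums show that \<open>W\<close> has speed close to
  \<open>m \<surd>(13/12)\<close> (\<open>w_speed\<close>), and on a whole period this contributes \<open>2 \<surd>(13/12)\<close> zeros. For even
  \<open>n\<close> (\<open>even_period_integral\<close>) let \<open>\<epsilon> = m\<^sup>-\<^sup>1\<^sup>/\<^sup>6\<close>. At phase distance at least \<open>\<epsilon>\<close> from the zero of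
  \<open>c\<close>, the summand \<open>a\<^sub>n cos (n x)\<close> changes the speed by a factor \<open>1 + O(\<epsilon>)\<close>; at smaller distance the
  curve sweeps out nearly a half circle, which is the one extra zero. Each period thus contributes
  \<open>1 + 2 \<surd>(13/12) + O(\<epsilon>)\<close>, and the \<open>m\<close> errors add up to \<open>O(m \<epsilon>)\<close>, which has order
  \<open>n\<close> to the power \<open>5/6\<close>.

  Only \<open>O(1/\<epsilon>)\<close> periods, near \<open>0\<close>, \<open>\<pi>\<close> and \<open>2\<pi>\<close>, violate the condition on \<open>m |sin x|\<close>
  (\<open>card_bad_periods\<close>). For them \<open>O(\<surd>m)\<close> expected zeros per period suffice. This follows from Rolle's
  theorem: a function with many zeros in a short interval is tiny on it (\<open>many_zeros_imp_small\<close>), which is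
  unlikely for a Gaussian sum of variance bounded below (\<open>expected_zeros_short\<close>).
\<close>

section \<open>Linear combinations of independent normal variables\<close>

locale gaussian_family = prob_space +
  fixes I :: "'i set" and \<xi> :: "'i \<Rightarrow> 'a \<Rightarrow> real" and \<sigma> :: real
  assumes fin: "finite I"
    and sig: "\<sigma> > 0"
    and indep: "indep_vars (\<lambda>_. borel) \<xi> I"
    and normal: "\<And>i. i \<in> I \<Longrightarrow> distributed M lborel (\<xi> i) (normal_density 0 \<sigma>)"
begin

definition lin :: "('i \<Rightarrow> real) \<Rightarrow> 'a \<Rightarrow> real" where
  "lin c \<omega> = (\<Sum>i\<in>I. c i * \<xi> i \<omega>)"

definition ip :: "('i \<Rightarrow> real) \<Rightarrow> ('i \<Rightarrow> real) \<Rightarrow> real" where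
  "ip u v = (\<Sum>i\<in>I. u i * v i)"

lemma xi_measurable[measurable]: "i \<in> I \<Longrightarrow> \<xi> i \<in> borel_measurable M"
  using normal[of i] by (simp add: distributed_def)

lemma lin_measurable[measurable]: "lin c \<in> borel_measurable M"
  unfolding lin_def by measurable

lemma lin_add: "lin (\<lambda>i. u i + v i) \<omega> = lin u \<omega> + lin v \<omega>"
  by (simp add: lin_def sum.distrib algebra_simps)

lemma lin_scale: "lin (\<lambda>i. c * u i) \<omega> = c * lin u \<omega>"
  by (simp add: lin_def sum_distrib_left algebra_simps)

lemma ip_nonneg: "0 \<le> ip u u"
  by (simp add: ip_def sum_nonneg)

lemma char_xi:
  assumes "i \<in> I"
  shows "char (distr M borel (\<lambda>\<omega>. c * \<xi> i \<omega>)) t = exp (- ((t * c * \<sigma>)\<^sup>2 / 2))"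
proof -
  have "distributed M lborel (\<lambda>\<omega>. (\<xi> i \<omega> - 0) / \<sigma>) std_normal_density"
    using normal_standard_normal_convert[of \<sigma> "\<xi> i" 0] normal[OF assms] sig by simp
  then have d: "distr M lborel (\<lambda>\<omega>. \<xi> i \<omega> / \<sigma>) = std_normal_distribution"
    by (simp add: distributed_def)
  have m[measurable]: "\<xi> i \<in> borel_measurable M" using assms by simp
  have "char (distr M borel (\<lambda>\<omega>. c * \<xi> i \<omega>)) t = (CLINT \<omega>|M. iexp (t * (c * \<xi> i \<omega>)))"
    unfolding char_def by (subst integral_distr) auto
  also have "\<dots> = (CLINT \<omega>|M. iexp ((t * c * \<sigma>) * (\<xi> i \<omega> / \<sigma>)))"
    using sig by (simp add: mult_ac)
  also have "\<dots> = char (distr M lborel (\<lambda>\<omega>. \<xi> i \<omega> / \<sigma>)) (t * c * \<sigma>)"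
    unfolding char_def by (subst integral_distr) auto
  also have "\<dots> = exp (- ((t * c * \<sigma>)\<^sup>2 / 2))"
    unfolding d char_std_normal_distribution by simp
  finally show ?thesis .
qed

lemma char_lin: "(CLINT \<omega>|M. iexp (lin c \<omega>)) = exp (- (\<sigma>\<^sup>2 * ip c c / 2))"
proof -
  have ind: "indep_vars (\<lambda>i. borel) (\<lambda>i \<omega>. c i * \<xi> i \<omega>) I"
    by (rule indep_vars_compose2[OF indep]) auto
  have "(CLINT \<omega>|M. iexp (lin c \<omega>)) = char (distr M borel (lin c)) 1"
    unfolding char_def by (subst integral_distr) auto
  also have "lin c = (\<lambda>\<omega>. \<Sum>i\<in>I. c i * \<xi> i \<omega>)"
    by (simp add: lin_def fun_eq_iff)
  also have "char (distr M borel (\<lambda>\<omega>. \<Sum>i\<in>I. c i * \<xi> i \<omega>)) 1 = (\<Prod>i\<in>I. char (distr M borel (\<lambda>\<omega>. c i * \<xi> i \<omega>)) 1)"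
    by (rule char_distr_sum[OF ind])
  also have "\<dots> = (\<Prod>i\<in>I. complex_of_real (exp (- ((c i * \<sigma>)\<^sup>2 / 2))))"
    by (intro prod.cong refl) (subst char_xi, auto)
  also have "\<dots> = complex_of_real (exp (\<Sum>i\<in>I. - ((c i * \<sigma>)\<^sup>2 / 2)))"
    by (simp add: exp_sum[OF fin])
  also have "(\<Sum>i\<in>I. - ((c i * \<sigma>)\<^sup>2 / 2)) = - (\<sigma>\<^sup>2 * ip c c / 2)"
    by (simp add: ip_def sum_negf sum_distrib_left sum_divide_distrib power2_eq_square mult_ac)
  finally show ?thesis by (simp add: lin_def)
qed

lemma distr_lin:
  assumes "ip c c = 1"
  shows "distr M borel (\<lambda>\<omega>. lin c \<omega> / \<sigma>) = std_normal_distribution"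
proof (rule Levy_uniqueness)
  have [simp]: "real_distribution N = (prob_space N \<and> sets N = sets borel)" for N
    by (simp add: real_distribution_def real_distribution_axioms_def)
  show "real_distribution (distr M borel (\<lambda>\<omega>. lin c \<omega> / \<sigma>))"
    by (simp add: prob_space_distr)
  show "real_distribution std_normal_distribution"
    by (rule real_dist_normal_dist)
  show "char (distr M borel (\<lambda>\<omega>. lin c \<omega> / \<sigma>)) = char std_normal_distribution"
  proof
    fix t
    have "char (distr M borel (\<lambda>\<omega>. lin c \<omega> / \<sigma>)) t = (CLINT \<omega>|M. iexp (lin (\<lambda>i. t / \<sigma> * c i) \<omega>))"
      unfolding char_def lin_scale by (subst integral_distr) (auto simp: mult_ac)
    also have "\<dots> = exp (- (\<sigma>\<^sup>2 * ip (\<lambda>i. t / \<sigma> * c i) (\<lambda>i. t / \<sigma> * c i) / 2))"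
      by (rule char_lin)
    also have "ip (\<lambda>i. t / \<sigma> * c i) (\<lambda>i. t / \<sigma> * c i) = (t / \<sigma>)\<^sup>2 * ip c c"
      by (simp add: ip_def sum_distrib_left power2_eq_square mult_ac)
    finally show "char (distr M borel (\<lambda>\<omega>. lin c \<omega> / \<sigma>)) t = char std_normal_distribution t"
      using sig by (simp add: assms char_std_normal_distribution power_divide)
  qed
qed

lemma char_joint:
  assumes "ip u u = 1" "ip v v = 1" "ip u v = 0"
  shows "(CLINT \<omega>|M. iexp (t * (lin u \<omega> / \<sigma>) + s * (lin v \<omega> / \<sigma>))) = exp (- ((t\<^sup>2 + s\<^sup>2) / 2))"
proof -
  have "(CLINT \<omega>|M. iexp (t * (lin u \<omega> / \<sigma>) + s * (lin v \<omega> / \<sigma>)))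
     = (CLINT \<omega>|M. iexp (lin (\<lambda>i. t / \<sigma> * u i + s / \<sigma> * v i) \<omega>))"
    unfolding lin_add lin_scale by simp
  also have "\<dots> = exp (- (\<sigma>\<^sup>2 * ip (\<lambda>i. t / \<sigma> * u i + s / \<sigma> * v i) (\<lambda>i. t / \<sigma> * u i + s / \<sigma> * v i) / 2))"
    by (rule char_lin)
  also have "ip (\<lambda>i. t / \<sigma> * u i + s / \<sigma> * v i) (\<lambda>i. t / \<sigma> * u i + s / \<sigma> * v i)
     = (t / \<sigma>)\<^sup>2 * ip u u + 2 * (t / \<sigma>) * (s / \<sigma>) * ip u v + (s / \<sigma>)\<^sup>2 * ip v v"
    unfolding ip_def sum_distrib_left sum.distrib[symmetric]
    by (intro sum.cong refl) (simp add: power2_eq_square algebra_simps)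
  also have "\<dots> = (t\<^sup>2 + s\<^sup>2) / \<sigma>\<^sup>2"
    by (simp add: assms power_divide add_divide_distrib)
  also have "\<sigma>\<^sup>2 * ((t\<^sup>2 + s\<^sup>2) / \<sigma>\<^sup>2) / 2 = (t\<^sup>2 + s\<^sup>2) / 2"
    using sig by simp
  finally show ?thesis .
qed

text \<open>
  Independence of two variables \<open>X\<close> and \<open>Z\<close> will be derived from one-dimensional characteristic functions only.
  The device is to reweight the probability measure by a nonnegative function \<open>g\<close> (of \<open>Z\<close>): if the reweighted
  characteristic function of \<open>X\<close> is a multiple of that of \<open>\<mu>\<close>, then Levy's uniqueness theorem makes the
  reweighted law of \<open>X\<close> the same multiple of \<open>\<mu>\<close>.
\<close>

lemma weighted_law:
  fixes X g :: "'a \<Rightarrow> real" and \<mu> :: "real measure"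
  assumes [measurable]: "X \<in> borel_measurable M" and g: "integrable M g" "\<And>\<omega>. 0 \<le> g \<omega>"
    and k: "\<kappa> > 0" and mu: "real_distribution \<mu>"
    and ch: "\<And>t. (CLINT \<omega>|M. g \<omega> * iexp (t * X \<omega>)) = \<kappa> * char \<mu> t"
    and B[measurable]: "B \<in> sets borel"
  shows "(LINT \<omega>|M. g \<omega> * indicator B (X \<omega>)) = \<kappa> * measure \<mu> B"
proof -
  interpret mu: real_distribution \<mu> by (rule mu)
  have [measurable]: "g \<in> borel_measurable M" using g by auto
  have "complex_of_real (LINT \<omega>|M. g \<omega>) = complex_of_real \<kappa>"
    using ch[of 0] mu.char_zero by simp
  then have Eg: "(LINT \<omega>|M. g \<omega>) = \<kappa>"
    by (simp only: of_real_eq_iff)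
  let ?D = "density M (\<lambda>\<omega>. ennreal (g \<omega> / \<kappa>))"
  let ?N = "distr ?D borel X"
  have "emeasure ?D (space M) = (\<integral>\<^sup>+\<omega>. ennreal (g \<omega> / \<kappa>) \<partial>M)"
    by (subst emeasure_density) (auto intro!: nn_integral_cong)
  also have "\<dots> = ennreal (LINT \<omega>|M. g \<omega> / \<kappa>)"
    using g k by (intro nn_integral_eq_integral) auto
  also have "\<dots> = 1" using Eg k by simp
  finally interpret D: prob_space ?D
    by (intro prob_spaceI) simp
  have N: "real_distribution ?N"
    by (simp add: real_distribution_def real_distribution_axioms_def D.prob_space_distr)
  interpret N: real_distribution ?N by (rule N)
  have "?N = \<mu>"
  proof (rule Levy_uniqueness[OF N mu], rule ext)
    fix t
    have "char ?N t = (CLINT \<omega>|?D. iexp (t * X \<omega>))"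
      unfolding char_def by (subst integral_distr) auto
    also have "\<dots> = (CLINT \<omega>|M. (g \<omega> / \<kappa>) *\<^sub>R iexp (t * X \<omega>))"
      using g k by (subst integral_density) auto
    also have "\<dots> = (CLINT \<omega>|M. (1 / \<kappa>) * (g \<omega> * iexp (t * X \<omega>)))"
      by (simp add: scaleR_conv_of_real)
    also have "\<dots> = (1 / \<kappa>) * (\<kappa> * char \<mu> t)"
      unfolding ch[symmetric] by (rule integral_mult_right_zero)
    finally show "char ?N t = char \<mu> t" using k by simp
  qed
  then have "measure \<mu> B = (LINT x|?N. indicator B x)"
    by (simp add: measure_def)
  also have "\<dots> = (LINT \<omega>|?D. indicator B (X \<omega>))"
    by (subst integral_distr) auto
  also have "\<dots> = (LINT \<omega>|M. (g \<omega> / \<kappa>) *\<^sub>R indicator B (X \<omega>))"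
    using g k by (subst integral_density) auto
  also have "\<dots> = (LINT \<omega>|M. (1 / \<kappa>) * (g \<omega> * indicator B (X \<omega>)))"
    by simp
  also have "\<dots> = (1 / \<kappa>) * (LINT \<omega>|M. g \<omega> * indicator B (X \<omega>))"
    by (rule integral_mult_right_zero)
  finally show ?thesis using k by simp
qed

lemma integrable_bounded:
  fixes f :: "'a \<Rightarrow> 'b::{banach, second_countable_topology}"
  assumes "f \<in> borel_measurable M" "\<And>\<omega>. norm (f \<omega>) \<le> B"
  shows "integrable M f"
  using assms by (intro integrable_const_bound[of _ B]) auto

text \<open>
  Uncorrelated linear combinations of independent normal variables are independent. The lemma
  \<open>weighted_law\<close> is used twice: with the weights \<open>1 + cos (s Z)\<close> and \<open>1 + sin (s Z)\<close> it shows that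
  \<open>Z\<close> has the same characteristic function on each event \<open>X \<in> A\<close> as on the whole space; with the weight
  \<open>1\<close> on \<open>X \<in> A\<close> and \<open>0\<close> elsewhere it then identifies the law of \<open>Z\<close> given \<open>X \<in> A\<close>.
\<close>

lemma joint_law_orthogonal:
  assumes uv: "ip u u = 1" "ip v v = 1" "ip u v = 0"
  shows "distr M (borel \<Otimes>\<^sub>M borel) (\<lambda>\<omega>. (lin u \<omega> / \<sigma>, lin v \<omega> / \<sigma>))
    = std_normal_distribution \<Otimes>\<^sub>M std_normal_distribution"
proof -
  let ?X = "\<lambda>\<omega>. lin u \<omega> / \<sigma>" and ?Z = "\<lambda>\<omega>. lin v \<omega> / \<sigma>"
  let ?n = "std_normal_distribution"
  have char_n: "char ?n t = complex_of_real (exp (- (t\<^sup>2 / 2)))" for t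
    by (simp add: char_std_normal_distribution)
  have J: "(CLINT \<omega>|M. iexp (t * ?X \<omega> + s * ?Z \<omega>)) = exp (- (t\<^sup>2 / 2)) * exp (- (s\<^sup>2 / 2))" for s t
    using char_joint[OF uv, of t s] by (simp add: exp_add[symmetric] add_divide_distrib)
  have int: "integrable M (\<lambda>\<omega>. iexp (t * ?X \<omega> + s * ?Z \<omega>))" for s t
    by (rule integrable_iexp) auto
  have JJ: "(CLINT \<omega>|M. c * iexp (t * ?X \<omega> + s * ?Z \<omega>)) = c * (exp (- (t\<^sup>2 / 2)) * exp (- (s\<^sup>2 / 2)))" for s t c
    by (simp only: integral_mult_right_zero J)
  have X: "(CLINT \<omega>|M. iexp (t * ?X \<omega>)) = exp (- (t\<^sup>2 / 2))" for t
    using J[of t 0] by simp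
  have intX: "integrable M (\<lambda>\<omega>. iexp (t * ?X \<omega>))" for t
    using int[of t 0] by simp
  have ex_cos: "complex_of_real (1 + cos b) * iexp a = iexp a + ((1/2) * iexp (a + b) + (1/2) * iexp (a - b))"
    and ex_sin: "complex_of_real (1 + sin b) * iexp a = iexp a + ((-\<i>/2) * iexp (a + b) + (\<i>/2) * iexp (a - b))" for a b :: real
    unfolding cis_conv_exp[symmetric]
    by (simp_all add: complex_eq_iff cos_add cos_diff sin_add sin_diff field_simps)
  have ex_iexp: "complex_of_real a * iexp b = complex_of_real (cos b * a) + \<i> * complex_of_real (sin b * a)" for a b :: real
    unfolding cis_conv_exp[symmetric] by (simp add: complex_eq_iff)
  have cosint: "(CLINT \<omega>|M. complex_of_real (1 + cos (s * ?Z \<omega>)) * iexp (t * ?X \<omega>))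
      = complex_of_real (1 + exp (- (s\<^sup>2 / 2))) * char ?n t" for s t
  proof -
    have "complex_of_real (1 + cos (s * ?Z \<omega>)) * iexp (t * ?X \<omega>)
       = iexp (t * ?X \<omega>) + ((1/2) * iexp (t * ?X \<omega> + s * ?Z \<omega>) + (1/2) * iexp (t * ?X \<omega> + (-s) * ?Z \<omega>))" for \<omega>
      using ex_cos[of "s * ?Z \<omega>" "t * ?X \<omega>"] by simp
    then have "(CLINT \<omega>|M. complex_of_real (1 + cos (s * ?Z \<omega>)) * iexp (t * ?X \<omega>))
      = (CLINT \<omega>|M. iexp (t * ?X \<omega>) + ((1/2) * iexp (t * ?X \<omega> + s * ?Z \<omega>) + (1/2) * iexp (t * ?X \<omega> + (-s) * ?Z \<omega>)))"
      by presburger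
    also have "\<dots> = (CLINT \<omega>|M. iexp (t * ?X \<omega>)) + ((CLINT \<omega>|M. (1/2) * iexp (t * ?X \<omega> + s * ?Z \<omega>))
         + (CLINT \<omega>|M. (1/2) * iexp (t * ?X \<omega> + (-s) * ?Z \<omega>)))"
      using int intX by (simp only: Bochner_Integration.integral_add integrable_mult_right Bochner_Integration.integrable_add)
    also have "\<dots> = (1 + exp (- (s\<^sup>2 / 2))) * char ?n t"
      unfolding JJ X char_n by (simp add: algebra_simps)
    finally show ?thesis .
  qed
  have sinint: "(CLINT \<omega>|M. complex_of_real (1 + sin (s * ?Z \<omega>)) * iexp (t * ?X \<omega>)) = 1 * char ?n t" for s t
  proof -
    have "complex_of_real (1 + sin (s * ?Z \<omega>)) * iexp (t * ?X \<omega>)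
       = iexp (t * ?X \<omega>) + ((-\<i>/2) * iexp (t * ?X \<omega> + s * ?Z \<omega>) + (\<i>/2) * iexp (t * ?X \<omega> + (-s) * ?Z \<omega>))" for \<omega>
      using ex_sin[of "s * ?Z \<omega>" "t * ?X \<omega>"] by simp
    then have "(CLINT \<omega>|M. complex_of_real (1 + sin (s * ?Z \<omega>)) * iexp (t * ?X \<omega>))
      = (CLINT \<omega>|M. iexp (t * ?X \<omega>) + ((-\<i>/2) * iexp (t * ?X \<omega> + s * ?Z \<omega>) + (\<i>/2) * iexp (t * ?X \<omega> + (-s) * ?Z \<omega>)))"
      by presburger
    also have "\<dots> = (CLINT \<omega>|M. iexp (t * ?X \<omega>)) + ((CLINT \<omega>|M. (-\<i>/2) * iexp (t * ?X \<omega> + s * ?Z \<omega>))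
         + (CLINT \<omega>|M. (\<i>/2) * iexp (t * ?X \<omega> + (-s) * ?Z \<omega>)))"
      using int intX by (simp only: Bochner_Integration.integral_add integrable_mult_right Bochner_Integration.integrable_add)
    also have "\<dots> = 1 * char ?n t"
      unfolding JJ X char_n by (simp add: algebra_simps)
    finally show ?thesis .
  qed
  have n: "real_distribution ?n" by (rule real_dist_normal_dist)
  interpret n: real_distribution ?n by (rule n)
  have lawX: "distr M borel ?X = ?n" and lawZ: "distr M borel ?Z = ?n"
    using distr_lin uv by auto
  have m[measurable]: "?X \<in> borel_measurable M" "?Z \<in> borel_measurable M" by auto
  have main: "prob ((?X -` A \<inter> space M) \<inter> (?Z -` B \<inter> space M)) = measure ?n A * measure ?n B"
    if A[measurable]: "A \<in> sets borel" and B[measurable]: "B \<in> sets borel" for A B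
  proof -
    let ?iA = "\<lambda>\<omega>. indicator A (?X \<omega>) :: real"
    have iA: "integrable M ?iA"
      by (rule integrable_bounded[of _ 1]) (auto split: split_indicator)
    have EA: "(LINT \<omega>|M. ?iA \<omega>) = measure ?n A"
    proof -
      have "(LINT \<omega>|M. ?iA \<omega>) = (LINT x|distr M borel ?X. indicator A x)"
        by (subst integral_distr) auto
      also have "\<dots> = measure ?n A" unfolding lawX by simp
      finally show ?thesis .
    qed
    have ic: "integrable M (\<lambda>\<omega>. f (s * ?Z \<omega>) * ?iA \<omega>)" if "f = cos \<or> f = (sin :: real \<Rightarrow> real)" for f s
      using that by (intro integrable_bounded[of _ 1]) (auto split: split_indicator)
    have C: "(LINT \<omega>|M. cos (s * ?Z \<omega>) * ?iA \<omega>) = exp (- (s\<^sup>2 / 2)) * measure ?n A" for s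
    proof -
      have "(LINT \<omega>|M. (1 + cos (s * ?Z \<omega>)) * ?iA \<omega>) = (1 + exp (- (s\<^sup>2 / 2))) * measure ?n A"
      proof (rule weighted_law[OF _ _ _ _ n _ A])
        show "integrable M (\<lambda>\<omega>. 1 + cos (s * ?Z \<omega>))"
          by (rule integrable_bounded[of _ 2]) (auto intro!: order_trans[OF abs_triangle_ineq] simp: abs_cos_le_one order_trans[OF abs_cos_le_one])
        show "0 \<le> 1 + cos (s * ?Z \<omega>)" for \<omega>
          using cos_ge_minus_one[of "s * ?Z \<omega>"] by linarith
        show "0 < 1 + exp (- (s\<^sup>2 / 2))" by (simp add: add_pos_pos)
      qed (use cosint in simp_all)
      moreover have "(LINT \<omega>|M. (1 + cos (s * ?Z \<omega>)) * ?iA \<omega>) = (LINT \<omega>|M. ?iA \<omega> + cos (s * ?Z \<omega>) * ?iA \<omega>)"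
        by (simp add: algebra_simps)
      moreover have "\<dots> = (LINT \<omega>|M. ?iA \<omega>) + (LINT \<omega>|M. cos (s * ?Z \<omega>) * ?iA \<omega>)"
        using iA ic by (intro Bochner_Integration.integral_add) auto
      ultimately show ?thesis using EA by (simp add: algebra_simps)
    qed
    have S: "(LINT \<omega>|M. sin (s * ?Z \<omega>) * ?iA \<omega>) = 0" for s
    proof -
      have "(LINT \<omega>|M. (1 + sin (s * ?Z \<omega>)) * ?iA \<omega>) = 1 * measure ?n A"
      proof (rule weighted_law[OF _ _ _ _ n _ A])
        show "integrable M (\<lambda>\<omega>. 1 + sin (s * ?Z \<omega>))"
          by (rule integrable_bounded[of _ 2]) (auto intro!: order_trans[OF abs_triangle_ineq] simp: abs_sin_le_one order_trans[OF abs_sin_le_one])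
        show "0 \<le> 1 + sin (s * ?Z \<omega>)" for \<omega>
          using sin_ge_minus_one[of "s * ?Z \<omega>"] by linarith
      qed (use sinint in simp_all)
      moreover have "(LINT \<omega>|M. (1 + sin (s * ?Z \<omega>)) * ?iA \<omega>) = (LINT \<omega>|M. ?iA \<omega> + sin (s * ?Z \<omega>) * ?iA \<omega>)"
        by (simp add: algebra_simps)
      moreover have "\<dots> = (LINT \<omega>|M. ?iA \<omega>) + (LINT \<omega>|M. sin (s * ?Z \<omega>) * ?iA \<omega>)"
        using iA ic by (intro Bochner_Integration.integral_add) auto
      ultimately show ?thesis using EA by simp
    qed
    have P: "prob ((?X -` A \<inter> space M) \<inter> (?Z -` B \<inter> space M)) = (LINT \<omega>|M. ?iA \<omega> * indicator B (?Z \<omega>))"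
    proof -
      have "prob ((?X -` A \<inter> space M) \<inter> (?Z -` B \<inter> space M))
        = (LINT \<omega>|M. indicator ((?X -` A \<inter> space M) \<inter> (?Z -` B \<inter> space M)) \<omega>)"
        by (subst Bochner_Integration.integral_indicator) (auto simp: Int_ac)
      also have "\<dots> = (LINT \<omega>|M. ?iA \<omega> * indicator B (?Z \<omega>))"
        by (intro Bochner_Integration.integral_cong) (auto split: split_indicator)
      finally show ?thesis .
    qed
    show ?thesis
    proof (cases "measure ?n A = 0")
      case True
      have "(LINT \<omega>|M. ?iA \<omega> * indicator B (?Z \<omega>)) \<le> (LINT \<omega>|M. ?iA \<omega>)"
        using iA by (intro integral_mono integrable_bounded[of _ 1]) (auto split: split_indicator)
      moreover have "0 \<le> (LINT \<omega>|M. ?iA \<omega> * indicator B (?Z \<omega>))"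
        by (intro Bochner_Integration.integral_nonneg) auto
      ultimately show ?thesis using True P EA by simp
    next
      case False
      have "(LINT \<omega>|M. ?iA \<omega> * indicator B (?Z \<omega>)) = measure ?n A * measure ?n B"
      proof (rule weighted_law[OF _ iA _ _ n _ B])
        show "0 < measure ?n A" using False by (simp add: zero_less_measure_iff)
        fix s
        have ic': "integrable M (\<lambda>\<omega>. complex_of_real (f (s * ?Z \<omega>) * ?iA \<omega>))" if "f = cos \<or> f = (sin :: real \<Rightarrow> real)" for f
          using ic[OF that] by (rule integrable_of_real)
        have "(CLINT \<omega>|M. complex_of_real (?iA \<omega>) * iexp (s * ?Z \<omega>))
          = (CLINT \<omega>|M. complex_of_real (cos (s * ?Z \<omega>) * ?iA \<omega>) + \<i> * complex_of_real (sin (s * ?Z \<omega>) * ?iA \<omega>))"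
          by (intro Bochner_Integration.integral_cong refl ex_iexp)
        also have "\<dots> = (CLINT \<omega>|M. complex_of_real (cos (s * ?Z \<omega>) * ?iA \<omega>)) + \<i> * (CLINT \<omega>|M. complex_of_real (sin (s * ?Z \<omega>) * ?iA \<omega>))"
          by (subst Bochner_Integration.integral_add[OF ic' integrable_mult_right[OF ic']])
             (simp_all only: integral_mult_right_zero simp_thms)
        also have "\<dots> = measure ?n A * char ?n s"
          unfolding integral_complex_of_real C S char_n by simp
        finally show "(CLINT \<omega>|M. complex_of_real (?iA \<omega>) * iexp (s * ?Z \<omega>)) = measure ?n A * char ?n s" .
      qed auto
      then show ?thesis using P by simp
    qed
  qed
  show ?thesis
  proof (rule pair_measure_eqI[symmetric])
    show "sigma_finite_measure ?n" by unfold_locales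
    show "sigma_finite_measure ?n" by unfold_locales
    show "sets (?n \<Otimes>\<^sub>M ?n) = sets (distr M (borel \<Otimes>\<^sub>M borel) (\<lambda>\<omega>. (?X \<omega>, ?Z \<omega>)))"
      unfolding sets_distr by (rule sets_pair_measure_cong) auto
  next
    fix A B assume "A \<in> sets ?n" "B \<in> sets ?n"
    then have [measurable]: "A \<in> sets borel" "B \<in> sets borel" by auto
    have "emeasure (distr M (borel \<Otimes>\<^sub>M borel) (\<lambda>\<omega>. (?X \<omega>, ?Z \<omega>))) (A \<times> B)
       = emeasure M ((?X -` A \<inter> space M) \<inter> (?Z -` B \<inter> space M))"
      by (subst emeasure_distr) (auto intro!: arg_cong[where f="emeasure M"])
    also have "\<dots> = ennreal (measure ?n A * measure ?n B)"
      using main[of A B] by (simp add: emeasure_eq_measure)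
    finally show "emeasure ?n A * emeasure ?n B = emeasure (distr M (borel \<Otimes>\<^sub>M borel) (\<lambda>\<omega>. (?X \<omega>, ?Z \<omega>))) (A \<times> B)"
      by (simp add: n.emeasure_eq_measure ennreal_mult)
  qed
qed

end

section \<open>The probability of a sign change\<close>

text \<open>
  The ratio of two independent standard normal variables has the Cauchy density.
\<close>

lemma nn_integral_std_density_pair:
  "(\<integral>\<^sup>+x. ennreal (std_normal_density x) * (ennreal \<bar>x\<bar> * ennreal (std_normal_density (- x * t))) \<partial>lborel)
   = ennreal (1 / (pi * (1 + t\<^sup>2)))"
proof -
  define s where "s = sqrt (1 + t\<^sup>2)"
  have s: "s > 0" "s\<^sup>2 = 1 + t\<^sup>2" by (auto simp: s_def add_pos_nonneg)
  have "has_bochner_integral lborel (\<lambda>x. std_normal_density x * \<bar>x\<bar> ^ (2 * 0 + 1)) (sqrt (2 / pi) * 2 ^ 0 * fact 0)"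
    by (rule std_normal_moment_abs_odd)
  then have h: "(\<integral>\<^sup>+x. ennreal (std_normal_density x * \<bar>x\<bar>) \<partial>lborel) = ennreal (sqrt (2 / pi))"
    by (subst nn_integral_eq_integral) (auto simp: has_bochner_integral_iff)
  have e: "std_normal_density x * std_normal_density (- x * t) = std_normal_density (s * x) / sqrt (2 * pi)" for x
    by (simp add: std_normal_density_def exp_add[symmetric] power_mult_distrib s field_simps)
  have "ennreal (sqrt (2 / pi)) = ennreal \<bar>s\<bar> * (\<integral>\<^sup>+x. ennreal (std_normal_density (0 + s * x) * \<bar>0 + s * x\<bar>) \<partial>lborel)"
    unfolding h[symmetric] using s by (intro nn_integral_real_affine) auto
  also have "\<dots> = ennreal s * (\<integral>\<^sup>+x. ennreal (s * sqrt (2 * pi)) * (ennreal (std_normal_density x) * (ennreal \<bar>x\<bar> * ennreal (std_normal_density (- x * t)))) \<partial>lborel)"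
  proof -
    have "std_normal_density (0 + s * x) * \<bar>0 + s * x\<bar> = s * sqrt (2 * pi) * (std_normal_density x * (\<bar>x\<bar> * std_normal_density (- x * t)))" for x
      using e[of x] s by (simp add: abs_mult field_simps)
    then show ?thesis using s by (simp add: ennreal_mult[symmetric] del: mult_minus_left)
  qed
  also have "\<dots> = ennreal s * (ennreal (s * sqrt (2 * pi)) * (\<integral>\<^sup>+x. (ennreal (std_normal_density x) * (ennreal \<bar>x\<bar> * ennreal (std_normal_density (- x * t)))) \<partial>lborel))"
    by (subst nn_integral_cmult) auto
  also have "\<dots> = ennreal (s\<^sup>2 * sqrt (2 * pi)) * (\<integral>\<^sup>+x. (ennreal (std_normal_density x) * (ennreal \<bar>x\<bar> * ennreal (std_normal_density (- x * t)))) \<partial>lborel)"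
  proof -
    have "ennreal s * (ennreal (s * sqrt (2 * pi)) * J) = ennreal (s\<^sup>2 * sqrt (2 * pi)) * J" for J
    proof -
      have "ennreal s * (ennreal (s * sqrt (2 * pi)) * J) = (ennreal s * ennreal (s * sqrt (2 * pi))) * J"
        by (simp only: mult.assoc)
      also have "ennreal s * ennreal (s * sqrt (2 * pi)) = ennreal (s * (s * sqrt (2 * pi)))"
        using s(1) by (intro ennreal_mult[symmetric]) auto
      finally show ?thesis by (simp only: power2_eq_square mult.assoc)
    qed
    then show ?thesis .
  qed
  finally have eq: "ennreal (sqrt (2 / pi)) = ennreal (s\<^sup>2 * sqrt (2 * pi)) * (\<integral>\<^sup>+x. (ennreal (std_normal_density x) * (ennreal \<bar>x\<bar> * ennreal (std_normal_density (- x * t)))) \<partial>lborel)"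
    (is "_ = _ * ?J") .
  have c: "s\<^sup>2 * sqrt (2 * pi) > 0" using s(1) by simp
  have "?J = ennreal (1 / (s\<^sup>2 * sqrt (2 * pi))) * (ennreal (s\<^sup>2 * sqrt (2 * pi)) * ?J)"
    using c s(1) by (simp add: mult.assoc[symmetric] ennreal_mult[symmetric] del: mult_minus_left)
  also have "\<dots> = ennreal (1 / (s\<^sup>2 * sqrt (2 * pi)) * sqrt (2 / pi))"
    unfolding eq[symmetric] using c by (intro ennreal_mult[symmetric]) auto
  also have "1 / (s\<^sup>2 * sqrt (2 * pi)) * sqrt (2 / pi) = 1 / (pi * (1 + t\<^sup>2))"
  proof -
    have "sqrt (2 / pi) = sqrt (2 * pi) / pi"
      by (simp add: real_sqrt_divide real_sqrt_mult real_div_sqrt field_simps)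
    moreover have "1 / (s\<^sup>2 * r) * (r / pi) = 1 / (pi * s\<^sup>2)" if "r > 0" for r
      using that by simp
    ultimately show ?thesis using s(2) by simp
  qed
  finally show ?thesis .
qed

lemma wedge_measurable:
  fixes k :: real
  shows "{p. fst p * (k * fst p + snd p) < 0} \<in> sets (borel \<Otimes>\<^sub>M borel)"
proof -
  have "{p \<in> space (borel \<Otimes>\<^sub>M borel). fst p * (k * fst p + snd p) < 0} \<in> sets (borel \<Otimes>\<^sub>M borel)"
    by measurable
  then show ?thesis by (simp add: space_pair_measure)
qed

text \<open>
  The wedge is a condition on \<open>-z/x\<close> alone, so substituting \<open>z = - x t\<close> and integrating out \<open>x\<close> leaves a
  tail of the Cauchy distribution. The minus sign makes it an upper tail.
\<close>

lemma std_normal_wedge: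
  "emeasure (std_normal_distribution \<Otimes>\<^sub>M std_normal_distribution) {p. fst p * (k * fst p + snd p) < 0}
   = ennreal ((pi / 2 - arctan k) / pi)"
proof -
  let ?n = std_normal_distribution
  let ?f = "\<lambda>x. ennreal (std_normal_density x)"
  interpret n: prob_space ?n by (rule prob_space_normal_density) simp
  note S[measurable] = wedge_measurable[of k]
  have sets_nn: "sets (?n \<Otimes>\<^sub>M ?n) = sets (borel \<Otimes>\<^sub>M borel)"
    by (rule sets_pair_measure_cong) auto
  let ?S = "{p. fst p * (k * fst p + snd p) < 0}"
  have e1: "emeasure (?n \<Otimes>\<^sub>M ?n) ?S = (\<integral>\<^sup>+x. \<integral>\<^sup>+z. indicator ?S (x, z) \<partial>?n \<partial>?n)"
    using S by (intro n.emeasure_pair_measure) (simp add: sets_nn)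
  have inner: "(\<integral>\<^sup>+z. indicator ?S (x, z) \<partial>?n) = (\<integral>\<^sup>+z. ?f z * indicator ?S (x, z) \<partial>lborel)" for x
    by (rule nn_integral_density) measurable
  have e2: "(\<integral>\<^sup>+x. \<integral>\<^sup>+z. indicator ?S (x, z) \<partial>?n \<partial>?n) = (\<integral>\<^sup>+x. ?f x * (\<integral>\<^sup>+z. ?f z * indicator ?S (x, z) \<partial>lborel) \<partial>lborel)"
    unfolding inner by (rule nn_integral_density) measurable
  have e3: "(\<integral>\<^sup>+x. ?f x * (\<integral>\<^sup>+z. ?f z * indicator ?S (x, z) \<partial>lborel) \<partial>lborel)
    = (\<integral>\<^sup>+x. (\<integral>\<^sup>+t. ?f x * (ennreal \<bar>x\<bar> * ?f (- x * t)) * indicator {k<..} t \<partial>lborel) \<partial>lborel)"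
  proof (rule nn_integral_cong_AE)
    have "AE x in lborel. x \<noteq> (0::real)" by (rule AE_lborel_singleton)
    then show "AE x in lborel. ?f x * (\<integral>\<^sup>+z. ?f z * indicator ?S (x, z) \<partial>lborel)
      = (\<integral>\<^sup>+t. ?f x * (ennreal \<bar>x\<bar> * ?f (- x * t)) * indicator {k<..} t \<partial>lborel)"
    proof eventually_elim
      fix x :: real assume x: "x \<noteq> 0"
      have iff: "x * (k * x + - x * t) < 0 \<longleftrightarrow> k < t" for t
      proof -
        have "x * (k * x + - x * t) = (k - t) * x\<^sup>2" by (simp add: power2_eq_square algebra_simps)
        moreover have "x\<^sup>2 > 0" using x by simp
        ultimately show ?thesis by (simp add: mult_less_0_iff)
      qed
      have "(\<integral>\<^sup>+z. ?f z * indicator ?S (x, z) \<partial>lborel)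
        = ennreal \<bar>-x\<bar> * (\<integral>\<^sup>+t. ?f (0 + -x * t) * indicator ?S (x, 0 + -x * t) \<partial>lborel)"
        using x by (intro nn_integral_real_affine) auto
      also have "\<dots> = ennreal \<bar>x\<bar> * (\<integral>\<^sup>+t. ?f (-x * t) * indicator {k<..} t \<partial>lborel)"
        using iff by (intro arg_cong2[where f="(*)"] nn_integral_cong) (auto split: split_indicator)
      finally show "?f x * (\<integral>\<^sup>+z. ?f z * indicator ?S (x, z) \<partial>lborel)
         = (\<integral>\<^sup>+t. ?f x * (ennreal \<bar>x\<bar> * ?f (- x * t)) * indicator {k<..} t \<partial>lborel)"
        by (simp add: nn_integral_cmult[symmetric] mult_ac)
    qed
  qed
  have "(\<integral>\<^sup>+x. (\<integral>\<^sup>+t. ?f x * (ennreal \<bar>x\<bar> * ?f (- x * t)) * indicator {k<..} t \<partial>lborel) \<partial>lborel)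
    = (\<integral>\<^sup>+t. (\<integral>\<^sup>+x. ?f x * (ennreal \<bar>x\<bar> * ?f (- x * t)) * indicator {k<..} t \<partial>lborel) \<partial>lborel)"
    by (rule lborel_pair.Fubini') measurable
  also have "\<dots> = (\<integral>\<^sup>+t. ennreal (1 / (pi * (1 + t\<^sup>2))) * indicator {k<..} t \<partial>lborel)"
    unfolding nn_integral_std_density_pair[symmetric]
    by (intro nn_integral_cong) (simp add: nn_integral_multc)
  also have "\<dots> = (\<integral>\<^sup>+t. ennreal (1 / (pi * (1 + t\<^sup>2))) * indicator {k..} t \<partial>lborel)"
    by (intro nn_integral_cong_AE eventually_mono[OF AE_lborel_singleton[of k]]) (auto split: split_indicator)
  also have "\<dots> = ennreal (1 / 2 - arctan k / pi)"
  proof (rule nn_integral_FTC_atLeast)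
    show "DERIV (\<lambda>t. arctan t / pi) x :> 1 / (pi * (1 + x\<^sup>2))" for x
      by (rule DERIV_cong[OF DERIV_cdivide[OF DERIV_arctan]]) (simp add: divide_inverse)
    show "((\<lambda>t. arctan t / pi) \<longlongrightarrow> 1 / 2) at_top"
      using tendsto_divide[OF tendsto_arctan_at_top tendsto_const[of pi]] by simp
  qed auto
  also have "1 / 2 - arctan k / pi = (pi / 2 - arctan k) / pi" by (simp add: field_simps)
  finally show ?thesis unfolding e1 e2 e3 .
qed

context gaussian_family
begin

lemma ip_add_scale: "ip u (\<lambda>i. v i + c * w i) = ip u v + c * ip u w"
  by (simp add: ip_def sum.distrib sum_distrib_left algebra_simps)

lemma ip_scale: "ip (\<lambda>i. a * u i) (\<lambda>i. b * v i) = a * b * ip u v"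
  by (simp add: ip_def sum_distrib_left algebra_simps)

lemma ip_self_eq_0: "ip u u = 0 \<longleftrightarrow> (\<forall>i\<in>I. u i = 0)"
  using fin by (simp add: ip_def sum_nonneg_eq_0_iff)

text \<open>
  The Gram determinant of two vectors, i.e. \<open>(|u| |v| sin \<theta>)\<^sup>2\<close> with \<open>\<theta>\<close> the angle between them.
\<close>

definition gram :: "('i \<Rightarrow> real) \<Rightarrow> ('i \<Rightarrow> real) \<Rightarrow> real" where
  "gram u v = ip u u * ip v v - (ip u v)\<^sup>2"

text \<open>
  Squared length of the component of \<open>v\<close> orthogonal to \<open>u\<close>.
\<close>

lemma gram_residual:
  assumes "ip u u > 0"
  shows "ip (\<lambda>i. v i - ip u v / ip u u * u i) (\<lambda>i. v i - ip u v / ip u u * u i) = gram u v / ip u u"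
proof -
  define l where "l = ip u v / ip u u"
  have "ip (\<lambda>i. v i - l * u i) (\<lambda>i. v i - l * u i) = ip v v - 2 * l * ip u v + l\<^sup>2 * ip u u"
    unfolding ip_def sum_distrib_left sum.distrib[symmetric] sum_subtractf[symmetric]
    by (intro sum.cong refl) (simp add: power2_eq_square algebra_simps)
  also have "\<dots> = gram u v / ip u u"
    using assms by (simp add: l_def gram_def field_simps power2_eq_square)
  finally show ?thesis by (simp add: l_def)
qed

lemma gram_nonneg: "0 \<le> gram u v"
proof (cases "ip u u = 0")
  case True
  then have "ip u v = 0" using ip_self_eq_0[of u] by (simp add: ip_def)
  then show ?thesis using True by (simp add: gram_def)
next
  case False
  then have "ip u u > 0" using ip_nonneg[of u] by linarith
  from gram_residual[OF this, of v] ip_nonneg this show ?thesis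
    by (metis zero_le_divide_iff not_le)
qed

text \<open>
  The quotient on the right is the tangent of the angle \<open>\<theta>\<close> between \<open>u\<close> and \<open>v\<close>, so the probability is
  \<open>\<theta>/\<pi>\<close>. Splitting \<open>v\<close> into its components along and orthogonal to \<open>u\<close> reduces the claim to
  \<open>std_normal_wedge\<close>. When \<open>u\<close> and \<open>v\<close> are parallel, both sides vanish.
\<close>

lemma prob_sign_change:
  assumes pos: "ip u v > 0"
  shows "prob {\<omega> \<in> space M. lin u \<omega> * lin v \<omega> < 0} = arctan (sqrt (gram u v) / ip u v) / pi"
proof -
  have u: "ip u u > 0"
  proof (rule ccontr)
    assume "\<not> ip u u > 0"
    then have "ip u u = 0" using ip_nonneg[of u] by linarith
    then have "ip u v = 0" using ip_self_eq_0[of u] by (simp add: ip_def)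
    then show False using pos by simp
  qed
  define l where "l = ip u v / ip u u"
  define w where "w = (\<lambda>i. v i - l * u i)"
  have l: "l > 0" using u pos by (simp add: l_def)
  have ww: "ip w w = gram u v / ip u u"
    using gram_residual[OF u, of v] by (simp add: w_def l_def)
  have uw: "ip u w = 0"
    using ip_add_scale[of u v "-l" u] u by (simp add: w_def l_def)
  have v: "lin v \<omega> = l * lin u \<omega> + lin w \<omega>" for \<omega>
    unfolding lin_scale[symmetric] lin_add[symmetric] by (simp add: w_def lin_def)
  show ?thesis
  proof (cases "gram u v = 0")
    case True
    then have "ip w w = 0" using ww by simp
    then have "lin w \<omega> = 0" for \<omega>
      by (simp add: ip_self_eq_0 lin_def)
    then have "lin u \<omega> * lin v \<omega> = l * (lin u \<omega>)\<^sup>2" for \<omega>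
      by (simp add: v power2_eq_square)
    moreover have "0 \<le> l * (lin u \<omega>)\<^sup>2" for \<omega> using l by simp
    ultimately have "{\<omega> \<in> space M. lin u \<omega> * lin v \<omega> < 0} = {}"
      by (metis (no_types, lifting) Collect_empty_eq not_less)
    then show ?thesis using True by (simp only: measure_empty) simp
  next
    case False
    then have g: "gram u v > 0" using gram_nonneg[of u v] by linarith
    then have w0: "ip w w > 0" using ww u by simp
    define nu nw where "nu = sqrt (ip u u)" and "nw = sqrt (ip w w)"
    have nn: "nu > 0" "nw > 0" "nu\<^sup>2 = ip u u" "nw\<^sup>2 = ip w w"
      using u w0 by (auto simp: nu_def nw_def)
    let ?u = "\<lambda>i. 1 / nu * u i" and ?w = "\<lambda>i. 1 / nw * w i"
    have n1: "ip ?u ?u = 1" "ip ?w ?w = 1" "ip ?u ?w = 0"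
      using nn(1,2) uw by (simp_all only: ip_scale nn(3,4)[symmetric]) (simp_all add: power2_eq_square)
    let ?X = "\<lambda>\<omega>. lin ?u \<omega> / \<sigma>" and ?Z = "\<lambda>\<omega>. lin ?w \<omega> / \<sigma>"
    define k where "k = l * nu / nw"
    have iff: "lin u \<omega> * lin v \<omega> < 0 \<longleftrightarrow> ?X \<omega> * (k * ?X \<omega> + ?Z \<omega>) < 0" for \<omega>
    proof -
      have U: "lin u \<omega> = \<sigma> * nu * ?X \<omega>" and W: "lin w \<omega> = \<sigma> * nw * ?Z \<omega>"
        using nn sig unfolding lin_scale by simp_all
      have "lin u \<omega> * lin v \<omega> = (\<sigma>\<^sup>2 * nu * nw) * (?X \<omega> * (k * ?X \<omega> + ?Z \<omega>))"
        unfolding v U W k_def using nn by (simp add: field_simps power2_eq_square)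
      moreover have "\<sigma>\<^sup>2 * nu * nw > 0" using nn sig by simp
      ultimately show ?thesis
        using mult_less_cancel_left_pos[of "\<sigma>\<^sup>2 * nu * nw" "?X \<omega> * (k * ?X \<omega> + ?Z \<omega>)" 0]
        by (simp only: mult_zero_right)
    qed
    note S[measurable] = wedge_measurable[of k]
    have "emeasure M {\<omega> \<in> space M. lin u \<omega> * lin v \<omega> < 0}
      = emeasure (distr M (borel \<Otimes>\<^sub>M borel) (\<lambda>\<omega>. (?X \<omega>, ?Z \<omega>))) {p. fst p * (k * fst p + snd p) < 0}"
      unfolding iff by (subst emeasure_distr) (auto intro!: arg_cong[where f="emeasure M"])
    also have "\<dots> = ennreal ((pi / 2 - arctan k) / pi)"
      unfolding joint_law_orthogonal[OF n1] by (rule std_normal_wedge)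
    finally have P: "prob {\<omega> \<in> space M. lin u \<omega> * lin v \<omega> < 0} = (pi / 2 - arctan k) / pi"
      using arctan_ubound[of k] by (simp add: emeasure_eq_measure)
    have k0: "k > 0" using l nn by (simp add: k_def)
    have "sqrt (gram u v) = nu * nw"
      using g u by (simp add: nu_def nw_def ww real_sqrt_mult[symmetric])
    then have "k = ip u v / sqrt (gram u v)"
      using nn u by (simp add: k_def l_def field_simps power2_eq_square)
    then have "arctan (sqrt (gram u v) / ip u v) = pi / 2 - arctan k"
      using arctan_inverse[of k] k0 by (simp add: inverse_eq_divide sgn_if)
    then show ?thesis using P by simp
  qed
qed

text \<open>
  The density of a normal variable with standard deviation \<open>s\<close> is at most \<open>1 / (2 s)\<close>.
\<close>

lemma prob_small:
  assumes u: "ip u u > 0" and t: "t \<ge> 0"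
  shows "prob {\<omega> \<in> space M. \<bar>lin u \<omega>\<bar> \<le> t} \<le> t / (\<sigma> * sqrt (ip u u))"
proof -
  define nu where "nu = sqrt (ip u u)"
  have nn: "nu > 0" "nu\<^sup>2 = ip u u" using u by (auto simp: nu_def)
  let ?u = "\<lambda>i. 1 / nu * u i"
  have n1: "ip ?u ?u = 1"
    using nn(1) by (simp only: ip_scale nn(2)[symmetric]) (simp add: power2_eq_square)
  let ?X = "\<lambda>\<omega>. lin ?u \<omega> / \<sigma>"
  have iff: "\<bar>lin u \<omega>\<bar> \<le> t \<longleftrightarrow> ?X \<omega> \<in> {- (t / (\<sigma> * nu)) .. t / (\<sigma> * nu)}" for \<omega>
  proof -
    have "lin u \<omega> = \<sigma> * nu * ?X \<omega>" using nn sig unfolding lin_scale by simp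
    then have "\<bar>lin u \<omega>\<bar> = \<sigma> * nu * \<bar>?X \<omega>\<bar>" using nn sig by (simp add: abs_mult)
    then have "\<bar>lin u \<omega>\<bar> \<le> t \<longleftrightarrow> \<bar>?X \<omega>\<bar> \<le> t / (\<sigma> * nu)"
      using nn sig by (simp add: field_simps)
    then show ?thesis unfolding atLeastAtMost_iff abs_le_iff by linarith
  qed
  let ?A = "{- (t / (\<sigma> * nu)) .. t / (\<sigma> * nu)}"
  have "emeasure M {\<omega> \<in> space M. \<bar>lin u \<omega>\<bar> \<le> t} = emeasure (distr M borel ?X) ?A"
    unfolding iff by (subst emeasure_distr) (auto intro!: arg_cong[where f="emeasure M"])
  also have "\<dots> = (\<integral>\<^sup>+x. ennreal (std_normal_density x) * indicator ?A x \<partial>lborel)"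
    unfolding distr_lin[OF n1] by (subst emeasure_density) auto
  also have "\<dots> \<le> (\<integral>\<^sup>+x. ennreal (1 / 2) * indicator ?A x \<partial>lborel)"
  proof (intro nn_integral_mono mult_right_mono)
    fix x :: real
    have "sqrt 4 \<le> sqrt (2 * pi)" using pi_gt3 by (intro real_sqrt_le_mono) linarith
    then have "1 / sqrt (2 * pi) \<le> 1 / 2" by (simp add: field_simps)
    moreover have "exp (- x\<^sup>2 / 2) \<le> 1" by simp
    ultimately have "1 / sqrt (2 * pi) * exp (- x\<^sup>2 / 2) \<le> 1 / 2 * 1"
      by (intro mult_mono) auto
    then show "ennreal (std_normal_density x) \<le> ennreal (1 / 2)"
      by (intro ennreal_leI) (simp add: std_normal_density_def)
  qed simp
  also have "\<dots> = ennreal (1 / 2) * emeasure lborel ?A"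
    by (rule nn_integral_cmult_indicator) simp
  also have "emeasure lborel ?A = ennreal (2 * (t / (\<sigma> * nu)))"
    using t nn sig by simp
  also have "ennreal (1 / 2) * ennreal (2 * (t / (\<sigma> * nu))) = ennreal (1 / 2 * (2 * (t / (\<sigma> * nu))))"
    using t nn sig by (intro ennreal_mult[symmetric]) auto
  also have "1 / 2 * (2 * (t / (\<sigma> * nu))) = t / (\<sigma> * nu)" by simp
  finally show ?thesis
    using t nn sig by (simp add: emeasure_eq_measure nu_def)
qed

lemma AE_lin_nonzero:
  assumes "ip u u > 0"
  shows "AE \<omega> in M. lin u \<omega> \<noteq> 0"
proof -
  have "prob {\<omega> \<in> space M. \<bar>lin u \<omega>\<bar> \<le> 0} \<le> 0"
    using prob_small[OF assms, of 0] by simp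
  then have "prob {\<omega> \<in> space M. lin u \<omega> = 0} = 0"
    using measure_nonneg[of M "{\<omega> \<in> space M. lin u \<omega> = 0}"] by simp
  then show ?thesis
    by (subst AE_iff_measurable[OF _ refl]) (auto simp: emeasure_eq_measure)
qed

lemma expectation_abs_xi:
  assumes "i \<in> I"
  shows "(\<integral>\<^sup>+\<omega>. ennreal \<bar>\<xi> i \<omega>\<bar> \<partial>M) \<le> ennreal \<sigma>"
proof -
  have m[measurable]: "\<xi> i \<in> borel_measurable M" using assms by simp
  have "distributed M lborel (\<lambda>\<omega>. (\<xi> i \<omega> - 0) / \<sigma>) std_normal_density"
    using normal_standard_normal_convert[of \<sigma> "\<xi> i" 0] normal[OF assms] sig by simp
  then have d: "distr M lborel (\<lambda>\<omega>. \<xi> i \<omega> / \<sigma>) = density lborel (\<lambda>x. ennreal (std_normal_density x))"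
    by (simp add: distributed_def)
  have "has_bochner_integral lborel (\<lambda>x. std_normal_density x * \<bar>x\<bar> ^ (2 * 0 + 1)) (sqrt (2 / pi) * 2 ^ 0 * fact 0)"
    by (rule std_normal_moment_abs_odd)
  then have h: "(\<integral>\<^sup>+x. ennreal (std_normal_density x * \<bar>x\<bar>) \<partial>lborel) = ennreal (sqrt (2 / pi))"
    by (subst nn_integral_eq_integral) (auto simp: has_bochner_integral_iff)
  have "(\<integral>\<^sup>+\<omega>. ennreal \<bar>\<xi> i \<omega>\<bar> \<partial>M) = (\<integral>\<^sup>+\<omega>. ennreal \<sigma> * ennreal \<bar>\<xi> i \<omega> / \<sigma>\<bar> \<partial>M)"
    using sig by (intro nn_integral_cong) (simp add: ennreal_mult[symmetric] abs_mult)
  also have "\<dots> = ennreal \<sigma> * (\<integral>\<^sup>+\<omega>. ennreal \<bar>\<xi> i \<omega> / \<sigma>\<bar> \<partial>M)"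
    by (rule nn_integral_cmult) simp
  also have "(\<integral>\<^sup>+\<omega>. ennreal \<bar>\<xi> i \<omega> / \<sigma>\<bar> \<partial>M) = (\<integral>\<^sup>+x. ennreal \<bar>x\<bar> \<partial>distr M lborel (\<lambda>\<omega>. \<xi> i \<omega> / \<sigma>))"
    by (subst nn_integral_distr) auto
  also have "\<dots> = ennreal (sqrt (2 / pi))"
    unfolding d h[symmetric] by (subst nn_integral_density) (auto simp: ennreal_mult)
  also have "ennreal \<sigma> * ennreal (sqrt (2 / pi)) \<le> ennreal \<sigma> * ennreal 1"
  proof -
    have "sqrt (2 / pi) \<le> sqrt 1" using pi_gt3 by (intro real_sqrt_le_mono) simp
    then show ?thesis by (intro mult_left_mono ennreal_leI) auto
  qed
  finally show ?thesis by simp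
qed

end

section \<open>Counting zeros of functions on the line\<close>

text \<open>
  Extended nonnegative values are used so that an infinite zero set counts as \<open>\<infinity>\<close>, and additivity and
  monotonicity hold without side conditions.
\<close>

definition zcount :: "(real \<Rightarrow> real) \<Rightarrow> real set \<Rightarrow> ennreal" where
  "zcount f A = emeasure (count_space UNIV) {x \<in> A. f x = 0}"

lemma zcount_mono: "A \<subseteq> B \<Longrightarrow> zcount f A \<le> zcount f B"
  unfolding zcount_def by (rule emeasure_mono) auto

lemma zcount_Un_le: "zcount f (A \<union> B) \<le> zcount f A + zcount f B"
proof -
  have "{x \<in> A \<union> B. f x = 0} = {x \<in> A. f x = 0} \<union> {x \<in> B. f x = 0}" by auto
  then show ?thesis unfolding zcount_def by (simp add: emeasure_subadditive)
qed

lemma zcount_UN_le: "finite J \<Longrightarrow> zcount f (\<Union>j\<in>J. A j) \<le> (\<Sum>j\<in>J. zcount f (A j))"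
proof (induction J rule: finite_induct)
  case empty then show ?case by (simp add: zcount_def)
next
  case (insert j J)
  then show ?case
    using zcount_Un_le[of f "A j" "\<Union>j\<in>J. A j"] by (auto intro: order_trans add_left_mono)
qed

lemma zcount_UN_disjoint:
  assumes "finite J" "disjoint_family_on A J"
  shows "(\<Sum>j\<in>J. zcount f (A j)) = zcount f (\<Union>j\<in>J. A j)"
proof -
  have "{x \<in> (\<Union>j\<in>J. A j). f x = 0} = (\<Union>j\<in>J. {x \<in> A j. f x = 0})" by auto
  moreover have "disjoint_family_on (\<lambda>j. {x \<in> A j. f x = 0}) J"
    using assms(2) by (auto simp: disjoint_family_on_def)
  ultimately show ?thesis
    unfolding zcount_def using assms(1) by (simp add: sum_emeasure image_subset_iff)
qed

lemma zcount_ge_card: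
  assumes "finite F" "F \<subseteq> {x \<in> A. f x = 0}"
  shows "of_nat (card F) \<le> zcount f A"
proof -
  have "of_nat (card F) = emeasure (count_space UNIV) F" using assms by (simp add: emeasure_count_space_finite)
  also have "\<dots> \<le> zcount f A" unfolding zcount_def using assms by (intro emeasure_mono) auto
  finally show ?thesis .
qed

text \<open>
  Bounds for finite sets of zeros suffice, also when the zero set is infinite.
\<close>

lemma zcount_le:
  assumes "\<And>F. finite F \<Longrightarrow> F \<subseteq> {x \<in> A. f x = 0} \<Longrightarrow> of_nat (card F) \<le> c"
  shows "zcount f A \<le> c"
proof (cases "finite {x \<in> A. f x = 0}")
  case True
  then show ?thesis using assms[OF True] by (simp add: zcount_def emeasure_count_space_finite)
next
  case False
  have "of_nat n \<le> c" for n
  proof -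
    obtain F where "finite F" "card F = n" "F \<subseteq> {x \<in> A. f x = 0}"
      using infinite_arbitrarily_large[OF False] by blast
    then show ?thesis using assms by blast
  qed
  then have "c = \<top>" using ennreal_SUP_of_nat_eq_top by (metis SUP_least top.extremum_unique)
  then show ?thesis by simp
qed

lemma zcount_ge_cells:
  assumes "finite J" "disjoint_family_on A J" "\<And>j. j \<in> J \<Longrightarrow> A j \<subseteq> B" "\<And>j. j \<in> J \<Longrightarrow> \<exists>x\<in>A j. f x = 0"
  shows "of_nat (card J) \<le> zcount f B"
proof -
  have "of_nat (card J) = (\<Sum>j\<in>J. 1 :: ennreal)" by simp
  also have "\<dots> \<le> (\<Sum>j\<in>J. zcount f (A j))"
  proof (rule sum_mono)
    fix j assume "j \<in> J"
    then obtain x where "x \<in> A j" "f x = 0" using assms(4) by blast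
    then show "1 \<le> zcount f (A j)" using zcount_ge_card[of "{x}" "A j" f] by simp
  qed
  also have "\<dots> = zcount f (\<Union>j\<in>J. A j)" by (rule zcount_UN_disjoint[OF assms(1,2)])
  also have "\<dots> \<le> zcount f B" using assms(3) by (intro zcount_mono) auto
  finally show ?thesis .
qed

lemma finite_separation:
  fixes F :: "'b::metric_space set"
  assumes "finite F"
  shows "\<exists>d>0. \<forall>x\<in>F. \<forall>y\<in>F. x \<noteq> y \<longrightarrow> d \<le> dist x y"
proof -
  let ?S = "(\<lambda>(x, y). dist x y) ` {(x, y). x \<in> F \<and> y \<in> F \<and> x \<noteq> y}"
  have "finite {(x, y). x \<in> F \<and> y \<in> F \<and> x \<noteq> y}"
    by (rule finite_subset[of _ "F \<times> F"]) (use assms in auto)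
  then have fin: "finite (insert 1 ?S)" by simp
  show ?thesis
  proof (intro exI[of _ "Min (insert 1 ?S)"] conjI ballI impI)
    show "0 < Min (insert 1 ?S)" using fin by (subst Min_gr_iff) auto
    fix x y assume "x \<in> F" "y \<in> F" "x \<noteq> y"
    then show "Min (insert 1 ?S) \<le> dist x y" by (intro Min_le fin) force
  qed
qed

text \<open>
  Existence of a zero in a compact set can be tested on a countable dense subset, hence is a measurable event;
  countable unions of compact sets inherit this and include all intervals.
\<close>

definition sigma_compact :: "real set \<Rightarrow> bool" where
  "sigma_compact A \<longleftrightarrow> (\<exists>K. (\<forall>i::nat. compact (K i)) \<and> A = (\<Union>i. K i))"

lemma sigma_compact_compact: "compact K \<Longrightarrow> sigma_compact K"
  unfolding sigma_compact_def by (intro exI[of _ "\<lambda>_. K"]) auto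

lemma sigma_compact_Int:
  assumes "sigma_compact A" "sigma_compact B"
  shows "sigma_compact (A \<inter> B)"
proof -
  obtain K L where K: "\<And>i::nat. compact (K i)" "A = (\<Union>i. K i)" and L: "\<And>i::nat. compact (L i)" "B = (\<Union>i. L i)"
    using assms unfolding sigma_compact_def by blast
  let ?P = "\<lambda>n. K (fst (prod_decode n)) \<inter> L (snd (prod_decode n))"
  have "A \<inter> B = (\<Union>n. ?P n)"
  proof (intro subset_antisym subsetI)
    fix x assume "x \<in> A \<inter> B"
    then obtain i j where "x \<in> K i" "x \<in> L j" using K L by blast
    then have "x \<in> ?P (prod_encode (i, j))" by simp
    then show "x \<in> (\<Union>n. ?P n)" by blast
  qed (use K L in auto)
  moreover have "compact (?P n)" for n using K L by (intro compact_Int) auto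
  ultimately show ?thesis unfolding sigma_compact_def by (intro exI[of _ ?P]) auto
qed

lemma sigma_compact_interval: "sigma_compact {a<..b}" "sigma_compact {a<..<b}"
proof -
  have r: "\<exists>n. inverse (real (Suc n)) < e" if "e > 0" for e
    using reals_Archimedean[OF that] by simp
  have "{a<..b} = (\<Union>n. {a + inverse (real (Suc n))..b})"
  proof (intro subset_antisym subsetI)
    fix x assume x: "x \<in> {a<..b}"
    then obtain n where "inverse (real (Suc n)) < x - a" using r[of "x - a"] by auto
    then have "x \<in> {a + inverse (real (Suc n))..b}" using x by simp
    then show "x \<in> (\<Union>n. {a + inverse (real (Suc n))..b})" by blast
  next
    fix x assume "x \<in> (\<Union>n. {a + inverse (real (Suc n))..b})"
    then obtain n where "a + inverse (real (Suc n)) \<le> x" "x \<le> b" by auto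
    moreover have "inverse (real (Suc n)) > 0" by simp
    ultimately have "a < x" by linarith
    then show "x \<in> {a<..b}" using \<open>x \<le> b\<close> by simp
  qed
  then show "sigma_compact {a<..b}" unfolding sigma_compact_def
    by (intro exI[of _ "\<lambda>n. {a + inverse (real (Suc n))..b}"]) auto
  have "{a<..<b} = (\<Union>n. {a + inverse (real (Suc n))..b - inverse (real (Suc n))})"
  proof (intro subset_antisym subsetI)
    fix x assume x: "x \<in> {a<..<b}"
    then obtain n where "inverse (real (Suc n)) < min (x - a) (b - x)" using r[of "min (x - a) (b - x)"] by auto
    then have "x \<in> {a + inverse (real (Suc n))..b - inverse (real (Suc n))}" using x by simp
    then show "x \<in> (\<Union>n. {a + inverse (real (Suc n))..b - inverse (real (Suc n))})" by blast
  next
    fix x assume "x \<in> (\<Union>n. {a + inverse (real (Suc n))..b - inverse (real (Suc n))})"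
    then obtain n where "a + inverse (real (Suc n)) \<le> x" "x \<le> b - inverse (real (Suc n))" by auto
    moreover have "inverse (real (Suc n)) > 0" by simp
    ultimately have "a < x" "x < b" by linarith+
    then show "x \<in> {a<..<b}" by simp
  qed
  then show "sigma_compact {a<..<b}" unfolding sigma_compact_def
    by (intro exI[of _ "\<lambda>n. {a + inverse (real (Suc n))..b - inverse (real (Suc n))}"]) auto
qed

text \<open>
  By compactness there is a zero iff \<open>|f|\<close> takes arbitrarily small values on a countable dense subset.
\<close>

lemma sets_ex_zero_compact:
  fixes f :: "'a \<Rightarrow> real \<Rightarrow> real"
  assumes cont: "\<And>\<omega>. continuous_on K (f \<omega>)" and K: "compact K"
    and [measurable]: "\<And>x. (\<lambda>\<omega>. f \<omega> x) \<in> borel_measurable M"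
  shows "{\<omega> \<in> space M. \<exists>x\<in>K. f \<omega> x = 0} \<in> sets M"
proof -
  obtain D where D: "countable D" "D \<subseteq> K" "K \<subseteq> closure D"
    using separable[of K] by blast
  have iff: "(\<exists>x\<in>K. f \<omega> x = 0) \<longleftrightarrow> (\<forall>n::nat. \<exists>t\<in>D. \<bar>f \<omega> t\<bar> < inverse (real (Suc n)))" for \<omega>
  proof
    assume "\<exists>x\<in>K. f \<omega> x = 0"
    then obtain x where x: "x \<in> K" "f \<omega> x = 0" by blast
    show "\<forall>n::nat. \<exists>t\<in>D. \<bar>f \<omega> t\<bar> < inverse (real (Suc n))"
    proof
      fix n
      obtain d where d: "d > 0" "\<And>y. y \<in> K \<Longrightarrow> dist y x < d \<Longrightarrow> dist (f \<omega> y) (f \<omega> x) < inverse (real (Suc n))"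
        using cont[of \<omega>] x(1) unfolding continuous_on_iff
        by (metis inverse_positive_iff_positive of_nat_0_less_iff zero_less_Suc)
      obtain t where "t \<in> D" "dist t x < d"
        using D(3) x(1) d(1) by (meson closure_approachable subsetD)
      then show "\<exists>t\<in>D. \<bar>f \<omega> t\<bar> < inverse (real (Suc n))"
        using d(2)[of t] D(2) x(2) by (auto simp: dist_real_def)
    qed
  next
    assume R: "\<forall>n::nat. \<exists>t\<in>D. \<bar>f \<omega> t\<bar> < inverse (real (Suc n))"
    then have "K \<noteq> {}" using D(2) by fastforce
    then obtain x where x: "x \<in> K" "\<And>y. y \<in> K \<Longrightarrow> \<bar>f \<omega> x\<bar> \<le> \<bar>f \<omega> y\<bar>"
      using continuous_attains_inf[OF K, of "\<lambda>x. \<bar>f \<omega> x\<bar>"] cont[of \<omega>] by (metis continuous_on_rabs)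
    have "\<bar>f \<omega> x\<bar> < inverse (real (Suc n))" for n
      using R x(2) D(2) by (meson le_less_trans subsetD)
    then have "\<bar>f \<omega> x\<bar> \<le> 0"
      using reals_Archimedean[of "\<bar>f \<omega> x\<bar>"] by (meson less_asym not_le)
    then show "\<exists>x\<in>K. f \<omega> x = 0" using x(1) by auto
  qed
  have "{\<omega> \<in> space M. \<forall>n::nat. \<exists>t\<in>D. \<bar>f \<omega> t\<bar> < inverse (real (Suc n))}
    = (\<Inter>n::nat. \<Union>t\<in>D. {\<omega> \<in> space M. \<bar>f \<omega> t\<bar> < inverse (real (Suc n))})"
    by auto
  also have "\<dots> \<in> sets M"
    using D(1) by (intro sets.countable_INT' sets.countable_UN') auto
  finally have "{\<omega> \<in> space M. \<forall>n::nat. \<exists>t\<in>D. \<bar>f \<omega> t\<bar> < inverse (real (Suc n))} \<in> sets M" .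
  then show ?thesis by (simp only: iff)
qed

lemma sets_ex_zero:
  fixes f :: "'a \<Rightarrow> real \<Rightarrow> real"
  assumes cont: "\<And>\<omega>. continuous_on UNIV (f \<omega>)" and A: "sigma_compact A"
    and m: "\<And>x. (\<lambda>\<omega>. f \<omega> x) \<in> borel_measurable M"
  shows "{\<omega> \<in> space M. \<exists>x\<in>A. f \<omega> x = 0} \<in> sets M"
proof -
  obtain K where K: "\<And>i::nat. compact (K i)" "A = (\<Union>i. K i)"
    using A unfolding sigma_compact_def by blast
  have "{\<omega> \<in> space M. \<exists>x\<in>K i. f \<omega> x = 0} \<in> sets M" for i
    using cont by (intro sets_ex_zero_compact K m) (blast intro: continuous_on_subset)
  then have "(\<Union>i. {\<omega> \<in> space M. \<exists>x\<in>K i. f \<omega> x = 0}) \<in> sets M" by blast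
  also have "(\<Union>i. {\<omega> \<in> space M. \<exists>x\<in>K i. f \<omega> x = 0}) = {\<omega> \<in> space M. \<exists>x\<in>A. f \<omega> x = 0}"
    using K(2) by auto
  finally show ?thesis .
qed

definition dyadic_cell :: "nat \<Rightarrow> int \<Rightarrow> real set" where
  "dyadic_cell j k = {(real_of_int k - 1) / 2 ^ j <.. real_of_int k / 2 ^ j}"

lemma dyadic_cell_iff: "x \<in> dyadic_cell j k \<longleftrightarrow> \<lceil>x * 2 ^ j\<rceil> = k"
  by (auto simp: dyadic_cell_def ceiling_eq_iff field_simps)

text \<open>
  The number of zeros is the supremum of the numbers of dyadic cells that contain a zero: finitely many zeros
  lie in different cells as soon as the cells are short enough. The range of \<open>k\<close> grows faster than
  \<open>2 ^ j\<close>, so that the cells eventually cover every bounded set.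
\<close>

lemma zcount_eq_SUP:
  "zcount f A = (SUP j. \<Sum>k\<in>{- (4 ^ j) .. 4 ^ j}. if \<exists>x\<in>A \<inter> dyadic_cell j k. f x = 0 then 1 else 0)"
    (is "_ = (SUP j. ?N j)")
proof (rule antisym)
  show "(SUP j. ?N j) \<le> zcount f A"
  proof (rule SUP_least)
    fix j
    let ?J = "{k \<in> {- (4 ^ j) .. 4 ^ j}. \<exists>x\<in>A \<inter> dyadic_cell j k. f x = 0}"
    have fJ: "finite ?J" by (rule finite_subset[of _ "{- (4 ^ j) .. 4 ^ j}"]) auto
    have "?N j = of_nat (card ?J)"
      by (subst sum.inter_filter[symmetric]) auto
    also have "\<dots> \<le> zcount f A"
      by (rule zcount_ge_cells[where A="\<lambda>k. A \<inter> dyadic_cell j k", OF fJ])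
         (auto simp: disjoint_family_on_def dyadic_cell_iff)
    finally show "?N j \<le> zcount f A" .
  qed
next
  show "zcount f A \<le> (SUP j. ?N j)"
  proof (rule zcount_le)
    fix F assume F: "finite F" "F \<subseteq> {x \<in> A. f x = 0}"
    obtain d where d: "d > 0" "\<And>x y. x \<in> F \<Longrightarrow> y \<in> F \<Longrightarrow> x \<noteq> y \<Longrightarrow> d \<le> dist x y"
      using finite_separation[OF F(1)] by metis
    obtain R where R: "\<And>x. x \<in> F \<Longrightarrow> \<bar>x\<bar> \<le> R"
      using finite_imp_bounded[OF F(1)] by (auto simp: bounded_iff)
    obtain j1 where j1: "(1/2) ^ j1 < d" using real_arch_pow_inv[OF d(1), of "1/2"] by auto
    obtain j2 where j2: "R + 1 < 2 ^ j2" using real_arch_pow[of 2 "R + 1"] by auto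
    define j where "j = max j1 j2"
    have jd: "(1/2::real) ^ j < d"
      using j1 by (rule le_less_trans[rotated]) (simp add: j_def power_decreasing)
    have jR: "R + 1 < 2 ^ j"
      using j2 by (rule less_le_trans) (simp add: j_def)
    let ?J = "{k \<in> {- (4 ^ j) .. 4 ^ j}. \<exists>x\<in>A \<inter> dyadic_cell j k. f x = 0}"
    let ?g = "\<lambda>x::real. \<lceil>x * 2 ^ j\<rceil>"
    have "inj_on ?g F"
    proof (rule inj_onI, rule ccontr)
      fix x y assume xy: "x \<in> F" "y \<in> F" "?g x = ?g y" "x \<noteq> y"
      have "\<bar>x * 2 ^ j - y * 2 ^ j\<bar> < 1" using xy(3) by linarith
      then have "\<bar>x - y\<bar> * 2 ^ j < 1" by (simp add: abs_mult left_diff_distrib[symmetric])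
      then have "\<bar>x - y\<bar> < (1/2) ^ j" by (simp add: field_simps power_divide)
      then show False using d(2)[OF xy(1,2,4)] jd by (simp add: dist_real_def)
    qed
    moreover have "?g ` F \<subseteq> ?J"
    proof (intro image_subsetI CollectI conjI)
      fix x assume x: "x \<in> F"
      have "\<bar>x * 2 ^ j\<bar> \<le> R * 2 ^ j" using R[OF x] by (simp add: abs_mult mult_right_mono)
      also have "\<dots> \<le> (2 ^ j - 1) * 2 ^ j" using jR by (intro mult_right_mono) auto
      also have "\<dots> = 4 ^ j - 2 ^ j" by (simp add: left_diff_distrib power_mult_distrib[symmetric])
      also have "\<dots> \<le> 4 ^ j - 1" by simp
      finally have b: "\<bar>x * 2 ^ j\<bar> \<le> 4 ^ j - 1" .
      have "- (4 ^ j) \<le> ?g x" "?g x \<le> 4 ^ j"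
        using b by (auto simp: le_ceiling_iff ceiling_le_iff)
      then show "?g x \<in> {- (4 ^ j) .. 4 ^ j}" by simp
      show "\<exists>y\<in>A \<inter> dyadic_cell j (?g x). f y = 0"
        using x F(2) by (auto simp: dyadic_cell_iff)
    qed
    moreover have fJ: "finite ?J" by (rule finite_subset[of _ "{- (4 ^ j) .. 4 ^ j}"]) auto
    ultimately have "card F \<le> card ?J" by (rule card_inj_on_le)
    then have "of_nat (card F) \<le> (of_nat (card ?J) :: ennreal)" by simp
    also have "\<dots> = ?N j" by (subst sum.inter_filter[symmetric]) auto
    also have "\<dots> \<le> (SUP j. ?N j)" by (rule SUP_upper) simp
    finally show "of_nat (card F) \<le> (SUP j. ?N j)" .
  qed
qed

text \<open>
  Random zero counts are measurable, also on outcomes with infinitely many zeros.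
\<close>

lemma measurable_zcount:
  fixes f :: "'a \<Rightarrow> real \<Rightarrow> real"
  assumes cont: "\<And>\<omega>. continuous_on UNIV (f \<omega>)" and A: "sigma_compact A"
    and m: "\<And>x. (\<lambda>\<omega>. f \<omega> x) \<in> borel_measurable M"
  shows "(\<lambda>\<omega>. zcount (f \<omega>) A) \<in> borel_measurable M"
proof -
  have [measurable]: "Measurable.pred M (\<lambda>\<omega>. \<exists>x\<in>A \<inter> dyadic_cell j k. f \<omega> x = 0)" for j k
    using sets_ex_zero[OF cont sigma_compact_Int[OF A] m, of "dyadic_cell j k"] sigma_compact_interval(1)
    by (simp add: dyadic_cell_def pred_def)
  show ?thesis unfolding zcount_eq_SUP by measurable
qed

section \<open>Angles between points of a smooth curve\<close>

lemma arctan_near_id: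
  assumes "0 \<le> x"
  shows "\<bar>arctan x - x\<bar> \<le> x\<^sup>2"
proof (cases "x = 0")
  case False
  then have x: "x > 0" using assms by simp
  obtain z where z: "0 < z" "z < x" "arctan x - arctan 0 = (x - 0) * inverse (1 + z\<^sup>2)"
    using MVT2[of 0 x arctan "\<lambda>z. inverse (1 + z\<^sup>2)"] x by (metis DERIV_arctan)
  have z1: "1 + z\<^sup>2 > 0" by (simp add: add_pos_nonneg)
  then have z2: "1 + z\<^sup>2 \<noteq> 0" by simp
  have "arctan x = x / (1 + z\<^sup>2)" using z(3) by (simp add: field_simps)
  then have e: "arctan x - x = - (x * z\<^sup>2 / (1 + z\<^sup>2))"
  proof -
    have "x * (1 + z\<^sup>2) / (1 + z\<^sup>2) = x" using z2 by simp
    then have "x / (1 + z\<^sup>2) + x * z\<^sup>2 / (1 + z\<^sup>2) = x"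
      by (simp only: distrib_left add_divide_distrib mult_1_right)
    then show ?thesis using \<open>arctan x = x / (1 + z\<^sup>2)\<close> by linarith
  qed
  have "\<bar>arctan x - x\<bar> = x * (z\<^sup>2 / (1 + z\<^sup>2))" using x z1 by (simp add: e abs_mult)
  also have "z\<^sup>2 / (1 + z\<^sup>2) \<le> z"
  proof -
    have "0 \<le> (z - 1/2)\<^sup>2" by simp
    then have "z \<le> 1 + z\<^sup>2" by (simp add: power2_eq_square algebra_simps)
    then have "z * z \<le> z * (1 + z\<^sup>2)" using z by (intro mult_left_mono) auto
    then show ?thesis using z1 by (simp add: field_simps power2_eq_square)
  qed
  also have "x * z \<le> x * x" using z by simp
  finally show ?thesis using x by (simp add: power2_eq_square mult_left_mono)
qed simp

context gaussian_family
begin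

abbreviation nrm :: "('i \<Rightarrow> real) \<Rightarrow> real" where
  "nrm u \<equiv> L2_set u I"

lemma nrm_eq: "nrm u = sqrt (ip u u)"
  by (simp add: L2_set_def ip_def power2_eq_square)

lemma nrm_sq: "(nrm u)\<^sup>2 = ip u u"
  by (simp add: nrm_eq ip_nonneg)

lemma ip_le_nrm: "\<bar>ip u v\<bar> \<le> nrm u * nrm v"
proof -
  have "(ip u v)\<^sup>2 \<le> (nrm u * nrm v)\<^sup>2"
    using gram_nonneg[of u v] by (simp add: gram_def power_mult_distrib nrm_sq)
  then have "\<bar>ip u v\<bar> \<le> \<bar>nrm u * nrm v\<bar>" by (simp only: abs_le_square_iff)
  then show ?thesis by (simp add: abs_mult)
qed

text \<open>
  The component of \<open>v\<close> orthogonal to \<open>u\<close>; its norm is \<open>|v| sin \<theta>\<close>.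
\<close>

definition residual :: "('i \<Rightarrow> real) \<Rightarrow> ('i \<Rightarrow> real) \<Rightarrow> 'i \<Rightarrow> real" where
  "residual u v i = v i - ip u v / ip u u * u i"

lemma sqrt_gram_eq:
  assumes "ip u u > 0"
  shows "sqrt (gram u v) = nrm u * nrm (residual u v)"
proof -
  have "residual u v = (\<lambda>i. v i - ip u v / ip u u * u i)" by (simp add: residual_def fun_eq_iff)
  then have "gram u v = ip u u * ip (residual u v) (residual u v)"
    using gram_residual[OF assms, of v] assms by (simp add: field_simps)
  then show ?thesis by (simp add: nrm_eq real_sqrt_mult)
qed

lemma nrm_residual_le:
  assumes "ip u u > 0"
  shows "nrm (residual u v) \<le> nrm v"
proof -
  have "sqrt (gram u v) \<le> sqrt (ip u u * ip v v)" by (simp add: gram_def)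
  then have "nrm u * nrm (residual u v) \<le> nrm u * nrm v"
    using sqrt_gram_eq[OF assms, of v] by (simp add: nrm_eq real_sqrt_mult)
  moreover have "nrm u > 0" using assms by (simp add: nrm_eq)
  ultimately show ?thesis by simp
qed

lemma sqrt_gram_le: "sqrt (gram u v) \<le> nrm u * nrm v"
proof -
  have "sqrt (gram u v) \<le> sqrt (ip u u * ip v v)" by (simp add: gram_def)
  then show ?thesis by (simp add: nrm_eq real_sqrt_mult)
qed

text \<open>
  For fixed \<open>u\<close> the root of the Gram determinant is \<open>|u|\<close> times a seminorm of the other vector which vanishes
  on \<open>u\<close>. Hence moving from \<open>u\<close> to \<open>u + h v + R\<close> it grows like \<open>h\<close> times its value at \<open>v\<close>, up to the
  size of the remainder \<open>R\<close>.
\<close>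

lemma sqrt_gram_diff:
  assumes u: "ip u u > 0" and h: "h \<ge> 0" and z: "\<And>i. i \<in> I \<Longrightarrow> z i = u i + h * v i + R i"
  shows "\<bar>sqrt (gram u z) - h * sqrt (gram u v)\<bar> \<le> nrm u * nrm R"
proof -
  have iz: "ip u z = ip u u + h * ip u v + ip u R"
    unfolding ip_def using z by (simp add: algebra_simps sum.distrib sum_distrib_left)
  have rz: "residual u z i = h * residual u v i + residual u R i" if "i \<in> I" for i
    using u z[OF that] by (simp add: residual_def iz field_simps)
  have "nrm (residual u z) = nrm (\<lambda>i. h * residual u v i + residual u R i)"
    by (intro L2_set_cong refl rz)
  also have "\<dots> \<le> nrm (\<lambda>i. h * residual u v i) + nrm (residual u R)"
    by (rule L2_set_triangle_ineq)
  also have "nrm (\<lambda>i. h * residual u v i) = h * nrm (residual u v)"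
    by (rule L2_set_right_distrib[OF h, symmetric])
  finally have 1: "nrm (residual u z) \<le> h * nrm (residual u v) + nrm (residual u R)" .
  have "h * nrm (residual u v) = nrm (\<lambda>i. h * residual u v i)"
    by (rule L2_set_right_distrib[OF h])
  also have "\<dots> = nrm (\<lambda>i. residual u z i + - residual u R i)"
    by (intro L2_set_cong refl) (simp add: rz)
  also have "\<dots> \<le> nrm (residual u z) + nrm (\<lambda>i. - residual u R i)"
    by (rule L2_set_triangle_ineq)
  also have "nrm (\<lambda>i. - residual u R i) = nrm (residual u R)" by (simp add: L2_set_def)
  finally have 2: "\<bar>nrm (residual u z) - h * nrm (residual u v)\<bar> \<le> nrm R"
    using 1 nrm_residual_le[OF u, of R] by linarith
  have "sqrt (gram u z) - h * sqrt (gram u v) = nrm u * (nrm (residual u z) - h * nrm (residual u v))"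
    by (simp add: sqrt_gram_eq[OF u] algebra_simps)
  then have "\<bar>sqrt (gram u z) - h * sqrt (gram u v)\<bar> = nrm u * \<bar>nrm (residual u z) - h * nrm (residual u v)\<bar>"
    by (simp add: abs_mult)
  also have "\<dots> \<le> nrm u * nrm R" using 2 by (intro mult_left_mono) auto
  finally show ?thesis .
qed

end

text \<open>
  The bound \<open>B\<close> on the second derivatives makes Taylor estimates uniform in the point.
\<close>

locale gaussian_curve = gaussian_family +
  fixes F F1 F2 :: "'b \<Rightarrow> real \<Rightarrow> real" and B :: real
  assumes der1: "\<And>i x. i \<in> I \<Longrightarrow> (F i has_real_derivative F1 i x) (at x)"
    and der2: "\<And>i x. i \<in> I \<Longrightarrow> (F1 i has_real_derivative F2 i x) (at x)"
    and F2_bound: "\<And>i x. i \<in> I \<Longrightarrow> \<bar>F2 i x\<bar> \<le> B"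
    and B_nonneg: "0 \<le> B"
begin

abbreviation "v x \<equiv> (\<lambda>i. F i x)"
abbreviation "v1 x \<equiv> (\<lambda>i. F1 i x)"

definition path :: "'a \<Rightarrow> real \<Rightarrow> real" where
  "path \<omega> x = lin (v x) \<omega>"

definition path1 :: "'a \<Rightarrow> real \<Rightarrow> real" where
  "path1 \<omega> x = lin (v1 x) \<omega>"

text \<open>
  The speed of the normalised curve \<open>v/|v|\<close>.
\<close>

definition rate :: "real \<Rightarrow> real" where
  "rate x = sqrt (gram (v x) (v1 x)) / ip (v x) (v x)"

lemma path_measurable[measurable]: "(\<lambda>\<omega>. path \<omega> x) \<in> borel_measurable M"
  unfolding path_def by measurable

lemma path_deriv: "(path \<omega> has_real_derivative path1 \<omega> x) (at x)"
  unfolding path_def path1_def lin_def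
  by (intro DERIV_sum) (auto intro!: derivative_eq_intros der1)

lemma path_continuous: "continuous_on A (path \<omega>)"
  using path_deriv by (meson DERIV_isCont continuous_at_imp_continuous_on)

lemma F_continuous: "i \<in> I \<Longrightarrow> continuous_on A (F i)" "i \<in> I \<Longrightarrow> continuous_on A (F1 i)"
  using der1 der2 by (meson DERIV_isCont continuous_at_imp_continuous_on)+

lemma ip_continuous:
  "continuous_on A (\<lambda>x. ip (v x) (v x))" "continuous_on A (\<lambda>x. ip (v x) (v1 x))"
  "continuous_on A (\<lambda>x. ip (v1 x) (v1 x))"
  unfolding ip_def by (intro continuous_on_sum continuous_on_mult F_continuous; assumption)+

lemma rate_continuous:
  assumes "\<And>x. x \<in> A \<Longrightarrow> ip (v x) (v x) > 0"
  shows "continuous_on A rate"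
  unfolding rate_def gram_def
  by (intro continuous_intros ip_continuous) (use assms in force)

lemma rate_nonneg: "0 \<le> rate x"
  by (simp add: rate_def gram_nonneg ip_nonneg)

lemma F_taylor:
  assumes "i \<in> I"
  shows "\<bar>F i y - F i x - (y - x) * F1 i x\<bar> \<le> B * (y - x)\<^sup>2"
proof -
  have lip: "\<bar>F1 i z - F1 i x\<bar> \<le> B * \<bar>z - x\<bar>" for z
    using field_differentiable_bound[of UNIV "F1 i" "F2 i" B z x] der2[OF assms] F2_bound[OF assms]
    by (simp add: dist_real_def)
  define g where "g = (\<lambda>z. F i z - F i x - (z - x) * F1 i x)"
  have g': "(g has_field_derivative (F1 i z - F1 i x)) (at z within closed_segment x y)" for z
    unfolding g_def by (rule DERIV_subset[where s=UNIV]) (auto intro!: derivative_eq_intros der1[OF assms])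
  have "norm (g y - g x) \<le> (B * \<bar>y - x\<bar>) * norm (y - x)"
  proof (rule field_differentiable_bound[OF convex_closed_segment g'])
    fix z assume z: "z \<in> closed_segment x y"
    then have "\<bar>z - x\<bar> \<le> \<bar>y - x\<bar>"
      by (auto simp: closed_segment_eq_real_ivl split: if_splits)
    then have "B * \<bar>z - x\<bar> \<le> B * \<bar>y - x\<bar>" using B_nonneg by (rule mult_left_mono)
    then show "norm (F1 i z - F1 i x) \<le> B * \<bar>y - x\<bar>" using lip[of z] by simp
  qed auto
  then show ?thesis by (simp add: g_def power2_eq_square abs_mult_self_eq mult.assoc)
qed

definition sumabs :: "'a \<Rightarrow> real" where
  "sumabs \<omega> = (\<Sum>i\<in>I. \<bar>\<xi> i \<omega>\<bar>)"

lemma path_taylor: "\<bar>path \<omega> y - path \<omega> x - (y - x) * path1 \<omega> x\<bar> \<le> B * sumabs \<omega> * (y - x)\<^sup>2"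
proof -
  have "path \<omega> y - path \<omega> x - (y - x) * path1 \<omega> x = (\<Sum>i\<in>I. (F i y - F i x - (y - x) * F1 i x) * \<xi> i \<omega>)"
    by (simp add: path_def path1_def lin_def algebra_simps sum.distrib sum_subtractf sum_distrib_left)
  also have "\<bar>\<dots>\<bar> \<le> (\<Sum>i\<in>I. \<bar>(F i y - F i x - (y - x) * F1 i x) * \<xi> i \<omega>\<bar>)" by (rule sum_abs)
  also have "\<dots> \<le> (\<Sum>i\<in>I. (B * (y - x)\<^sup>2) * \<bar>\<xi> i \<omega>\<bar>)"
    unfolding abs_mult by (intro sum_mono mult_right_mono F_taylor) auto
  finally show ?thesis by (simp add: sumabs_def sum_distrib_left sum_distrib_right mult_ac)
qed

text \<open>
  The angle between nearby points of the curve is its speed times the step, with a quadratic error that is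
  uniform on compact intervals. The constant arises from \<open>b\<close>, a lower bound of \<open>|v|\<^sup>2\<close>, from \<open>A\<close>, an
  upper bound of \<open>|v|\<close> and of the length of the derivative, and from \<open>B\<close>, which bounds the second
  derivatives.
\<close>

lemma angle_first_order:
  assumes pos: "\<And>x. x \<in> {p..q} \<Longrightarrow> ip (v x) (v x) > 0" and pq: "p < q"
  obtains C d where "d > 0" "C \<ge> 0"
    "\<And>x y. x \<in> {p..q} \<Longrightarrow> y \<in> {p..q} \<Longrightarrow> x < y \<Longrightarrow> y < x + d \<Longrightarrow>
      ip (v x) (v y) > 0 \<and> \<bar>arctan (sqrt (gram (v x) (v y)) / ip (v x) (v y)) - (y - x) * rate x\<bar> \<le> C * (y - x)\<^sup>2"
proof -
  have ne: "{p..q} \<noteq> {}" using pq by simp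
  obtain x0 where x0: "x0 \<in> {p..q}" "\<And>x. x \<in> {p..q} \<Longrightarrow> ip (v x0) (v x0) \<le> ip (v x) (v x)"
    using continuous_attains_inf[OF _ ne ip_continuous(1)] by auto
  define b where "b = ip (v x0) (v x0)"
  have b: "b > 0" "\<And>x. x \<in> {p..q} \<Longrightarrow> b \<le> ip (v x) (v x)"
    using x0 pos by (auto simp: b_def)
  have "\<exists>A\<ge>0. \<forall>x\<in>{p..q}. nrm (v x) \<le> A \<and> nrm (v1 x) \<le> A"
  proof -
    obtain x1 where x1: "\<And>x. x \<in> {p..q} \<Longrightarrow> ip (v x) (v x) \<le> ip (v x1) (v x1)"
      using continuous_attains_sup[OF compact_Icc ne ip_continuous(1)] by blast
    obtain x2 where x2: "\<And>x. x \<in> {p..q} \<Longrightarrow> ip (v1 x) (v1 x) \<le> ip (v1 x2) (v1 x2)"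
      using continuous_attains_sup[OF compact_Icc ne ip_continuous(3)] by blast
    show ?thesis
    proof (intro exI[of _ "nrm (v x1) + nrm (v1 x2)"] conjI ballI add_nonneg_nonneg L2_set_nonneg)
      fix x assume x: "x \<in> {p..q}"
      have "nrm (v x) \<le> nrm (v x1)" "nrm (v1 x) \<le> nrm (v1 x2)"
        using x1[OF x] x2[OF x] by (auto simp: nrm_eq)
      moreover have "0 \<le> nrm (v x1)" "0 \<le> nrm (v1 x2)" by (rule L2_set_nonneg)+
      ultimately show "nrm (v x) \<le> nrm (v x1) + nrm (v1 x2)" "nrm (v1 x) \<le> nrm (v x1) + nrm (v1 x2)"
        by linarith+
    qed
  qed
  then obtain A where A: "A \<ge> 0" "\<And>x. x \<in> {p..q} \<Longrightarrow> nrm (v x) \<le> A" "\<And>x. x \<in> {p..q} \<Longrightarrow> nrm (v1 x) \<le> A"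
    by blast
  define B' where "B' = card I * B"
  have B': "B' \<ge> 0" using B_nonneg by (simp add: B'_def)
  define C1 where "C1 = A * A + A * B'"
  have C1: "C1 \<ge> 0" using A B' by (simp add: C1_def)
  define d where "d = min 1 (b / (2 * (C1 + 1)))"
  have d: "d > 0" "d \<le> 1" using b C1 by (auto simp: d_def)
  define C2 where "C2 = A * B' * 2 / b + A * A * C1 * 2 / b\<^sup>2"
  define C3 where "C3 = (A * A + A * B') * 2 / b"
  have C23: "C2 \<ge> 0" "C3 \<ge> 0" using A B' C1 b by (auto simp: C2_def C3_def)
  show thesis
  proof (rule that[of d "C2 + C3\<^sup>2"])
    show "d > 0" by (fact d) 
    show "0 \<le> C2 + C3\<^sup>2" using C23 by simp
    fix x y assume xy: "x \<in> {p..q}" "y \<in> {p..q}" "x < y" "y < x + d"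
    define h where "h = y - x"
    have h: "h > 0" "h < d" "h \<le> 1" using xy d by (auto simp: h_def)
    define R where "R = (\<lambda>i. F i y - F i x - h * F1 i x)"
    have z: "F i y = F i x + h * F1 i x + R i" for i by (simp add: R_def)
    have "nrm R \<le> (\<Sum>i\<in>I. \<bar>R i\<bar>)" by (rule L2_set_le_sum_abs)
    also have "\<dots> \<le> (\<Sum>i\<in>I. B * h\<^sup>2)"
      using F_taylor by (intro sum_mono) (simp add: R_def h_def)
    finally have R: "nrm R \<le> B' * h\<^sup>2" by (simp add: B'_def)
    define D where "D = ip (v x) (v x)"
    define D' where "D' = ip (v x) (v y)"
    have D: "D \<ge> b" "D > 0" using b xy by (auto simp: D_def intro: less_le_trans)
    have eqD': "D' = D + h * ip (v x) (v1 x) + ip (v x) R"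
      unfolding D'_def D_def ip_def by (simp add: R_def algebra_simps sum.distrib sum_subtractf sum_distrib_left)
    have ipR: "\<bar>ip (v x) R\<bar> \<le> A * (B' * h\<^sup>2)"
      by (rule order_trans[OF ip_le_nrm]) (intro mult_mono A R xy L2_set_nonneg A(1))
    have ip1: "\<bar>ip (v x) (v1 x)\<bar> \<le> A * A"
      by (rule order_trans[OF ip_le_nrm]) (intro mult_mono A xy L2_set_nonneg A(1))
    have h2: "h\<^sup>2 \<le> h" using h by (simp add: power2_eq_square mult_left_le)
    have "\<bar>D' - D\<bar> \<le> \<bar>h * ip (v x) (v1 x)\<bar> + \<bar>ip (v x) R\<bar>" unfolding eqD' by linarith
    also have "\<dots> \<le> h * (A * A) + A * (B' * h)"
    proof (intro add_mono)
      show "\<bar>h * ip (v x) (v1 x)\<bar> \<le> h * (A * A)" using ip1 h by (simp add: abs_mult)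
      have "A * (B' * h\<^sup>2) \<le> A * (B' * h)" using h2 A B' by (intro mult_left_mono)
      then show "\<bar>ip (v x) R\<bar> \<le> A * (B' * h)" using ipR by linarith
    qed
    finally have D'D: "\<bar>D' - D\<bar> \<le> h * C1" by (simp add: C1_def algebra_simps)
    have "h * C1 \<le> d * (C1 + 1)" using h C1 by (intro mult_mono) auto
    also have "\<dots> \<le> b / (2 * (C1 + 1)) * (C1 + 1)" using C1 by (intro mult_right_mono) (auto simp: d_def)
    also have "\<dots> = b / 2" using C1 by (simp add: field_simps)
    finally have hC: "h * C1 \<le> b / 2" .
    have D'b: "D' \<ge> b / 2" using D'D hC D by linarith
    then have D'0: "D' > 0" using b by linarith
    define g where "g = sqrt (gram (v x) (v1 x))"
    have g: "0 \<le> g" "g \<le> A * A"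
      using sqrt_gram_le[of "v x" "v1 x"] A xy by (auto simp: g_def gram_nonneg intro!: order_trans[OF sqrt_gram_le] mult_mono)
    define G where "G = sqrt (gram (v x) (v y))"
    have Gg: "\<bar>G - h * g\<bar> \<le> A * (B' * h\<^sup>2)"
    proof -
      have "\<bar>G - h * g\<bar> \<le> nrm (v x) * nrm R"
        unfolding G_def g_def by (rule sqrt_gram_diff) (use D h z in \<open>auto simp: D_def\<close>)
      also have "\<dots> \<le> A * (B' * h\<^sup>2)" by (intro mult_mono A R xy L2_set_nonneg A(1))
      finally show ?thesis .
    qed
    define T where "T = G / D'"
    have T0: "0 \<le> T" using D'0 by (simp add: T_def G_def gram_nonneg)
    have invD': "1 / D' \<le> 2 / b" using D'b D'0 b by (simp add: field_simps)
    have "T - h * (g / D) = (G - h * g) / D' + h * g * ((D - D') / (D * D'))"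
      using D D'0 by (simp add: T_def field_simps)
    also have "\<bar>\<dots>\<bar> \<le> \<bar>(G - h * g) / D'\<bar> + \<bar>h * g * ((D - D') / (D * D'))\<bar>" by (rule abs_triangle_ineq)
    also have "\<dots> \<le> A * B' * 2 / b * h\<^sup>2 + A * A * C1 * 2 / b\<^sup>2 * h\<^sup>2"
    proof (intro add_mono)
      have "\<bar>(G - h * g) / D'\<bar> = \<bar>G - h * g\<bar> * (1 / D')" using D'0 by simp
      also have "\<dots> \<le> (A * (B' * h\<^sup>2)) * (2 / b)"
        using Gg invD' D'0 A B' by (intro mult_mono) auto
      finally show "\<bar>(G - h * g) / D'\<bar> \<le> A * B' * 2 / b * h\<^sup>2" by (simp add: field_simps)
      have "1 / D \<le> 1 / b" using D b by (simp add: field_simps)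
      then have "(1 / D) * (1 / D') \<le> (1 / b) * (2 / b)" using invD' D'0 D b by (intro mult_mono) auto
      then have i: "1 / (D * D') \<le> 2 / b\<^sup>2" by (simp add: power2_eq_square)
      have "\<bar>h * g * ((D - D') / (D * D'))\<bar> = (h * g) * (\<bar>D' - D\<bar> * (1 / (D * D')))"
        using h g D D'0 by (simp add: abs_mult abs_minus_commute)
      also have "\<dots> \<le> (h * (A * A)) * ((h * C1) * (2 / b\<^sup>2))"
        using h g D D'0 D'D i A C1 by (intro mult_mono) auto
      finally show "\<bar>h * g * ((D - D') / (D * D'))\<bar> \<le> A * A * C1 * 2 / b\<^sup>2 * h\<^sup>2"
        by (simp add: power2_eq_square field_simps)
    qed
    finally have Tr: "\<bar>T - h * (g / D)\<bar> \<le> C2 * h\<^sup>2" by (simp add: C2_def algebra_simps)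
    have "G \<le> h * g + A * (B' * h\<^sup>2)" using Gg by linarith
    also have "\<dots> \<le> h * (A * A) + A * (B' * h)"
      using g h h2 A B' by (intro add_mono mult_left_mono) auto
    also have "\<dots> = h * (A * A + A * B')" by (simp add: algebra_simps)
    finally have Gh: "G \<le> h * (A * A + A * B')" .
    have "T = G * (1 / D')" by (simp add: T_def)
    also have "\<dots> \<le> (h * (A * A + A * B')) * (2 / b)"
      using Gh invD' D'0 A B' h by (intro mult_mono) auto
    also have "\<dots> = C3 * h" by (simp add: C3_def)
    finally have T3: "T \<le> C3 * h" .
    have "T\<^sup>2 \<le> (C3 * h)\<^sup>2" using T3 T0 by (intro power_mono)
    then have "\<bar>arctan T - T\<bar> \<le> C3\<^sup>2 * h\<^sup>2"
      using arctan_near_id[OF T0] by (simp add: power_mult_distrib)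
    then have "\<bar>arctan T - h * (g / D)\<bar> \<le> C2 * h\<^sup>2 + C3\<^sup>2 * h\<^sup>2" using Tr by linarith
    then show "ip (v x) (v y) > 0 \<and> \<bar>arctan (sqrt (gram (v x) (v y)) / ip (v x) (v y)) - (y - x) * rate x\<bar> \<le> (C2 + C3\<^sup>2) * (y - x)\<^sup>2"
      using D'0 by (simp add: T_def G_def D'_def D_def g_def h_def rate_def algebra_simps)
  qed
qed

lemma angle_integral:
  assumes pos: "\<And>x. x \<in> {p..q} \<Longrightarrow> ip (v x) (v x) > 0" and pq: "p < q" and e: "e > 0"
  obtains d where "d > 0"
    "\<And>x y. x \<in> {p..q} \<Longrightarrow> y \<in> {p..q} \<Longrightarrow> x < y \<Longrightarrow> y < x + d \<Longrightarrow>
      ip (v x) (v y) > 0 \<and> \<bar>arctan (sqrt (gram (v x) (v y)) / ip (v x) (v y)) - integral {x..y} rate\<bar> \<le> e * (y - x)"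
proof -
  obtain C d1 where C: "d1 > 0" "C \<ge> 0"
    "\<And>x y. x \<in> {p..q} \<Longrightarrow> y \<in> {p..q} \<Longrightarrow> x < y \<Longrightarrow> y < x + d1 \<Longrightarrow>
      ip (v x) (v y) > 0 \<and> \<bar>arctan (sqrt (gram (v x) (v y)) / ip (v x) (v y)) - (y - x) * rate x\<bar> \<le> C * (y - x)\<^sup>2"
    using angle_first_order[OF pos pq] by metis
  have cont: "continuous_on {p..q} rate" by (rule rate_continuous[OF pos])
  then have "uniformly_continuous_on {p..q} rate" by (rule compact_uniformly_continuous) simp
  then obtain d2 where d2: "d2 > 0" "\<And>x y. x \<in> {p..q} \<Longrightarrow> y \<in> {p..q} \<Longrightarrow> dist y x < d2 \<Longrightarrow> dist (rate y) (rate x) < e / 2"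
    using e unfolding uniformly_continuous_on_def by (metis half_gt_zero)
  define d where "d = min (min d1 d2) (e / (2 * (C + 1)))"
  show thesis
  proof (rule that[of d])
    show "d > 0" using C d2 e by (simp add: d_def)
    have dd: "d \<le> d2" by (simp add: d_def)
    fix x y assume xy: "x \<in> {p..q}" "y \<in> {p..q}" "x < y" "y < x + d"
    have 1: "ip (v x) (v y) > 0" "\<bar>arctan (sqrt (gram (v x) (v y)) / ip (v x) (v y)) - (y - x) * rate x\<bar> \<le> C * (y - x)\<^sup>2"
      using C(3)[OF xy(1-3)] xy(4) by (auto simp: d_def)
    have "(y - x) * C \<le> (e / (2 * (C + 1))) * (C + 1)"
      using xy C by (intro mult_mono) (auto simp: d_def)
    also have "\<dots> = e / 2" using C(2) by (simp add: field_simps)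
    finally have "(y - x) * C * (y - x) \<le> e / 2 * (y - x)" using xy by (intro mult_right_mono) auto
    then have 2: "C * (y - x)\<^sup>2 \<le> e / 2 * (y - x)" by (simp add: power2_eq_square mult_ac)
    have sub: "{x..y} \<subseteq> {p..q}" using xy by auto
    have int: "rate integrable_on {x..y}"
      by (intro integrable_continuous_interval continuous_on_subset[OF cont sub])
    have "norm (integral {x..y} (\<lambda>z. rate z - rate x)) \<le> e / 2 * (y - x)"
    proof (rule integral_bound)
      show "continuous_on {x..y} (\<lambda>z. rate z - rate x)"
        by (intro continuous_intros continuous_on_subset[OF cont sub])
      fix z assume "z \<in> {x..y}"
      then show "norm (rate z - rate x) \<le> e / 2"
        using d2(2)[of x z] xy dd by (auto simp: dist_real_def)
    qed (use xy in auto)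
    also have "integral {x..y} (\<lambda>z. rate z - rate x) = integral {x..y} rate - (y - x) * rate x"
      using xy by (subst integral_diff[OF int]) auto
    finally have 3: "\<bar>integral {x..y} rate - (y - x) * rate x\<bar> \<le> e / 2 * (y - x)"
      by (simp only: real_norm_def)
    show "ip (v x) (v y) > 0 \<and> \<bar>arctan (sqrt (gram (v x) (v y)) / ip (v x) (v y)) - integral {x..y} rate\<bar> \<le> e * (y - x)"
    proof (rule conjI[OF 1(1)])
      have "e * (y - x) = e / 2 * (y - x) + e / 2 * (y - x)" by (simp add: field_simps)
      then show "\<bar>arctan (sqrt (gram (v x) (v y)) / ip (v x) (v y)) - integral {x..y} rate\<bar> \<le> e * (y - x)"
        using 1(2) 2 3 by linarith
    qed
  qed
qed

end

section \<open>The expected number of zeros as a curve length\<close>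

context gaussian_curve
begin

lemma sumabs_measurable[measurable]: "sumabs \<in> borel_measurable M"
  unfolding sumabs_def by measurable

text \<open>
  A double zero forces the path to be of order \<open>h\<^sup>2\<close> at some point of any mesh of width \<open>h\<close>. Each mesh point
  has probability \<open>O(h\<^sup>2)\<close> for this and there are \<open>O(1/h)\<close> of them, so the event is contained in events of
  probability \<open>O(h)\<close>. The Taylor remainder depends on the coefficients; restricting to
  \<open>sumabs \<le> R\<close> makes it uniform.
\<close>

lemma AE_no_double_zero:
  assumes pos: "\<And>x. x \<in> {p..q} \<Longrightarrow> ip (v x) (v x) > 0" and pq: "p < q"
  shows "AE \<omega> in M. \<forall>x\<in>{p..q}. \<not> (path \<omega> x = 0 \<and> path1 \<omega> x = 0)"
proof -
  have ne: "{p..q} \<noteq> {}" using pq by simp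
  obtain x0 where x0: "x0 \<in> {p..q}" "\<And>x. x \<in> {p..q} \<Longrightarrow> ip (v x0) (v x0) \<le> ip (v x) (v x)"
    using continuous_attains_inf[OF compact_Icc ne ip_continuous(1)] by blast
  define b where "b = sqrt (ip (v x0) (v x0))"
  have b: "b > 0" "\<And>x. x \<in> {p..q} \<Longrightarrow> b \<le> sqrt (ip (v x) (v x))"
    using x0 pos by (auto simp: b_def)
  \<comment> \<open>Fix a bound for the coefficients; countably many bounds exhaust the space.\<close>
  have step: "AE \<omega> in M. sumabs \<omega> \<le> real R \<longrightarrow> (\<forall>x\<in>{p..q}. \<not> (path \<omega> x = 0 \<and> path1 \<omega> x = 0))" for R
  proof -
    define X where "X = (\<lambda>N k. p + real k * ((q - p) / real N))"
    define E where "E = (\<lambda>N k. {\<omega> \<in> space M. \<bar>lin (v (X N k)) \<omega>\<bar> \<le> B * R * ((q - p) / real N)\<^sup>2})"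
    define U where "U = (\<lambda>N. \<Union>k\<le>N. E N k)"
    have E[measurable]: "E N k \<in> sets M" for N k unfolding E_def by measurable
    have U[measurable]: "U N \<in> sets M" for N unfolding U_def by auto
    define c where "c = B * R * (q - p)\<^sup>2 / (\<sigma> * b)"
    have XI: "X N k \<in> {p..q}" if "k \<le> N" "N > 0" for N k
    proof -
      have "real k * ((q - p) / real N) \<le> real N * ((q - p) / real N)"
        using that pq by (intro mult_right_mono) auto
      then show ?thesis using that pq by (simp add: X_def)
    qed
    have PU: "prob (U N) \<le> c * (2 / real N)" if N: "N > 0" for N
    proof -
      have PE: "prob (E N k) \<le> c / (real N)\<^sup>2" if k: "k \<le> N" for k
      proof -
        have "prob (E N k) \<le> B * R * ((q - p) / real N)\<^sup>2 / (\<sigma> * sqrt (ip (v (X N k)) (v (X N k))))"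
          unfolding E_def using pos XI[OF k N] B_nonneg by (intro prob_small) auto
        also have "\<dots> \<le> B * R * ((q - p) / real N)\<^sup>2 / (\<sigma> * b)"
          using b(1) b(2)[OF XI[OF k N]] sig B_nonneg pos[OF XI[OF k N]] by (intro divide_left_mono mult_left_mono mult_pos_pos) auto
        also have "\<dots> = c / (real N)\<^sup>2" by (simp add: c_def power_divide)
        finally show ?thesis .
      qed
      have c0: "c \<ge> 0" using B_nonneg b sig by (simp add: c_def)
      have "prob (U N) \<le> (\<Sum>k\<le>N. prob (E N k))"
        unfolding U_def by (intro finite_measure_subadditive_finite) auto
      also have "\<dots> \<le> (\<Sum>k\<le>N. c / (real N)\<^sup>2)" by (intro sum_mono PE) simp
      also have "\<dots> = (real N + 1) * (c / (real N)\<^sup>2)" by simp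
      also have "\<dots> \<le> (2 * real N) * (c / (real N)\<^sup>2)" using N c0 by (intro mult_right_mono) auto
      also have "\<dots> = c * (2 / real N)" using N by (simp add: power2_eq_square)
      finally show ?thesis .
    qed
    have "(\<lambda>N. c * (2 / real N)) \<longlonglongrightarrow> c * 0"
      by (intro tendsto_mult tendsto_const lim_const_over_n)
    then have lim: "(\<lambda>N. c * (2 / real N)) \<longlonglongrightarrow> 0" by simp
    define Z where "Z = (\<Inter>N\<in>{1..}. U N)"
    have Z[measurable]: "Z \<in> sets M" unfolding Z_def by (intro sets.countable_INT') auto
    have "prob Z \<le> c * (2 / real N)" if "N \<ge> 1" for N
    proof -
      have "prob Z \<le> prob (U N)" using that by (intro finite_measure_mono) (auto simp: Z_def)
      then show ?thesis using PU[of N] that by simp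
    qed
    then have "prob Z \<le> 0"
      by (intro LIMSEQ_le_const[OF lim]) blast
    then have "prob Z = 0" using measure_nonneg[of M Z] by linarith
    then have "Z \<in> null_sets M" using Z by (simp add: null_sets_def emeasure_eq_measure)
    then show ?thesis
    proof (rule AE_I', intro subsetI)
      fix \<omega> assume "\<omega> \<in> {\<omega> \<in> space M. \<not> (sumabs \<omega> \<le> real R \<longrightarrow> (\<forall>x\<in>{p..q}. \<not> (path \<omega> x = 0 \<and> path1 \<omega> x = 0)))}"
      then obtain x where w: "\<omega> \<in> space M" "sumabs \<omega> \<le> real R" "x \<in> {p..q}" "path \<omega> x = 0" "path1 \<omega> x = 0" by blast
      show "\<omega> \<in> Z" unfolding Z_def
      proof (intro INT_I)
        fix N assume "N \<in> {1::nat..}"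
        then have N: "N > 0" by simp
        define h where "h = (q - p) / real N"
        have h: "h > 0" using pq N by (simp add: h_def)
        define k where "k = nat \<lfloor>(x - p) / h\<rfloor>"
        have r0: "(x - p) / h \<ge> 0" using w h by simp
        have "(x - p) / h \<le> (q - p) / h" using w h by (intro divide_right_mono) auto
        also have "\<dots> = real N" using pq N by (simp add: h_def)
        finally have "(x - p) / h \<le> real N" .
        then have kN: "k \<le> N" using r0 unfolding k_def by linarith
        have kf: "real k \<le> (x - p) / h" "(x - p) / h < real k + 1"
          unfolding k_def using r0 by linarith+
        have "\<bar>X N k - x\<bar> \<le> h"
        proof -
          have X: "X N k = p + real k * h" by (simp add: X_def h_def)
          have "real k * h \<le> x - p" using kf(1) h by (simp add: pos_le_divide_eq)
          moreover have "x - p < (real k + 1) * h" using kf(2) h by (simp add: pos_divide_less_eq)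
          ultimately show ?thesis unfolding X abs_le_iff distrib_right by linarith
        qed
        then have "(X N k - x)\<^sup>2 \<le> h\<^sup>2" using h by (metis abs_le_square_iff abs_of_pos)
        then have "B * sumabs \<omega> * (X N k - x)\<^sup>2 \<le> B * R * h\<^sup>2"
          using w B_nonneg by (intro mult_mono) (auto simp: sumabs_def sum_nonneg)
        then have "\<bar>path \<omega> (X N k)\<bar> \<le> B * R * h\<^sup>2"
          using path_taylor[of \<omega> "X N k" x] w by simp
        then have "\<omega> \<in> E N k" using w by (simp add: E_def path_def h_def)
        then show "\<omega> \<in> U N" using kN by (auto simp: U_def)
      qed
    qed
  qed
  then have "AE \<omega> in M. \<forall>R. sumabs \<omega> \<le> real R \<longrightarrow> (\<forall>x\<in>{p..q}. \<not> (path \<omega> x = 0 \<and> path1 \<omega> x = 0))"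
    unfolding AE_all_countable by blast
  then show ?thesis
  proof eventually_elim
    case (elim \<omega>)
    obtain R where "sumabs \<omega> \<le> real R" using real_arch_simple by blast
    then show ?case using elim by blast
  qed
qed

text \<open>
  The mesh of index \<open>N\<close> has \<open>Suc N\<close> cells, which avoids the degenerate case of no cell.
\<close>

definition mesh :: "real \<Rightarrow> real \<Rightarrow> nat \<Rightarrow> nat \<Rightarrow> real" where
  "mesh p q N k = p + real k * ((q - p) / real (Suc N))"

definition sign_changes :: "real \<Rightarrow> real \<Rightarrow> nat \<Rightarrow> 'a \<Rightarrow> ennreal" where
  "sign_changes p q N \<omega> = (\<Sum>k<Suc N. indicator {\<omega>\<in>space M. path \<omega> (mesh p q N k) * path \<omega> (mesh p q N (Suc k)) < 0} \<omega>)"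

lemma sign_changes_measurable[measurable]: "sign_changes p q N \<in> borel_measurable M"
  unfolding sign_changes_def by measurable

lemma mesh_props:
  assumes "p < q"
  shows "mesh p q N 0 = p" "mesh p q N (Suc N) = q"
    "mesh p q N (Suc k) - mesh p q N k = (q - p) / real (Suc N)"
    "mesh p q N k < mesh p q N (Suc k)"
    "k \<le> Suc N \<Longrightarrow> mesh p q N k \<in> {p..q}"
    "k \<le> l \<Longrightarrow> mesh p q N k \<le> mesh p q N l"
proof -
  show "mesh p q N 0 = p" "mesh p q N (Suc N) = q" by (simp_all add: mesh_def)
  show d: "mesh p q N (Suc k) - mesh p q N k = (q - p) / real (Suc N)"
    by (simp add: mesh_def algebra_simps add_divide_distrib[symmetric] diff_divide_distrib[symmetric] del: of_nat_Suc) (simp add: algebra_simps diff_divide_distrib add_divide_distrib)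
  have "(q - p) / real (Suc N) > 0" using assms by simp
  then show "mesh p q N k < mesh p q N (Suc k)" using d by linarith
  show mono: "k \<le> l \<Longrightarrow> mesh p q N k \<le> mesh p q N l" for k l :: nat
    using assms by (simp add: mesh_def mult_right_mono divide_right_mono)
  show "k \<le> Suc N \<Longrightarrow> mesh p q N k \<in> {p..q}"
    using mono[of k "Suc N"] mono[of 0 k] by (simp add: mesh_def)
qed

lemma sign_changes_eq_card:
  assumes "\<omega> \<in> space M"
  shows "sign_changes p q N \<omega> = of_nat (card {k. k < Suc N \<and> path \<omega> (mesh p q N k) * path \<omega> (mesh p q N (Suc k)) < 0})"
proof -
  have "sign_changes p q N \<omega> = (\<Sum>k\<in>{..<Suc N}. if path \<omega> (mesh p q N k) * path \<omega> (mesh p q N (Suc k)) < 0 then 1 else 0)"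
    unfolding sign_changes_def using assms by (intro sum.cong) (auto split: split_indicator)
  also have "\<dots> = of_nat (card {k\<in>{..<Suc N}. path \<omega> (mesh p q N k) * path \<omega> (mesh p q N (Suc k)) < 0})"
    by (subst sum.inter_filter[symmetric]) auto
  finally show ?thesis by simp
qed

lemma sign_changes_le_zcount:
  assumes pq: "p < q" and w: "\<omega> \<in> space M"
  shows "sign_changes p q N \<omega> \<le> zcount (path \<omega>) {p<..<q}"
proof -
  let ?x = "mesh p q N"
  let ?J = "{k. k < Suc N \<and> path \<omega> (?x k) * path \<omega> (?x (Suc k)) < 0}"
  have "of_nat (card ?J) \<le> zcount (path \<omega>) {p<..<q}"
  proof (rule zcount_ge_cells[where A="\<lambda>k. {?x k<..<?x (Suc k)}"])
    show "finite ?J" by (rule finite_subset[of _ "{..<Suc N}"]) auto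
    show "disjoint_family_on (\<lambda>k. {?x k<..<?x (Suc k)}) ?J"
    proof (unfold disjoint_family_on_def, intro ballI impI)
      fix k l :: nat assume "k \<noteq> l"
      then have "Suc k \<le> l \<or> Suc l \<le> k" by linarith
      then show "{?x k<..<?x (Suc k)} \<inter> {?x l<..<?x (Suc l)} = {}"
        using mesh_props(6)[OF pq, of "Suc k" l N] mesh_props(6)[OF pq, of "Suc l" k N] by fastforce
    qed
    fix k assume k: "k \<in> ?J"
    show "{?x k<..<?x (Suc k)} \<subseteq> {p<..<q}"
      using mesh_props(5)[OF pq, of k N] mesh_props(5)[OF pq, of "Suc k" N] k by auto
    have lt: "?x k < ?x (Suc k)" by (rule mesh_props(4)[OF pq])
    have "\<exists>x\<ge>?x k. x \<le> ?x (Suc k) \<and> path \<omega> x = 0"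
    proof (cases "path \<omega> (?x k) < 0")
      case True
      then have "path \<omega> (?x (Suc k)) > 0" using k by (auto simp: mult_less_0_iff)
      then show ?thesis using True lt by (intro IVT') (auto intro: path_continuous)
    next
      case False
      then have "path \<omega> (?x k) > 0" "path \<omega> (?x (Suc k)) < 0" using k by (auto simp: mult_less_0_iff)
      then show ?thesis using lt by (intro IVT2') (auto intro: path_continuous)
    qed
    then obtain x where x: "?x k \<le> x" "x \<le> ?x (Suc k)" "path \<omega> x = 0" by blast
    moreover have "x \<noteq> ?x k" "x \<noteq> ?x (Suc k)" using x(3) k by auto
    ultimately show "\<exists>x\<in>{?x k<..<?x (Suc k)}. path \<omega> x = 0" by force
  qed
  then show ?thesis using sign_changes_eq_card[OF w] by simp
qed

lemma simple_zero_sign_change: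
  assumes f: "(f has_real_derivative l) (at z)" and l: "l \<noteq> 0" and z: "f z = (0::real)"
  shows "\<exists>d>0. \<forall>s t. 0 < s \<longrightarrow> s < d \<longrightarrow> 0 < t \<longrightarrow> t < d \<longrightarrow> f (z - s) * f (z + t) < 0"
proof (cases "l > 0")
  case True
  obtain d1 where d1: "d1 > 0" "\<forall>h>0. h < d1 \<longrightarrow> f z < f (z + h)" using DERIV_pos_inc_right[OF f True] by blast
  obtain d2 where d2: "d2 > 0" "\<forall>h>0. h < d2 \<longrightarrow> f (z - h) < f z" using DERIV_pos_inc_left[OF f True] by blast
  show ?thesis
    using d1 d2 z by (intro exI[of _ "min d1 d2"]) (auto simp: mult_less_0_iff)
next
  case False
  then have neg: "l < 0" using l by linarith
  obtain d1 where d1: "d1 > 0" "\<forall>h>0. h < d1 \<longrightarrow> f z > f (z + h)" using DERIV_neg_dec_right[OF f neg] by blast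
  obtain d2 where d2: "d2 > 0" "\<forall>h>0. h < d2 \<longrightarrow> f (z - h) > f z" using DERIV_neg_dec_left[OF f neg] by blast
  show ?thesis
    using d1 d2 z by (intro exI[of _ "min d1 d2"]) (auto simp: mult_less_0_iff)
qed

text \<open>
  On a fine mesh each of finitely many simple zeros lies in a cell of its own, and the path changes its sign
  across that cell.
\<close>

lemma card_zeros_le_sign_changes:
  assumes pq: "p < q" and w: "\<omega> \<in> space M"
    and simple: "\<forall>x\<in>{p..q}. \<not> (path \<omega> x = 0 \<and> path1 \<omega> x = 0)"
    and off: "\<And>N k. k \<le> Suc N \<Longrightarrow> path \<omega> (mesh p q N k) \<noteq> 0"
    and F: "finite Z" "Z \<subseteq> {x \<in> {p..q}. path \<omega> x = 0}"
  shows "\<forall>\<^sub>F N in sequentially. of_nat (card Z) \<le> sign_changes p q N \<omega>"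
proof -
  have "\<forall>z\<in>Z. \<exists>d>0. \<forall>s t. 0 < s \<longrightarrow> s < d \<longrightarrow> 0 < t \<longrightarrow> t < d \<longrightarrow> path \<omega> (z - s) * path \<omega> (z + t) < 0"
    using simple F(2) by (intro ballI simple_zero_sign_change[OF path_deriv]) auto
  then obtain D where D: "\<And>z. z \<in> Z \<Longrightarrow> D z > 0"
    "\<And>z s t. z \<in> Z \<Longrightarrow> 0 < s \<Longrightarrow> s < D z \<Longrightarrow> 0 < t \<Longrightarrow> t < D z \<Longrightarrow> path \<omega> (z - s) * path \<omega> (z + t) < 0"
    by metis
  obtain d where d: "d > 0" "\<And>x y. x \<in> Z \<Longrightarrow> y \<in> Z \<Longrightarrow> x \<noteq> y \<Longrightarrow> d \<le> dist x y"
    using finite_separation[OF F(1)] by metis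
  define e where "e = Min (insert d (D ` Z))"
  have e: "e > 0" "e \<le> d" "\<And>z. z \<in> Z \<Longrightarrow> e \<le> D z"
    using F(1) D(1) d(1) by (auto simp: e_def)
  have "(\<lambda>N. (q - p) / real (Suc N)) \<longlonglongrightarrow> 0"
    by (rule LIMSEQ_Suc[where f="\<lambda>N. (q - p) / real N"]) (rule lim_const_over_n)
  then have "\<forall>\<^sub>F N in sequentially. (q - p) / real (Suc N) < e" using e(1) by (rule order_tendstoD)
  then show ?thesis
  proof eventually_elim
    case (elim N)
    let ?x = "mesh p q N" and ?h = "(q - p) / real (Suc N)"
    let ?J = "{k. k < Suc N \<and> path \<omega> (?x k) * path \<omega> (?x (Suc k)) < 0}"
    define g where "g = (\<lambda>z. nat \<lfloor>(z - p) / ?h\<rfloor>)"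
    have h: "?h > 0" using pq by simp
    have mult_le: "a * H \<le> b" if "H > 0" "a \<le> b / H" for a b H :: real
      using that by (simp add: pos_le_divide_eq)
    have less_mult: "b < a * H" if "H > 0" "b / H < a" for a b H :: real
      using that by (simp add: pos_divide_less_eq)
    have key: "g z < Suc N \<and> ?x (g z) < z \<and> z < ?x (Suc (g z))" if z: "z \<in> Z" for z
    proof -
      have zI: "z \<in> {p..q}" "path \<omega> z = 0" using F z by auto
      have "z \<noteq> ?x 0" "z \<noteq> ?x (Suc N)" using off[of 0 N] off[of "Suc N" N] zI by auto
      then have zo: "p < z" "z < q" using zI mesh_props(1,2)[OF pq] by auto
      have r0: "(z - p) / ?h \<ge> 0" using zo h by simp
      have "(z - p) / ?h < (q - p) / ?h" using zo h by (intro divide_strict_right_mono) auto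
      also have "\<dots> = real (Suc N)" using pq by (simp add: field_simps)
      finally have rN: "(z - p) / ?h < real (Suc N)" .
      have kf: "real (g z) \<le> (z - p) / ?h" "(z - p) / ?h < real (g z) + 1"
        unfolding g_def using r0 by linarith+
      then have gN: "g z < Suc N" using rN by linarith
      have "real (g z) * ?h \<le> z - p" "z - p < (real (g z) + 1) * ?h"
        using kf mult_le[OF h] less_mult[OF h] by blast+
      then have "?x (g z) \<le> z" "z < ?x (Suc (g z))" by (auto simp: mesh_def add.commute)
      moreover have "z \<noteq> ?x (g z)" using off[of "g z" N] gN zI by auto
      ultimately show ?thesis using gN by auto
    qed
    have diff: "?x (Suc k) - ?x k = ?h" for k by (rule mesh_props(3)[OF pq])
    have "g ` Z \<subseteq> ?J"
    proof (intro image_subsetI CollectI conjI)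
      fix z assume z: "z \<in> Z"
      show "g z < Suc N" using key[OF z] by simp
      have "path \<omega> (z - (z - ?x (g z))) * path \<omega> (z + (?x (Suc (g z)) - z)) < 0"
        using key[OF z] diff[of "g z"] elim e(3)[OF z] by (intro D(2)[OF z]) linarith+
      then show "path \<omega> (?x (g z)) * path \<omega> (?x (Suc (g z))) < 0" by simp
    qed
    moreover have "inj_on g Z"
    proof (rule inj_onI, rule ccontr)
      fix y z assume yz: "y \<in> Z" "z \<in> Z" "g y = g z" "y \<noteq> z"
      have "\<bar>y - z\<bar> < ?h" using key[OF yz(1)] key[OF yz(2)] diff[of "g z"] yz(3) by (simp only:) linarith
      then show False using d(2)[OF yz(1,2,4)] elim e(2) by (simp add: dist_real_def)
    qed
    moreover have "finite ?J" by (rule finite_subset[of _ "{..<Suc N}"]) auto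
    ultimately have "card Z \<le> card ?J" by (intro card_inj_on_le)
    then show ?case using sign_changes_eq_card[OF w] by simp
  qed
qed

lemma AE_zcount_le_liminf:
  assumes pos: "\<And>x. x \<in> {p..q} \<Longrightarrow> ip (v x) (v x) > 0" and pq: "p < q"
  shows "AE \<omega> in M. zcount (path \<omega>) {p..q} \<le> liminf (\<lambda>N. sign_changes p q N \<omega>)"
proof -
  have "AE \<omega> in M. \<forall>N k. k \<le> Suc N \<longrightarrow> path \<omega> (mesh p q N k) \<noteq> 0"
  proof (subst AE_all_countable, intro allI, subst AE_all_countable, intro allI)
    fix N k
    show "AE \<omega> in M. k \<le> Suc N \<longrightarrow> path \<omega> (mesh p q N k) \<noteq> 0"
      using AE_lin_nonzero[OF pos[OF mesh_props(5)[OF pq, of k N]]]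
      by (cases "k \<le> Suc N") (auto simp: path_def)
  qed
  moreover have "AE \<omega> in M. \<forall>x\<in>{p..q}. \<not> (path \<omega> x = 0 \<and> path1 \<omega> x = 0)"
    by (rule AE_no_double_zero[OF pos pq])
  ultimately show ?thesis using AE_space
  proof eventually_elim
    case (elim \<omega>)
    show ?case
    proof (rule zcount_le)
      fix Z assume "finite Z" "Z \<subseteq> {x \<in> {p..q}. path \<omega> x = 0}"
      then show "of_nat (card Z) \<le> liminf (\<lambda>N. sign_changes p q N \<omega>)"
        using elim by (intro Liminf_bounded card_zeros_le_sign_changes pq) auto
    qed
  qed
qed

lemma zcount_path_measurable[measurable]:
  "(\<lambda>\<omega>. zcount (path \<omega>) {p..q}) \<in> borel_measurable M"
  "(\<lambda>\<omega>. zcount (path \<omega>) {p<..<q}) \<in> borel_measurable M"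
  by (intro measurable_zcount path_continuous path_measurable sigma_compact_interval sigma_compact_compact compact_Icc)+

text \<open>
  The probabilities of a sign change in the cells are angles divided by \<open>\<pi>\<close>, and the angles add up to the
  length of the curve.
\<close>

lemma expected_sign_changes:
  assumes pos: "\<And>x. x \<in> {p..q} \<Longrightarrow> ip (v x) (v x) > 0" and pq: "p < q" and e: "e > 0"
  shows "\<forall>\<^sub>F N in sequentially. \<exists>s. (\<integral>\<^sup>+\<omega>. sign_changes p q N \<omega> \<partial>M) = ennreal s \<and> 0 \<le> s \<and> \<bar>s - integral {p..q} rate / pi\<bar> \<le> e"
proof -
  define e' where "e' = pi * e / (q - p)"
  have e': "e' > 0" using e pq by (simp add: e'_def)
  obtain d where d: "d > 0"
    "\<And>x y. x \<in> {p..q} \<Longrightarrow> y \<in> {p..q} \<Longrightarrow> x < y \<Longrightarrow> y < x + d \<Longrightarrow>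
      ip (v x) (v y) > 0 \<and> \<bar>arctan (sqrt (gram (v x) (v y)) / ip (v x) (v y)) - integral {x..y} rate\<bar> \<le> e' * (y - x)"
    using angle_integral[OF pos pq e'] by metis
  have "(\<lambda>N. (q - p) / real (Suc N)) \<longlonglongrightarrow> 0"
    by (rule LIMSEQ_Suc[where f="\<lambda>N. (q - p) / real N"]) (rule lim_const_over_n)
  then have "\<forall>\<^sub>F N in sequentially. (q - p) / real (Suc N) < d" using d(1) by (rule order_tendstoD)
  then show ?thesis
  proof eventually_elim
    case (elim N)
    let ?x = "mesh p q N" and ?h = "(q - p) / real (Suc N)"
    let ?A = "\<lambda>k. {\<omega>\<in>space M. path \<omega> (?x k) * path \<omega> (?x (Suc k)) < 0}"
    define s where "s = (\<Sum>k<Suc N. prob (?A k))"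
    have "(\<integral>\<^sup>+\<omega>. sign_changes p q N \<omega> \<partial>M) = (\<Sum>k<Suc N. \<integral>\<^sup>+\<omega>. indicator (?A k) \<omega> \<partial>M)"
      unfolding sign_changes_def by (rule nn_integral_sum) measurable
    also have "\<dots> = (\<Sum>k<Suc N. ennreal (prob (?A k)))"
      by (intro sum.cong refl) (subst nn_integral_indicator, auto simp: emeasure_eq_measure)
    also have "\<dots> = ennreal s" unfolding s_def by (rule sum_ennreal) simp
    finally have S: "(\<integral>\<^sup>+\<omega>. sign_changes p q N \<omega> \<partial>M) = ennreal s" .
    have s0: "s \<ge> 0" by (simp add: s_def sum_nonneg)
    have cell: "\<bar>prob (?A k) - integral {?x k..?x (Suc k)} rate / pi\<bar> \<le> e' * ?h / pi" if k: "k < Suc N" for k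
    proof -
      have xk: "?x k \<in> {p..q}" "?x (Suc k) \<in> {p..q}" using mesh_props(5)[OF pq] k by auto
      have lt: "?x k < ?x (Suc k)" by (rule mesh_props(4)[OF pq])
      have df: "?x (Suc k) - ?x k = ?h" by (rule mesh_props(3)[OF pq])
      then have "?x (Suc k) < ?x k + d" using elim by linarith
      note * = d(2)[OF xk lt this]
      have "prob (?A k) = arctan (sqrt (gram (v (?x k)) (v (?x (Suc k)))) / ip (v (?x k)) (v (?x (Suc k)))) / pi"
        unfolding path_def using * by (intro prob_sign_change) simp
      then have "prob (?A k) - integral {?x k..?x (Suc k)} rate / pi
         = (arctan (sqrt (gram (v (?x k)) (v (?x (Suc k)))) / ip (v (?x k)) (v (?x (Suc k)))) - integral {?x k..?x (Suc k)} rate) / pi"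
        by (simp add: diff_divide_distrib)
      then have "\<bar>prob (?A k) - integral {?x k..?x (Suc k)} rate / pi\<bar>
         = \<bar>arctan (sqrt (gram (v (?x k)) (v (?x (Suc k)))) / ip (v (?x k)) (v (?x (Suc k)))) - integral {?x k..?x (Suc k)} rate\<bar> / pi"
        by simp
      also have "\<dots> \<le> (e' * (?x (Suc k) - ?x k)) / pi" using * by (intro divide_right_mono) auto
      finally show ?thesis by (simp only: df)
    qed
    have cont: "continuous_on {p..q} rate" by (rule rate_continuous[OF pos])
    have comb: "(\<Sum>k<n. integral {?x k..?x (Suc k)} rate) = integral {p..?x n} rate" if "n \<le> Suc N" for n
      using that
    proof (induction n)
      case 0 show ?case using mesh_props(1)[OF pq, of N] by simp
    next
      case (Suc n)
      have "integral {p..?x n} rate + integral {?x n..?x (Suc n)} rate = integral {p..?x (Suc n)} rate"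
      proof (rule Henstock_Kurzweil_Integration.integral_combine)
        show "p \<le> ?x n" "?x n \<le> ?x (Suc n)"
          using mesh_props(5)[OF pq, of n N] mesh_props(4)[OF pq, of N n] Suc by auto
        show "rate integrable_on {p..?x (Suc n)}"
          using mesh_props(5)[OF pq, of "Suc n" N] Suc
          by (intro integrable_continuous_interval continuous_on_subset[OF cont]) auto
      qed
      then show ?case using Suc by simp
    qed
    have "integral {p..q} rate / pi = (\<Sum>k<Suc N. integral {?x k..?x (Suc k)} rate / pi)"
      using comb[of "Suc N"] mesh_props(2)[OF pq, of N] by (simp only: sum_divide_distrib[symmetric])
    then have "\<bar>s - integral {p..q} rate / pi\<bar> = \<bar>\<Sum>k<Suc N. (prob (?A k) - integral {?x k..?x (Suc k)} rate / pi)\<bar>"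
      by (simp only: s_def sum_subtractf)
    also have "\<dots> \<le> (\<Sum>k<Suc N. \<bar>prob (?A k) - integral {?x k..?x (Suc k)} rate / pi\<bar>)" by (rule sum_abs)
    also have "\<dots> \<le> (\<Sum>k<Suc N. e' * ?h / pi)" by (intro sum_mono cell) simp
    also have "\<dots> = real (Suc N) * (e' * ?h / pi)" by simp
    also have "\<dots> = e' * (q - p) / pi" by (simp del: of_nat_Suc)
    also have "\<dots> = e" using pq by (simp add: e'_def)
    finally show ?case using S s0 by blast
  qed
qed

text \<open>
  Fatou's lemma applied to the sign changes on finer and finer meshes.
\<close>

theorem expected_zeros_upper:
  assumes pos: "\<And>x. x \<in> {p..q} \<Longrightarrow> ip (v x) (v x) > 0" and pq: "p < q"
  shows "(\<integral>\<^sup>+\<omega>. zcount (path \<omega>) {p..q} \<partial>M) \<le> ennreal (integral {p..q} rate / pi)"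
proof (rule ennreal_le_epsilon)
  fix e :: real assume e: "0 < e"
  have I0: "0 \<le> integral {p..q} rate / pi"
    by (intro divide_nonneg_pos integral_nonneg integrable_continuous_interval rate_continuous pos rate_nonneg pi_gt_zero)
  have "(\<integral>\<^sup>+\<omega>. zcount (path \<omega>) {p..q} \<partial>M) \<le> (\<integral>\<^sup>+\<omega>. liminf (\<lambda>N. sign_changes p q N \<omega>) \<partial>M)"
    by (rule nn_integral_mono_AE[OF AE_zcount_le_liminf[OF pos pq]])
  also have "\<dots> \<le> liminf (\<lambda>N. \<integral>\<^sup>+\<omega>. sign_changes p q N \<omega> \<partial>M)"
    by (rule nn_integral_liminf) measurable
  also have "\<dots> \<le> liminf (\<lambda>N. ennreal (integral {p..q} rate / pi + e))"
  proof (rule Liminf_mono)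
    show "\<forall>\<^sub>F N in sequentially. (\<integral>\<^sup>+\<omega>. sign_changes p q N \<omega> \<partial>M) \<le> ennreal (integral {p..q} rate / pi + e)"
    proof (rule eventually_mono)
      show "\<forall>\<^sub>F N in sequentially. \<exists>s. (\<integral>\<^sup>+\<omega>. sign_changes p q N \<omega> \<partial>M) = ennreal s \<and> 0 \<le> s \<and> \<bar>s - integral {p..q} rate / pi\<bar> \<le> e"
        by (rule expected_sign_changes[OF pos pq e])
    qed (auto intro!: ennreal_leI)
  qed
  also have "\<dots> = ennreal (integral {p..q} rate / pi + e)" by (rule Liminf_const) simp
  also have "\<dots> = ennreal (integral {p..q} rate / pi) + ennreal e" using e I0 by (intro ennreal_plus) auto
  finally show "(\<integral>\<^sup>+\<omega>. zcount (path \<omega>) {p..q} \<partial>M) \<le> ennreal (integral {p..q} rate / pi) + ennreal e" .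
qed

text \<open>
  Every sign change produces a zero inside its cell, so a single fine mesh is enough.
\<close>

theorem expected_zeros_lower:
  assumes pos: "\<And>x. x \<in> {p..q} \<Longrightarrow> ip (v x) (v x) > 0" and pq: "p < q"
  shows "ennreal (integral {p..q} rate / pi) \<le> (\<integral>\<^sup>+\<omega>. zcount (path \<omega>) {p<..<q} \<partial>M)"
proof (rule ennreal_le_epsilon)
  fix e :: real assume e: "0 < e"
  obtain N s where s: "(\<integral>\<^sup>+\<omega>. sign_changes p q N \<omega> \<partial>M) = ennreal s" "0 \<le> s" "\<bar>s - integral {p..q} rate / pi\<bar> \<le> e"
  proof -
    have "\<forall>\<^sub>F N in sequentially. \<exists>s. (\<integral>\<^sup>+\<omega>. sign_changes p q N \<omega> \<partial>M) = ennreal s \<and> 0 \<le> s \<and> \<bar>s - integral {p..q} rate / pi\<bar> \<le> e"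
      by (rule expected_sign_changes[OF pos pq e])
    from eventually_happens[OF this] show thesis using that by auto
  qed
  have "ennreal (integral {p..q} rate / pi) \<le> ennreal (s + e)" using s by (intro ennreal_leI) linarith
  also have "\<dots> = ennreal s + ennreal e" using s e by (intro ennreal_plus) auto
  also have "ennreal s \<le> (\<integral>\<^sup>+\<omega>. zcount (path \<omega>) {p<..<q} \<partial>M)"
    unfolding s(1)[symmetric] by (rule nn_integral_mono) (rule sign_changes_le_zcount[OF pq])
  finally show "ennreal (integral {p..q} rate / pi) \<le> (\<integral>\<^sup>+\<omega>. zcount (path \<omega>) {p<..<q} \<partial>M) + ennreal e"
    by (simp add: add_right_mono)
qed

end

section \<open>Many zeros in a short interval force small values\<close>

text \<open>
  The location between the extreme zeros is what makes the induction on the largest zero work.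
\<close>

lemma Rolle_many:
  fixes f :: "real \<Rightarrow> real"
  assumes der: "\<And>x. (f has_real_derivative f' x) (at x)"
    and fin: "finite Z" and ne: "Z \<noteq> {}" and z: "\<And>z. z \<in> Z \<Longrightarrow> f z = 0"
  shows "\<exists>Z'. finite Z' \<and> card Z' + 1 = card Z \<and> (\<forall>x\<in>Z'. Min Z < x \<and> x < Max Z \<and> f' x = 0)"
  using fin ne z
proof (induction Z rule: finite_linorder_max_induct)
  case (insert b A)
  show ?case
  proof (cases "A = {}")
    case True
    then show ?thesis by (intro exI[of _ "{}"]) auto
  next
    case False
    have "\<exists>Z'. finite Z' \<and> card Z' + 1 = card A \<and> (\<forall>x\<in>Z'. Min A < x \<and> x < Max A \<and> f' x = 0)"
      by (rule insert.IH[OF False]) (rule insert.prems(2), erule insertI2)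
    then obtain Z' where Z': "finite Z'" "card Z' + 1 = card A" "\<forall>x\<in>Z'. Min A < x \<and> x < Max A \<and> f' x = 0"
      by (elim exE conjE) (rule that)
    have lt: "Max A < b" using insert.hyps False by simp
    have "\<exists>c. Max A < c \<and> c < b \<and> f' c = 0"
    proof -
      have "Max A \<in> insert b A" using Max_in[OF insert.hyps(1) False] by (rule insertI2)
      then have "f (Max A) = 0" by (rule insert.prems(2))
      moreover have "f b = 0" by (rule insert.prems(2)) (rule insertI1)
      ultimately have "f (Max A) = f b" by (rule trans[OF _ sym])
      have cont: "continuous_on {Max A..b} f"
        by (rule DERIV_continuous_on[OF DERIV_subset[OF der subset_UNIV]])
      have diff: "f differentiable (at x)" for x
        unfolding real_differentiable_def by (rule exI) (rule der)
      obtain c where c: "Max A < c" "c < b" "DERIV f c :> 0"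
        by (rule exE[OF Rolle[OF lt \<open>f (Max A) = f b\<close> cont diff]]) (elim conjE, rule that)
      have "f' c = 0" by (rule DERIV_unique[OF der c(3)])
      then show ?thesis using c(1,2) by (intro exI[of _ c] conjI)
    qed
    then obtain c where c: "Max A < c" "c < b" "f' c = 0" by blast
    have Z'D: "Min A < x" "x < Max A" "f' x = 0" if "x \<in> Z'" for x
      using bspec[OF Z'(3) that] by simp_all
    have cn: "c \<notin> Z'"
    proof
      assume "c \<in> Z'"
      then show False using Z'D(2)[of c] c(1) by linarith
    qed
    have mm: "Min A \<le> Max A" by (rule Min_le[OF insert.hyps(1) Max_in[OF insert.hyps(1) False]])
    have mi: "Min (insert b A) = Min A"
      unfolding Min_insert[OF insert.hyps(1) False] using lt mm by linarith
    have ma: "Max (insert b A) = b"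
      unfolding Max_insert[OF insert.hyps(1) False] using lt by linarith
    have bn: "b \<notin> A" using insert.hyps by auto
    show ?thesis
    proof (intro exI[of _ "insert c Z'"] conjI ballI)
      show "finite (insert c Z')" using Z' by simp
      show "card (insert c Z') + 1 = card (insert b A)"
        using Z'(1,2) cn bn insert.hyps(1) by simp
      fix x assume "x \<in> insert c Z'"
      then have "Min A < x \<and> x < b \<and> f' x = 0"
      proof
        assume "x = c" then show ?thesis using c mm by simp
      next
        assume "x \<in> Z'" then show ?thesis using Z'D[of x] lt by simp
      qed
      then show "Min (insert b A) < x" "x < Max (insert b A)" "f' x = 0"
        unfolding mi ma by simp_all
    qed
  qed
qed simp

text \<open>
  By Rolle's theorem each differentiation loses one zero only. Hence the function and its first
  \<open>card Z - 1\<close> derivatives all vanish somewhere in the interval, and integrating back from there gains a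
  factor \<open>(b - a) \<Omega> \<le> q\<close> each time.
\<close>

lemma many_zeros_imp_small:
  fixes D :: "nat \<Rightarrow> real \<Rightarrow> real"
  assumes der: "\<And>k x. (D k has_real_derivative D (Suc k) x) (at x)"
    and bd: "\<And>k x. \<bar>D k x\<bar> \<le> S * \<Omega> ^ k"
    and len: "(b - a) * \<Omega> \<le> q" and O: "0 \<le> \<Omega>" and q: "0 \<le> q" and S: "0 \<le> S"
    and fin: "finite Z" and z: "Z \<subseteq> {x \<in> {a..b}. D j x = 0}" and x: "x \<in> {a..b}"
  shows "\<bar>D j x\<bar> \<le> S * \<Omega> ^ j * q ^ card Z"
  using fin z x
proof (induction "card Z" arbitrary: j Z x)
  case 0
  then show ?case using bd[of j x] by simp
next
  case (Suc k)
  have ne: "Z \<noteq> {}" using Suc.hyps(2) by auto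
  then obtain z where z: "z \<in> Z" "z \<in> {a..b}" "D j z = 0" using Suc.prems by auto
  obtain Z' where Z': "finite Z'" "card Z' + 1 = card Z" "\<forall>x\<in>Z'. Min Z < x \<and> x < Max Z \<and> D (Suc j) x = 0"
    using Rolle_many[OF der Suc.prems(1) ne] Suc.prems(2) by blast
  have "Min Z \<in> {a..b}" "Max Z \<in> {a..b}"
    using Min_in[OF Suc.prems(1) ne] Max_in[OF Suc.prems(1) ne] Suc.prems(2) by auto
  then have sub: "Z' \<subseteq> {x \<in> {a..b}. D (Suc j) x = 0}" using Z'(3) by fastforce
  have k: "k = card Z'" using Z'(2) Suc.hyps(2) by simp
  have IH: "\<bar>D (Suc j) y\<bar> \<le> S * \<Omega> ^ Suc j * q ^ k" if "y \<in> {a..b}" for y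
    using Suc.hyps(1)[OF k Z'(1) sub that] k by simp
  have "norm (D j x - D j z) \<le> (S * \<Omega> ^ Suc j * q ^ k) * norm (x - z)"
  proof (rule field_differentiable_bound[of "{a..b}"])
    show "(D j has_field_derivative D (Suc j) y) (at y within {a..b})" for y
      by (rule DERIV_subset[OF der]) auto
    show "norm (D (Suc j) y) \<le> S * \<Omega> ^ Suc j * q ^ k" if "y \<in> {a..b}" for y using IH[OF that] by simp
  qed (use z Suc.prems in auto)
  also have "\<dots> \<le> (S * \<Omega> ^ Suc j * q ^ k) * (b - a)"
    using z Suc.prems S O q by (intro mult_left_mono) auto
  also have "\<dots> = (S * \<Omega> ^ j * q ^ k) * ((b - a) * \<Omega>)" by simp
  also have "\<dots> \<le> (S * \<Omega> ^ j * q ^ k) * q" using len S O q by (intro mult_left_mono) auto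
  finally show ?case using z(3) Suc.hyps(2)[symmetric] by (simp add: mult_ac)
qed

text \<open>
  With \<open>q = 1/16\<close>, having more than \<open>k\<close> zeros implies \<open>|f z\<^sub>0| \<le> S / 16 ^ k\<close>, where \<open>S\<close> controls all
  derivatives. Then either \<open>S \<ge> \<sigma> 4 ^ k\<close> or \<open>|f z\<^sub>0| \<le> \<sigma> / 4 ^ k\<close>. The first alternative happens for
  \<open>O(\<surd>(S/\<sigma>))\<close> values of \<open>k\<close>, and \<open>\<mu>\<close> is a free parameter that linearises this root; the
  second has probability at most \<open>1 / (\<beta> 4 ^ k)\<close>. Summing over \<open>k\<close> bounds the expectation.
\<close>

lemma (in gaussian_family) expected_zeros_short:
  fixes Fd :: "nat \<Rightarrow> 'i \<Rightarrow> real \<Rightarrow> real"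
  assumes der: "\<And>k i x. i \<in> I \<Longrightarrow> (Fd k i has_real_derivative Fd (Suc k) i x) (at x)"
    and bd: "\<And>k i x. i \<in> I \<Longrightarrow> \<bar>Fd k i x\<bar> \<le> 2 * \<Omega> ^ k"
    and O: "0 \<le> \<Omega>" and len: "(b - a) * \<Omega> \<le> 1 / 16" and z0: "z0 \<in> {a..b}"
    and beta: "0 < \<beta>" "\<beta> \<le> sqrt (ip (\<lambda>i. Fd 0 i z0) (\<lambda>i. Fd 0 i z0))" and mu: "0 < \<mu>"
  shows "(\<integral>\<^sup>+\<omega>. zcount (\<lambda>x. lin (\<lambda>i. Fd 0 i x) \<omega>) {a..b} \<partial>M) \<le> ennreal (2 * real (card I) / \<mu> + \<mu> + 2 / \<beta>)"
proof -
  define D where "D = (\<lambda>\<omega> k x. lin (\<lambda>i. Fd k i x) \<omega>)"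
  define S where "S = (\<lambda>\<omega>. 2 * (\<Sum>i\<in>I. \<bar>\<xi> i \<omega>\<bar>))"
  define A where "A = (\<lambda>k. {\<omega>\<in>space M. \<bar>lin (\<lambda>i. Fd 0 i z0) \<omega>\<bar> \<le> \<sigma> * (1/4) ^ k})"
  have S0: "S \<omega> \<ge> 0" for \<omega> by (simp add: S_def sum_nonneg)
  have [measurable]: "S \<in> borel_measurable M" unfolding S_def by measurable
  have [measurable]: "A k \<in> sets M" for k unfolding A_def by measurable
  have derD: "(D \<omega> k has_real_derivative D \<omega> (Suc k) x) (at x)" for \<omega> k x
    unfolding D_def lin_def by (intro DERIV_sum) (auto intro!: derivative_eq_intros der)
  have bdD: "\<bar>D \<omega> k x\<bar> \<le> S \<omega> * \<Omega> ^ k" for \<omega> k x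
  proof -
    have "\<bar>D \<omega> k x\<bar> \<le> (\<Sum>i\<in>I. \<bar>Fd k i x * \<xi> i \<omega>\<bar>)" unfolding D_def lin_def by (rule sum_abs)
    also have "\<dots> \<le> (\<Sum>i\<in>I. (2 * \<Omega> ^ k) * \<bar>\<xi> i \<omega>\<bar>)"
      unfolding abs_mult by (intro sum_mono mult_right_mono bd) auto
    finally show ?thesis by (simp add: S_def sum_distrib_left sum_distrib_right mult_ac)
  qed
  have pt: "zcount (\<lambda>x. lin (\<lambda>i. Fd 0 i x) \<omega>) {a..b}
      \<le> ennreal (S \<omega> / \<sigma> / \<mu> + \<mu>) + (\<Sum>k. indicator (A k) \<omega>)" if w: "\<omega> \<in> space M" for \<omega>
  proof (rule zcount_le)
    fix Z assume Z: "finite Z" "Z \<subseteq> {x \<in> {a..b}. lin (\<lambda>i. Fd 0 i x) \<omega> = 0}"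
    define T where "T = S \<omega> / \<sigma>"
    have T0: "T \<ge> 0" using S0 sig by (simp add: T_def)
    \<comment> \<open>If \<open>|f z\<^sub>0|\<close> is not small, then \<open>T \<ge> 4 ^ k\<close>, which is recorded as \<open>\<surd>T / 2 ^ k \<ge> 1\<close>.\<close>
    have each: "1 \<le> ennreal (sqrt T * (1/2) ^ k) + indicator (A k) \<omega>" if k: "k < card Z" for k
    proof (cases "\<omega> \<in> A k")
      case True
      then show ?thesis by simp
    next
      case False
      then have "\<sigma> * (1/4) ^ k < \<bar>D \<omega> 0 z0\<bar>" using w by (simp add: A_def D_def)
      also have "\<dots> \<le> S \<omega> * \<Omega> ^ 0 * (1/16) ^ card Z"
        by (rule many_zeros_imp_small[OF derD bdD len O _ S0 Z(1) _ z0]) (use Z in \<open>auto simp: D_def\<close>)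
      also have "\<dots> \<le> S \<omega> * (1/16) ^ k"
        using S0 k by (simp add: mult_left_mono power_decreasing)
      finally have "(1/4) ^ k < T * (1/16) ^ k" using sig by (simp add: T_def field_simps)
      also have "(1/16::real) ^ k = (1/4) ^ k * (1/4) ^ k" by (simp add: power_mult_distrib[symmetric])
      finally have "1 < T * (1/4) ^ k" by simp
      then have "sqrt 1 \<le> sqrt (T * (1/4) ^ k)" by (intro real_sqrt_le_mono) simp
      also have "\<dots> = sqrt T * sqrt (((1/2) ^ k)\<^sup>2)"
        by (simp add: real_sqrt_mult power_mult_distrib[symmetric] power2_eq_square)
      finally have "1 \<le> sqrt T * (1/2) ^ k" by simp
      then have "ennreal 1 \<le> ennreal (sqrt T * (1/2) ^ k)" by (rule ennreal_leI)
      then show ?thesis by (simp add: add_increasing2)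
    qed
    have "of_nat (card Z) = (\<Sum>k<card Z. 1 :: ennreal)" by simp
    also have "\<dots> \<le> (\<Sum>k<card Z. ennreal (sqrt T * (1/2) ^ k) + indicator (A k) \<omega>)"
      by (intro sum_mono each) simp
    also have "\<dots> = (\<Sum>k<card Z. ennreal (sqrt T * (1/2) ^ k)) + (\<Sum>k<card Z. indicator (A k) \<omega>)"
      by (rule sum.distrib)
    also have "(\<Sum>k<card Z. indicator (A k) \<omega>) \<le> (\<Sum>k. indicator (A k) \<omega> :: ennreal)"
      by (rule sum_le_suminf) auto
    also have "(\<Sum>k<card Z. ennreal (sqrt T * (1/2) ^ k)) = ennreal (\<Sum>k<card Z. sqrt T * (1/2) ^ k)"
      using T0 by (intro sum_ennreal) simp
    also have "\<dots> \<le> ennreal (S \<omega> / \<sigma> / \<mu> + \<mu>)"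
    proof (rule ennreal_leI)
      have "(\<Sum>k<n. (1/2::real) ^ k) \<le> 2" for n by (simp add: geometric_sum)
      then have "(\<Sum>k<card Z. sqrt T * (1/2) ^ k) \<le> sqrt T * 2"
        unfolding sum_distrib_left[symmetric] using T0 by (intro mult_left_mono) auto
      also have "\<dots> \<le> T / \<mu> + \<mu>"
      proof -
        have "0 \<le> (sqrt T - \<mu>)\<^sup>2" by simp
        then have "2 * sqrt T * \<mu> \<le> T + \<mu>\<^sup>2" using T0 by (simp add: power2_diff)
        then have "(2 * sqrt T * \<mu>) / \<mu> \<le> (T + \<mu>\<^sup>2) / \<mu>" using mu by (intro divide_right_mono) auto
        then show ?thesis using mu by (simp add: add_divide_distrib power2_eq_square mult.commute)
      qed
      finally show "(\<Sum>k<card Z. sqrt T * (1/2) ^ k) \<le> S \<omega> / \<sigma> / \<mu> + \<mu>" by (simp add: T_def)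
    qed
    finally show "of_nat (card Z) \<le> ennreal (S \<omega> / \<sigma> / \<mu> + \<mu>) + (\<Sum>k. indicator (A k) \<omega>)"
      by (simp add: add_mono)
  qed
  have "(\<integral>\<^sup>+\<omega>. zcount (\<lambda>x. lin (\<lambda>i. Fd 0 i x) \<omega>) {a..b} \<partial>M)
    \<le> (\<integral>\<^sup>+\<omega>. ennreal (S \<omega> / \<sigma> / \<mu> + \<mu>) + (\<Sum>k. indicator (A k) \<omega>) \<partial>M)"
    by (rule nn_integral_mono) (rule pt)
  also have "\<dots> = (\<integral>\<^sup>+\<omega>. ennreal (S \<omega> / \<sigma> / \<mu> + \<mu>) \<partial>M) + (\<integral>\<^sup>+\<omega>. (\<Sum>k. indicator (A k) \<omega>) \<partial>M)"
    by (rule nn_integral_add) measurable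
  also have "(\<integral>\<^sup>+\<omega>. ennreal (S \<omega> / \<sigma> / \<mu> + \<mu>) \<partial>M) \<le> ennreal (2 * real (card I) / \<mu> + \<mu>)"
  proof -
    have "(\<integral>\<^sup>+\<omega>. ennreal (S \<omega> / \<sigma> / \<mu> + \<mu>) \<partial>M)
      = (\<integral>\<^sup>+\<omega>. (\<Sum>i\<in>I. ennreal (2 / \<sigma> / \<mu>) * ennreal \<bar>\<xi> i \<omega>\<bar>) + ennreal \<mu> \<partial>M)"
    proof (intro nn_integral_cong)
      fix \<omega>
      have "(\<Sum>i\<in>I. ennreal (2 / \<sigma> / \<mu>) * ennreal \<bar>\<xi> i \<omega>\<bar>) = (\<Sum>i\<in>I. ennreal (2 / \<sigma> / \<mu> * \<bar>\<xi> i \<omega>\<bar>))"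
        using sig mu by (intro sum.cong refl ennreal_mult[symmetric]) auto
      also have "\<dots> = ennreal (\<Sum>i\<in>I. 2 / \<sigma> / \<mu> * \<bar>\<xi> i \<omega>\<bar>)"
        using sig mu by (intro sum_ennreal) auto
      also have "(\<Sum>i\<in>I. 2 / \<sigma> / \<mu> * \<bar>\<xi> i \<omega>\<bar>) = S \<omega> / \<sigma> / \<mu>"
        by (simp add: S_def sum_distrib_left sum_divide_distrib mult_ac)
      finally show "ennreal (S \<omega> / \<sigma> / \<mu> + \<mu>) = (\<Sum>i\<in>I. ennreal (2 / \<sigma> / \<mu>) * ennreal \<bar>\<xi> i \<omega>\<bar>) + ennreal \<mu>"
        using S0 sig mu by (simp add: ennreal_plus)
    qed
    also have "\<dots> = (\<Sum>i\<in>I. ennreal (2 / \<sigma> / \<mu>) * (\<integral>\<^sup>+\<omega>. ennreal \<bar>\<xi> i \<omega>\<bar> \<partial>M)) + ennreal \<mu>"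
      by (subst nn_integral_add; (subst nn_integral_sum)?) (auto simp: nn_integral_cmult emeasure_space_1 intro!: sum.cong)
    also have "\<dots> \<le> (\<Sum>i\<in>I. ennreal (2 / \<sigma> / \<mu>) * ennreal \<sigma>) + ennreal \<mu>"
      by (intro add_mono sum_mono mult_left_mono expectation_abs_xi) auto
    also have "\<dots> = (\<Sum>i\<in>I. ennreal (2 / \<mu>)) + ennreal \<mu>"
      using sig mu by (simp add: ennreal_mult[symmetric])
    also have "\<dots> = ennreal (\<Sum>i\<in>I. 2 / \<mu>) + ennreal \<mu>"
      using mu by (subst sum_ennreal) auto
    also have "\<dots> = ennreal ((\<Sum>i\<in>I. 2 / \<mu>) + \<mu>)"
      using mu by (intro ennreal_plus[symmetric] sum_nonneg) auto
    finally show ?thesis by (simp add: mult_ac)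
  qed
  also have "(\<integral>\<^sup>+\<omega>. (\<Sum>k. indicator (A k) \<omega>) \<partial>M) \<le> ennreal (2 / \<beta>)"
  proof -
    have ip0: "ip (\<lambda>i. Fd 0 i z0) (\<lambda>i. Fd 0 i z0) > 0"
      using beta less_le_trans real_sqrt_gt_0_iff by blast
    have "(\<integral>\<^sup>+\<omega>. (\<Sum>k. indicator (A k) \<omega>) \<partial>M) = (\<Sum>k. \<integral>\<^sup>+\<omega>. indicator (A k) \<omega> \<partial>M)"
      by (rule nn_integral_suminf) measurable
    also have "\<dots> = (\<Sum>k. ennreal (prob (A k)))"
      by (intro suminf_cong) (subst nn_integral_indicator, auto simp: emeasure_eq_measure)
    also have "\<dots> \<le> (\<Sum>k. ennreal (1 / \<beta> * (1/4) ^ k))"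
    proof (intro suminf_le ennreal_leI)
      fix k
      have "prob (A k) \<le> \<sigma> * (1/4) ^ k / (\<sigma> * sqrt (ip (\<lambda>i. Fd 0 i z0) (\<lambda>i. Fd 0 i z0)))"
        unfolding A_def using sig by (intro prob_small ip0) auto
      also have "\<dots> = (1/4) ^ k / sqrt (ip (\<lambda>i. Fd 0 i z0) (\<lambda>i. Fd 0 i z0))" using sig by simp
      also have "\<dots> \<le> (1/4) ^ k / \<beta>" using beta ip0 by (intro divide_left_mono) auto
      finally show "prob (A k) \<le> 1 / \<beta> * (1/4) ^ k" by simp
    qed auto
    also have "\<dots> = ennreal (1 / \<beta> * (1 / (1 - 1/4)))"
    proof (rule suminf_ennreal_eq)
      show "(\<lambda>k. 1 / \<beta> * (1/4) ^ k) sums (1 / \<beta> * (1 / (1 - 1/4)))"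
        by (intro sums_mult geometric_sums) simp
    qed (use beta in auto)
    also have "\<dots> \<le> ennreal (2 / \<beta>)" using beta by (intro ennreal_leI) (simp add: field_simps)
    finally show ?thesis .
  qed
  also have "ennreal (2 * real (card I) / \<mu> + \<mu>) + ennreal (2 / \<beta>) = ennreal (2 * real (card I) / \<mu> + \<mu> + 2 / \<beta>)"
    using mu beta by (intro ennreal_plus[symmetric]) auto
  finally show ?thesis by (simp add: add_mono)
qed

section \<open>The cosine sum with half-shifted frequencies\<close>

text \<open>
  Summation by parts: monotone weights cost only twice the largest weight.
\<close>

lemma Abel_sum_bound:
  fixes g z :: "nat \<Rightarrow> real"
  assumes mono: "\<And>j. g j \<le> g (Suc j)" and g0: "0 \<le> g 0"
    and P: "\<And>k. \<bar>\<Sum>j<k. z j\<bar> \<le> T"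
  shows "\<bar>\<Sum>j<Suc n. g j * z j\<bar> \<le> 2 * g n * T"
proof -
  define P where "P = (\<lambda>k. \<Sum>j<k. z j)"
  have aux: "(c * p - q) + b * (r - p) = b * r - (q + (b - c) * p)" for b c p q r :: real
    by (simp add: algebra_simps)
  have PS: "P (Suc k) = P k + z k" for k by (simp add: P_def)
  have P0: "P 0 = 0" by (simp add: P_def)
  have id: "(\<Sum>j<Suc n. g j * z j) = g n * P (Suc n) - (\<Sum>j<n. (g (Suc j) - g j) * P (Suc j))" for n
  proof (induction n)
    case 0
    then show ?case by (simp add: PS P0)
  next
    case (Suc n)
    define Q where "Q = (\<Sum>j<n. (g (Suc j) - g j) * P (Suc j))"
    have IH: "(\<Sum>j<Suc n. g j * z j) = g n * P (Suc n) - Q" unfolding Q_def by (rule Suc.IH)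
    have "(\<Sum>j<Suc (Suc n). g j * z j) = (\<Sum>j<Suc n. g j * z j) + g (Suc n) * z (Suc n)" by simp
    also have "\<dots> = (g n * P (Suc n) - Q) + g (Suc n) * (P (Suc (Suc n)) - P (Suc n))"
      unfolding IH by (simp only: PS[of "Suc n"] add_diff_cancel_left')
    also have "\<dots> = g (Suc n) * P (Suc (Suc n)) - (Q + (g (Suc n) - g n) * P (Suc n))"
      by (rule aux)
    also have "Q + (g (Suc n) - g n) * P (Suc n) = (\<Sum>j<Suc n. (g (Suc j) - g j) * P (Suc j))"
      unfolding Q_def by (rule sum.lessThan_Suc[symmetric])
    finally show ?case .
  qed
  have T: "0 \<le> T" using P[of 0] by simp
  have gn: "g 0 \<le> g n" for n by (rule lift_Suc_mono_le[of g, OF mono le0])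
  have tel: "(\<Sum>j<n. g (Suc j) - g j) = g n - g 0" by (rule sum_lessThan_telescope)
  have PP: "\<bar>P k\<bar> \<le> T" for k using assms(3) by (simp add: P_def)
  have "\<bar>\<Sum>j<n. (g (Suc j) - g j) * P (Suc j)\<bar> \<le> (\<Sum>j<n. \<bar>(g (Suc j) - g j) * P (Suc j)\<bar>)" by (rule sum_abs)
  also have "\<dots> \<le> (\<Sum>j<n. (g (Suc j) - g j) * T)"
    unfolding abs_mult using mono PP by (intro sum_mono mult_mono) auto
  also have "\<dots> = (g n - g 0) * T" unfolding sum_distrib_right[symmetric] tel ..
  also have "\<dots> \<le> g n * T" using g0 T by (intro mult_right_mono) auto
  finally have 1: "\<bar>\<Sum>j<n. (g (Suc j) - g j) * P (Suc j)\<bar> \<le> g n * T" .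
  have "\<bar>g n * P (Suc n)\<bar> \<le> g n * T"
    unfolding abs_mult using gn[of n] g0 PP T by (intro mult_mono) auto
  with 1 show ?thesis unfolding id by linarith
qed

text \<open>
  Multiplied by \<open>2 sin x\<close> the sum telescopes.
\<close>

lemma cos_sum_bound:
  assumes "sin x \<noteq> 0"
  shows "\<bar>\<Sum>j<k. cos (2 * ((real j + c) * x))\<bar> \<le> 1 / \<bar>sin x\<bar>"
proof -
  let ?f = "\<lambda>j::nat. sin ((2 * (real j + c) - 1) * x)"
  have e: "2 * sin x * cos (2 * ((real j + c) * x)) = ?f (Suc j) - ?f j" for j
  proof -
    have "?f (Suc j) = sin (2 * ((real j + c) * x) + x)" "?f j = sin (2 * ((real j + c) * x) - x)"
      by (simp_all add: algebra_simps)
    then show ?thesis by (simp add: sin_add sin_diff)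
  qed
  have "2 * sin x * (\<Sum>j<k. cos (2 * ((real j + c) * x))) = ?f k - ?f 0"
    unfolding sum_distrib_left e by (rule sum_lessThan_telescope)
  moreover have "\<bar>?f k - ?f 0\<bar> \<le> 2"
    using abs_sin_le_one[of "(2 * (real k + c) - 1) * x"] abs_sin_le_one[of "(2 * (real 0 + c) - 1) * x"] by linarith
  ultimately have "2 * \<bar>sin x\<bar> * \<bar>\<Sum>j<k. cos (2 * ((real j + c) * x))\<bar> \<le> 2"
    by (metis abs_mult abs_numeral)
  then show ?thesis using assms by (simp add: field_simps)
qed

lemma sin_sum_bound:
  assumes "sin x \<noteq> 0"
  shows "\<bar>\<Sum>j<k. sin (2 * ((real j + c) * x))\<bar> \<le> 1 / \<bar>sin x\<bar>"
proof -
  let ?f = "\<lambda>j::nat. - cos ((2 * (real j + c) - 1) * x)"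
  have e: "2 * sin x * sin (2 * ((real j + c) * x)) = ?f (Suc j) - ?f j" for j
  proof -
    have "?f (Suc j) = - cos (2 * ((real j + c) * x) + x)" "?f j = - cos (2 * ((real j + c) * x) - x)"
      by (simp_all add: algebra_simps)
    then show ?thesis by (simp add: cos_add cos_diff)
  qed
  have "2 * sin x * (\<Sum>j<k. sin (2 * ((real j + c) * x))) = ?f k - ?f 0"
    unfolding sum_distrib_left e by (rule sum_lessThan_telescope)
  moreover have "\<bar>?f k - ?f 0\<bar> \<le> 2"
    using abs_cos_le_one[of "(2 * (real k + c) - 1) * x"] abs_cos_le_one[of "(2 * (real 0 + c) - 1) * x"] by linarith
  ultimately have "2 * \<bar>sin x\<bar> * \<bar>\<Sum>j<k. sin (2 * ((real j + c) * x))\<bar> \<le> 2"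
    by (metis abs_mult abs_numeral)
  then show ?thesis using assms by (simp add: field_simps)
qed

text \<open>
  For the vector \<open>w x = (cos (\<omega>\<^sub>j x))\<^sub>j\<close> with \<open>\<omega>\<^sub>j = j + m/2\<close>, the functions \<open>wA\<close>, \<open>wB\<close> and
  \<open>wD\<close> below are the inner products \<open>w \<bullet> w\<close>, \<open>w \<bullet> w'\<close> and \<open>w' \<bullet> w'\<close>.
\<close>

definition wfreq :: "nat \<Rightarrow> nat \<Rightarrow> real" where "wfreq m j = real j + real m / 2"

definition wA :: "nat \<Rightarrow> real \<Rightarrow> real" where
  "wA m x = (\<Sum>j<m. (cos (wfreq m j * x))\<^sup>2)"
definition wB :: "nat \<Rightarrow> real \<Rightarrow> real" where
  "wB m x = (\<Sum>j<m. cos (wfreq m j * x) * (- wfreq m j * sin (wfreq m j * x)))"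
definition wD :: "nat \<Rightarrow> real \<Rightarrow> real" where
  "wD m x = (\<Sum>j<m. (- wfreq m j * sin (wfreq m j * x))\<^sup>2)"

lemma sum_wfreq_sq: "(\<Sum>j<m. (wfreq m j)\<^sup>2) = 13/12 * real m ^ 3 - (real m)\<^sup>2 + real m / 6"
proof -
  have "(\<Sum>j<n. (real j + c)\<^sup>2) = real n * c\<^sup>2 + c * real n * (real n - 1) + real n * (real n - 1) * (2 * real n - 1) / 6" for n c
    by (induction n) (simp_all add: power2_eq_square field_simps)
  from this[where n=m and c="real m / 2"] show ?thesis
    unfolding wfreq_def by (simp add: power2_eq_square power3_eq_cube field_simps)
qed

text \<open>
  Doubling the angles turns the inner products into their mean values plus oscillating sums, which are bounded
  by \<open>1 / |sin x|\<close> times the largest weight. The error of the last estimate includes the lower order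
  terms of \<open>\<Sum>\<^sub>j \<omega>\<^sub>j\<^sup>2\<close>, which are absorbed because \<open>m \<tau> \<ge> 1\<close>.
\<close>

lemma w_estimates:
  assumes m: "m \<ge> 1" and s: "sin x \<noteq> 0"
  defines "\<tau> \<equiv> 1 / (real m * \<bar>sin x\<bar>)"
  shows "\<bar>wA m x - real m / 2\<bar> \<le> real m * \<tau> / 2"
    and "\<bar>wB m x\<bar> \<le> 3/2 * (real m)\<^sup>2 * \<tau>"
    and "\<bar>wD m x - 13/24 * real m ^ 3\<bar> \<le> 3 * real m ^ 3 * \<tau>"
proof -
  have mp: "real m > 0" using m by simp
  have T: "1 / \<bar>sin x\<bar> = real m * \<tau>" using mp by (simp add: \<tau>_def)
  have mt: "1 \<le> real m * \<tau>"
  proof -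
    have "\<bar>sin x\<bar> \<le> 1" by (rule abs_sin_le_one)
    then show ?thesis unfolding T[symmetric] using s by (simp add: field_simps)
  qed
  have m2: "(real m)\<^sup>2 \<le> real m ^ 3 * \<tau>"
  proof -
    have "(real m)\<^sup>2 * 1 \<le> (real m)\<^sup>2 * (real m * \<tau>)" using mt by (intro mult_left_mono) auto
    then show ?thesis by (simp add: power2_eq_square power3_eq_cube mult_ac)
  qed
  have c2: "(cos y)\<^sup>2 = 1/2 + 1/2 * cos (2 * y)" and s2: "(sin y)\<^sup>2 = 1/2 - 1/2 * cos (2 * y)"
    and sc: "cos y * sin y = 1/2 * sin (2 * y)" for y :: real
    using cos_double_cos[of y] cos_double_sin[of y] sin_double[of y] by (simp_all add: field_simps)
  have cs: "cos y * (- f * sin y) = - (1/2 * (f * sin (2 * y)))" for y f :: real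
    using sc[of y] by (simp add: mult.left_commute)
  have ds: "(- f * sin y)\<^sup>2 = 1/2 * f\<^sup>2 - 1/2 * (f\<^sup>2 * cos (2 * y))" for y f :: real
    by (simp add: power_mult_distrib s2) (simp add: algebra_simps)
  obtain n where n: "m = Suc n" using m by (cases m) auto
  have wn: "wfreq m n \<le> 3/2 * real m" "0 \<le> wfreq m n" by (auto simp: n wfreq_def)
  have "wA m x = real m / 2 + 1/2 * (\<Sum>j<m. cos (2 * ((real j + real m / 2) * x)))"
    by (simp add: wA_def c2 sum.distrib sum_distrib_left wfreq_def)
  then show "\<bar>wA m x - real m / 2\<bar> \<le> real m * \<tau> / 2"
    using cos_sum_bound[OF s, where k=m and c="real m / 2"] unfolding T by simp
  have "wB m x = - (1/2 * (\<Sum>j<Suc n. wfreq m j * sin (2 * ((real j + real m / 2) * x))))"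
    unfolding wB_def sum_distrib_left sum_negf[symmetric] n[symmetric]
    by (intro sum.cong refl) (simp only: cs wfreq_def)
  moreover have "\<bar>\<Sum>j<Suc n. wfreq m j * sin (2 * ((real j + real m / 2) * x))\<bar> \<le> 2 * wfreq m n * (real m * \<tau>)"
    unfolding T[symmetric] by (intro Abel_sum_bound sin_sum_bound s) (auto simp: wfreq_def)
  moreover have "2 * wfreq m n * (real m * \<tau>) \<le> 2 * (3/2 * real m) * (real m * \<tau>)"
    using wn mt by (intro mult_right_mono mult_left_mono) auto
  ultimately show "\<bar>wB m x\<bar> \<le> 3/2 * (real m)\<^sup>2 * \<tau>"
    by (simp add: power2_eq_square abs_mult)
  have "wD m x = 1/2 * (\<Sum>j<m. (wfreq m j)\<^sup>2) - 1/2 * (\<Sum>j<Suc n. (wfreq m j)\<^sup>2 * cos (2 * ((real j + real m / 2) * x)))"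
    unfolding wD_def n[symmetric] sum_distrib_left sum_subtractf[symmetric]
    by (intro sum.cong refl) (simp only: ds wfreq_def)
  moreover have "\<bar>\<Sum>j<Suc n. (wfreq m j)\<^sup>2 * cos (2 * ((real j + real m / 2) * x))\<bar> \<le> 2 * (wfreq m n)\<^sup>2 * (real m * \<tau>)"
    unfolding T[symmetric] by (intro Abel_sum_bound cos_sum_bound s) (auto simp: wfreq_def intro!: power_mono)
  moreover have "2 * (wfreq m n)\<^sup>2 * (real m * \<tau>) \<le> 2 * (3/2 * real m)\<^sup>2 * (real m * \<tau>)"
    using wn mt by (intro mult_right_mono mult_left_mono power_mono) auto
  moreover have "2 * (3/2 * real m)\<^sup>2 * (real m * \<tau>) = 9/2 * (real m ^ 3 * \<tau>)"
    by (simp add: power2_eq_square power3_eq_cube field_simps)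
  moreover have "real m \<le> (real m)\<^sup>2" using m by (simp add: power2_eq_square)
  ultimately show "\<bar>wD m x - 13/24 * real m ^ 3\<bar> \<le> 3 * real m ^ 3 * \<tau>"
    using m2 mp unfolding sum_wfreq_sq mult.assoc[of 3] by argo
qed

lemma w_gram_nonneg: "0 \<le> wA m x * wD m x - (wB m x)\<^sup>2"
  using Cauchy_Schwarz_ineq_sum[of "\<lambda>j. cos (wfreq m j * x)" "\<lambda>j. - wfreq m j * sin (wfreq m j * x)" "{..<m}"]
  by (simp add: wA_def wB_def wD_def)

text \<open>
  In units of \<open>m\<close>, \<open>m\<^sup>2\<close> and \<open>m\<^sup>3\<close> the inner products \<open>w \<bullet> w\<close>, \<open>w \<bullet> w'\<close> and
  \<open>w' \<bullet> w'\<close> are close to \<open>1/2\<close>, \<open>0\<close> and \<open>13/24\<close>. The squared speed is therefore close to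
  \<open>m\<^sup>2 (1/2 \<cdot> 13/24) / (1/2)\<^sup>2 = 13/12 m\<^sup>2\<close>.
\<close>

lemma w_speed:
  assumes m: "m \<ge> 1" and s: "sin x \<noteq> 0"
  defines "\<tau> \<equiv> 1 / (real m * \<bar>sin x\<bar>)"
  assumes t: "\<tau> \<le> 1/2"
  shows "wA m x \<ge> real m / 4" "wD m x \<le> 9 * (real m)\<^sup>2 * wA m x"
    "\<bar>sqrt (wA m x * wD m x - (wB m x)\<^sup>2) / wA m x - real m * sqrt (13/12)\<bar> \<le> 34 * real m * \<tau>"
proof -
  have mp: "real m > 0" using m by simp
  have t0: "\<tau> > 0" using mp s by (simp add: \<tau>_def)
  define A B D where "A = wA m x / real m" and "B = wB m x / (real m)\<^sup>2" and "D = wD m x / real m ^ 3"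
  have eq: "wA m x = real m * A" "wB m x = (real m)\<^sup>2 * B" "wD m x = real m ^ 3 * D"
    using mp by (auto simp: A_def B_def D_def)
  have A: "\<bar>A - 1/2\<bar> \<le> \<tau> / 2"
  proof -
    have "real m * \<bar>A - 1/2\<bar> = \<bar>real m * (A - 1/2)\<bar>" using mp by (simp add: abs_mult)
    also have "real m * (A - 1/2) = wA m x - real m / 2" using eq by (simp add: algebra_simps)
    also have "\<bar>\<dots>\<bar> \<le> real m * (\<tau> / 2)" using w_estimates(1)[OF m s, folded \<tau>_def] by simp
    finally show ?thesis using mp by simp
  qed
  have B: "\<bar>B\<bar> \<le> 3/2 * \<tau>"
  proof -
    have "(real m)\<^sup>2 * \<bar>B\<bar> = \<bar>wB m x\<bar>" using mp eq by (simp add: abs_mult)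
    also have "\<dots> \<le> (real m)\<^sup>2 * (3/2 * \<tau>)" using w_estimates(2)[OF m s, folded \<tau>_def] by simp
    finally show ?thesis using mp by simp
  qed
  have D: "\<bar>D - 13/24\<bar> \<le> 3 * \<tau>"
  proof -
    have "real m ^ 3 * \<bar>D - 13/24\<bar> = \<bar>real m ^ 3 * (D - 13/24)\<bar>" using mp by (simp add: abs_mult)
    also have "real m ^ 3 * (D - 13/24) = wD m x - 13/24 * real m ^ 3" using eq by (simp add: algebra_simps)
    also have "\<bar>\<dots>\<bar> \<le> real m ^ 3 * (3 * \<tau>)" using w_estimates(3)[OF m s, folded \<tau>_def] by simp
    finally show ?thesis using mp by simp
  qed
  have A4: "A \<ge> 1/4" using A t by linarith
  then show "wA m x \<ge> real m / 4" unfolding eq using mp by simp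
  have "D \<le> 9 * A" using A4 D t by linarith
  then have "real m ^ 3 * D \<le> real m ^ 3 * (9 * A)" using mp by (intro mult_left_mono) auto
  then show "wD m x \<le> 9 * (real m)\<^sup>2 * wA m x" unfolding eq by (simp add: power2_eq_square power3_eq_cube mult_ac)
  have "wA m x * wD m x - (wB m x)\<^sup>2 = real m ^ 4 * (A * D - B\<^sup>2)"
    unfolding eq by (simp add: power2_eq_square power3_eq_cube power4_eq_xxxx algebra_simps)
  then have G0: "0 \<le> A * D - B\<^sup>2" using w_gram_nonneg[of m x] mp by (simp add: zero_le_mult_iff)
  have sq: "sqrt (wA m x * wD m x - (wB m x)\<^sup>2) = (real m)\<^sup>2 * sqrt (A * D - B\<^sup>2)"
  proof -
    have "sqrt (real m ^ 4) = (real m)\<^sup>2"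
      by (simp add: real_sqrt_unique power4_eq_xxxx power2_eq_square)
    then show ?thesis
      using \<open>wA m x * wD m x - (wB m x)\<^sup>2 = real m ^ 4 * (A * D - B\<^sup>2)\<close> by (simp add: real_sqrt_mult)
  qed
  define K where "K = sqrt (A * D - B\<^sup>2) / A"
  have K0: "K \<ge> 0" using G0 A4 by (simp add: K_def)
  have spd: "sqrt (wA m x * wD m x - (wB m x)\<^sup>2) / wA m x = real m * K"
    unfolding sq unfolding eq K_def using mp A4 by (simp add: power2_eq_square)
  have Ksq: "K\<^sup>2 = (A * D - B\<^sup>2) / A\<^sup>2" using G0 by (simp add: K_def power_divide)
  \<comment> \<open>The squared speed differs from its limit by \<open>E / A - (B / A)\<^sup>2\<close>.\<close>
  define E where "E = D - 13/12 * A"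
  have "\<bar>E\<bar> \<le> 4 * \<tau>"
  proof -
    have "E = (D - 13/24) - 13/12 * (A - 1/2)" unfolding E_def by argo
    then have "\<bar>E\<bar> \<le> 3 * \<tau> + 13/12 * (\<tau> / 2)" using A D by argo
    then show ?thesis using t0 by argo
  qed
  have diff: "K\<^sup>2 - 13/12 = E * (1/A) - B\<^sup>2 * (1/A)\<^sup>2"
    unfolding Ksq E_def using A4 by (simp add: field_simps power2_eq_square)
  have iA: "0 < 1/A" "1/A \<le> 4" using A4 by (auto simp: field_simps)
  have "\<bar>E * (1/A)\<bar> \<le> (4 * \<tau>) * 4"
    unfolding abs_mult using \<open>\<bar>E\<bar> \<le> 4 * \<tau>\<close> iA by (intro mult_mono) auto
  moreover have "B\<^sup>2 * (1/A)\<^sup>2 \<le> (3/2 * \<tau>)\<^sup>2 * 4\<^sup>2"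
  proof (intro mult_mono)
    show "B\<^sup>2 \<le> (3/2 * \<tau>)\<^sup>2" using B t0 by (metis abs_le_square_iff abs_of_pos mult_pos_pos zero_less_divide_iff zero_less_numeral)
    show "(1/A)\<^sup>2 \<le> 4\<^sup>2" using iA by (intro power_mono) auto
  qed auto
  moreover have "(3/2 * \<tau>)\<^sup>2 * 4\<^sup>2 \<le> 18 * \<tau>"
  proof -
    have "\<tau> * \<tau> \<le> 1/2 * \<tau>" using t t0 by (intro mult_right_mono) auto
    then show ?thesis by (simp add: power2_eq_square field_simps)
  qed
  moreover have "0 \<le> B\<^sup>2 * (1/A)\<^sup>2" by simp
  ultimately have Kd: "\<bar>K\<^sup>2 - 13/12\<bar> \<le> 34 * \<tau>" unfolding diff by linarith
  have "sqrt 1 \<le> sqrt (13/12)" by (intro real_sqrt_le_mono) simp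
  then have s1: "1 \<le> sqrt (13/12)" by simp
  have "(K - sqrt (13/12)) * (K + sqrt (13/12)) = K\<^sup>2 - 13/12"
    by (simp add: algebra_simps power2_eq_square)
  then have "\<bar>K - sqrt (13/12)\<bar> * \<bar>K + sqrt (13/12)\<bar> \<le> 34 * \<tau>" using Kd by (simp only: abs_mult[symmetric])
  moreover have "\<bar>K - sqrt (13/12)\<bar> * 1 \<le> \<bar>K - sqrt (13/12)\<bar> * \<bar>K + sqrt (13/12)\<bar>"
  proof (rule mult_left_mono)
    show "1 \<le> \<bar>K + sqrt (13/12)\<bar>" using K0 s1 by linarith
  qed simp
  ultimately have Kf: "\<bar>K - sqrt (13/12)\<bar> \<le> 34 * \<tau>"
    unfolding mult_1_right by (rule order_trans[rotated])
  have "\<bar>real m * K - real m * sqrt (13/12)\<bar> = real m * \<bar>K - sqrt (13/12)\<bar>"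
    using mp by (simp add: abs_mult right_diff_distrib[symmetric])
  also have "\<dots> \<le> real m * (34 * \<tau>)" using Kf mp by (intro mult_left_mono) auto
  finally show "\<bar>sqrt (wA m x * wD m x - (wB m x)\<^sup>2) / wA m x - real m * sqrt (13/12)\<bar> \<le> 34 * real m * \<tau>"
    unfolding spd by (simp add: mult_ac)
qed

section \<open>Speed of the curve for even degree\<close>

text \<open>
  Speed of the curve \<open>(c w, e)\<close>, for \<open>a = w \<bullet> w\<close>, \<open>b = w \<bullet> w'\<close>, \<open>d = w' \<bullet> w'\<close> and
  \<open>X = c e' - e c'\<close>. Its Gram determinant is \<open>c\<^sup>4 (a d - b\<^sup>2)\<close>, the part of the rotation within the space
  of \<open>w\<close>, plus \<open>|X w - e c w'|\<^sup>2\<close>, the rotation towards the last coordinate. The term with \<open>X\<close> is the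
  speed at which the quotient \<open>c/e\<close> turns, and the term with \<open>e c\<close> is an error.
\<close>

lemma even_speed_abstract:
  fixes a b d c e X q R :: real
  assumes a: "a > 0" and d: "d \<ge> 0" and G: "0 \<le> a * d - b\<^sup>2" and q: "q = c\<^sup>2 * a + e\<^sup>2" "q > 0"
    and R: "R = sqrt (c ^ 4 * (a * d - b\<^sup>2) + (X\<^sup>2 * a - 2 * X * (e * c) * b + (e * c)\<^sup>2 * d)) / q"
  shows "R \<le> sqrt (a * d - b\<^sup>2) / a + \<bar>X\<bar> * sqrt a / q + \<bar>e * c\<bar> * sqrt d / q"
    "R \<ge> c\<^sup>2 * sqrt (a * d - b\<^sup>2) / q"
    "R \<ge> \<bar>X\<bar> * sqrt a / q - \<bar>e * c\<bar> * sqrt d / q"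
    "\<bar>e * c\<bar> * sqrt d / q \<le> sqrt (d / a) / 2"
proof -
  define g where "g = sqrt (a * d - b\<^sup>2)"
  define N where "N = X\<^sup>2 * a - 2 * X * (e * c) * b + (e * c)\<^sup>2 * d"
  define U V where "U = \<bar>X\<bar> * sqrt a" and "V = \<bar>e * c\<bar> * sqrt d"
  have UV: "U \<ge> 0" "V \<ge> 0" "U\<^sup>2 = X\<^sup>2 * a" "V\<^sup>2 = (e * c)\<^sup>2 * d"
    using a d by (auto simp: U_def V_def power_mult_distrib)
  have b: "\<bar>b\<bar> \<le> sqrt a * sqrt d"
  proof -
    have "sqrt (b\<^sup>2) \<le> sqrt (a * d)" using G by (intro real_sqrt_le_mono) simp
    then show ?thesis by (simp add: real_sqrt_mult)
  qed
  have cross: "\<bar>2 * X * (e * c) * b\<bar> \<le> 2 * U * V"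
  proof -
    have "\<bar>2 * X * (e * c) * b\<bar> = (2 * \<bar>X\<bar> * \<bar>e * c\<bar>) * \<bar>b\<bar>" by (simp add: abs_mult)
    also have "\<dots> \<le> (2 * \<bar>X\<bar> * \<bar>e * c\<bar>) * (sqrt a * sqrt d)" using b by (intro mult_left_mono) auto
    finally show ?thesis by (simp add: U_def V_def mult_ac)
  qed
  have Nup: "N \<le> (U + V)\<^sup>2" and Nlo: "(U - V)\<^sup>2 \<le> N"
    using cross unfolding N_def power2_sum power2_diff UV by linarith+
  have N0: "N \<ge> 0" using Nlo zero_le_power2[of "U - V"] by linarith
  have c4: "c ^ 4 * (a * d - b\<^sup>2) = (c\<^sup>2 * g)\<^sup>2"
    using G by (simp add: g_def power_mult_distrib)
  have g0: "g \<ge> 0" using G by (simp add: g_def)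
  have R': "R = sqrt ((c\<^sup>2 * g)\<^sup>2 + N) / q" unfolding R c4 N_def ..
  have "sqrt ((c\<^sup>2 * g)\<^sup>2 + N) \<le> c\<^sup>2 * g + (U + V)"
  proof (rule real_le_lsqrt)
    have "(c\<^sup>2 * g)\<^sup>2 + N \<le> (c\<^sup>2 * g)\<^sup>2 + (U + V)\<^sup>2" using Nup by simp
    also have "\<dots> \<le> (c\<^sup>2 * g + (U + V))\<^sup>2" using g0 UV by (simp add: power2_sum[of "c\<^sup>2 * g"])
    finally show "(c\<^sup>2 * g)\<^sup>2 + N \<le> (c\<^sup>2 * g + (U + V))\<^sup>2" .
  qed (use g0 UV N0 in auto)
  then have "R \<le> (c\<^sup>2 * g + (U + V)) / q" unfolding R' using q by (intro divide_right_mono) auto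
  also have "\<dots> = c\<^sup>2 * g / q + U / q + V / q" by (simp add: add_divide_distrib)
  also have "c\<^sup>2 * g / q \<le> g / a"
  proof -
    have "(c\<^sup>2 * g) * a \<le> g * q" using g0 by (simp add: q(1) algebra_simps)
    then show ?thesis using a q(2) by (simp add: divide_le_eq pos_le_divide_eq)
  qed
  finally show "R \<le> sqrt (a * d - b\<^sup>2) / a + \<bar>X\<bar> * sqrt a / q + \<bar>e * c\<bar> * sqrt d / q"
    by (simp add: g_def U_def V_def)
  have "c\<^sup>2 * g \<le> sqrt ((c\<^sup>2 * g)\<^sup>2 + N)" by (rule real_le_rsqrt) (use N0 in simp)
  then show "R \<ge> c\<^sup>2 * sqrt (a * d - b\<^sup>2) / q"
    unfolding R' g_def[symmetric] using q by (intro divide_right_mono) auto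
  have "U - V \<le> sqrt ((c\<^sup>2 * g)\<^sup>2 + N)" by (rule real_le_rsqrt) (use Nlo in \<open>simp add: add_increasing\<close>)
  then have "(U - V) / q \<le> R" unfolding R' using q by (intro divide_right_mono) auto
  then show "R \<ge> \<bar>X\<bar> * sqrt a / q - \<bar>e * c\<bar> * sqrt d / q"
    by (simp add: U_def V_def diff_divide_distrib)
  have "0 \<le> (\<bar>c\<bar> * sqrt a - \<bar>e\<bar>)\<^sup>2" by simp
  then have "2 * (\<bar>e * c\<bar> * sqrt a) \<le> q"
    using a by (simp add: q(1) power2_diff power_mult_distrib abs_mult mult_ac)
  then have "2 * (\<bar>e * c\<bar> * sqrt a) * sqrt d \<le> q * sqrt d" using d by (intro mult_right_mono) auto
  then have "\<bar>e * c\<bar> * sqrt d * (2 * sqrt a) \<le> sqrt d * q" by (simp add: mult_ac)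
  then have "\<bar>e * c\<bar> * sqrt d / q \<le> sqrt d / (2 * sqrt a)"
    using q(2) a by (simp add: divide_le_eq pos_le_divide_eq)
  then show "\<bar>e * c\<bar> * sqrt d / q \<le> sqrt (d / a) / 2" by (simp add: real_sqrt_divide)
qed

text \<open>
  The speed \<open>\<surd>(|v|\<^sup>2 |v'|\<^sup>2 - (v \<bullet> v')\<^sup>2) / |v|\<^sup>2\<close> of the curve \<open>v = (c w, e)\<close> with
  \<open>c = 2 cos (m x / 2)\<close> and \<open>e = cos (2 m x)\<close>.
\<close>

definition even_speed :: "nat \<Rightarrow> real \<Rightarrow> real" where
  "even_speed m x = (let a = wA m x; b = wB m x; d = wD m x;
      c = 2 * cos (real m * x / 2); c' = - real m * sin (real m * x / 2);
      e = cos (2 * real m * x); e' = - 2 * real m * sin (2 * real m * x) in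
      sqrt ((c\<^sup>2 * a + e\<^sup>2) * (c'\<^sup>2 * a + 2 * c * c' * b + c\<^sup>2 * d + e'\<^sup>2)
        - (c * c' * a + c\<^sup>2 * b + e * e')\<^sup>2) / (c\<^sup>2 * a + e\<^sup>2))"

text \<open>
  The angle, up to sign, of the planar point \<open>(\<surd>\<alpha> c, e)\<close> as a function of the phase \<open>t\<close> relative to the
  zero of \<open>c\<close>. With \<open>\<alpha>\<close> the mean value of \<open>w \<bullet> w\<close>, its derivative is the main part of the speed near that
  zero, and it turns through almost \<open>\<pi>\<close> when \<open>\<alpha>\<close> is large.
\<close>

definition crossing :: "real \<Rightarrow> real \<Rightarrow> real" where
  "crossing \<alpha> t = arctan (2 * sqrt \<alpha> * sin t / cos (4 * t))"

definition crossing' :: "real \<Rightarrow> real \<Rightarrow> real" where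
  "crossing' \<alpha> t = sqrt \<alpha> * (2 * cos t * cos (4 * t) + 8 * sin t * sin (4 * t)) / ((cos (4 * t))\<^sup>2 + 4 * \<alpha> * (sin t)\<^sup>2)"

lemma cos_4_ge_half:
  assumes "\<bar>t\<bar> \<le> pi / 12"
  shows "cos (4 * t) \<ge> 1 / 2"
proof -
  have "cos (pi / 3) \<le> cos \<bar>4 * t\<bar>" using assms pi_gt_zero by (intro cos_monotone_0_pi_le) auto
  then show ?thesis by (simp add: cos_60)
qed

lemma crossing_deriv:
  assumes t: "\<bar>t\<bar> \<le> pi / 12" and al: "\<alpha> > 0"
  shows "(crossing \<alpha> has_real_derivative crossing' \<alpha> t) (at t)"
proof -
  have c: "cos (4 * t) \<noteq> 0" "(cos (4 * t))\<^sup>2 > 0" using cos_4_ge_half[OF t] by auto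
  have den: "(cos (4 * t))\<^sup>2 + 4 * \<alpha> * (sin t)\<^sup>2 > 0" using c(2) al by (intro add_pos_nonneg) auto
  let ?u = "2 * sqrt \<alpha> * sin t / cos (4 * t)"
  have du: "((\<lambda>t. 2 * sqrt \<alpha> * sin t / cos (4 * t)) has_real_derivative
      (2 * sqrt \<alpha> * cos t * cos (4 * t) - 2 * sqrt \<alpha> * sin t * (- (4 * sin (4 * t)))) / (cos (4 * t))\<^sup>2) (at t)"
    using c by (auto intro!: derivative_eq_intros simp: power2_eq_square)
  have "(crossing \<alpha> has_real_derivative
     inverse (1 + ?u\<^sup>2) * ((2 * sqrt \<alpha> * cos t * cos (4 * t) - 2 * sqrt \<alpha> * sin t * (- (4 * sin (4 * t)))) / (cos (4 * t))\<^sup>2)) (at t)"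
    unfolding crossing_def by (rule DERIV_chain2[OF DERIV_arctan du])
  moreover have "inverse (1 + ?u\<^sup>2) * ((2 * sqrt \<alpha> * cos t * cos (4 * t) - 2 * sqrt \<alpha> * sin t * (- (4 * sin (4 * t)))) / (cos (4 * t))\<^sup>2)
      = crossing' \<alpha> t"
  proof -
    have "?u\<^sup>2 = 4 * \<alpha> * (sin t)\<^sup>2 / (cos (4 * t))\<^sup>2"
      using al by (simp add: power_divide power_mult_distrib)
    then have u: "1 + ?u\<^sup>2 = ((cos (4 * t))\<^sup>2 + 4 * \<alpha> * (sin t)\<^sup>2) / (cos (4 * t))\<^sup>2"
      using c by (simp add: add_divide_distrib)
    have cancel: "inverse (D / C) * (N / C) = N / D" if "C \<noteq> 0" for C D N :: real
      using that by (simp add: field_simps)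
    have N: "2 * sqrt \<alpha> * cos t * cos (4 * t) - 2 * sqrt \<alpha> * sin t * (- (4 * sin (4 * t)))
        = sqrt \<alpha> * (2 * cos t * cos (4 * t) + 8 * sin t * sin (4 * t))"
      by (simp add: algebra_simps)
    show ?thesis unfolding u N crossing'_def by (rule cancel) (use c in simp)
  qed
  ultimately show ?thesis by simp
qed

text \<open>
  Everything that enters the speed depends on the phase modulo \<open>\<pi>\<close> only, so all periods look alike.
\<close>

lemma phase_shift:
  fixes k :: nat and y t :: real
  assumes "y = real k * pi + pi / 2 + t"
  shows "(cos y)\<^sup>2 = (sin t)\<^sup>2" "cos (4 * y) = cos (4 * t)" "sin (4 * y) = sin (4 * t)"
    "\<bar>4 * cos y * sin (4 * y) - sin y * cos (4 * y)\<bar> = \<bar>4 * sin t * sin (4 * t) + cos t * cos (4 * t)\<bar>"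
proof -
  have kpi: "cos (real k * pi) = (-1) ^ k" "sin (real k * pi) = 0"
    by (simp_all add: cos_npi sin_npi)
  have y: "cos y = - ((-1) ^ k * sin t)" "sin y = (-1) ^ k * cos t"
  proof -
    have e: "y = real k * pi + (t + pi / 2)" using assms by simp
    have h: "cos (t + pi / 2) = - sin t" "sin (t + pi / 2) = cos t"
      by (simp_all add: cos_add sin_add)
    show "cos y = - ((-1) ^ k * sin t)" unfolding e cos_add kpi h by simp
    show "sin y = (-1) ^ k * cos t" unfolding e sin_add kpi h by simp
  qed
  have k2: "((-1) ^ k)\<^sup>2 = (1::real)" by (simp add: power_mult[symmetric] mult.commute)
  show "(cos y)\<^sup>2 = (sin t)\<^sup>2" unfolding y by (simp add: power_mult_distrib k2)
  have p: "sin (real (4 * k + 2) * pi) = 0" "cos (real (4 * k + 2) * pi) = 1"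
    by (simp_all only: sin_npi cos_npi) simp
  have e4: "4 * y = real (4 * k + 2) * pi + 4 * t" using assms by (simp add: algebra_simps)
  show c4: "cos (4 * y) = cos (4 * t)" unfolding e4 cos_add p by simp
  show s4: "sin (4 * y) = sin (4 * t)" unfolding e4 sin_add p by simp
  have "4 * cos y * sin (4 * y) - sin y * cos (4 * y) = - ((-1) ^ k * (4 * sin t * sin (4 * t) + cos t * cos (4 * t)))"
    unfolding c4 s4 y by (simp add: algebra_simps)
  then show "\<bar>4 * cos y * sin (4 * y) - sin y * cos (4 * y)\<bar> = \<bar>4 * sin t * sin (4 * t) + cos t * cos (4 * t)\<bar>"
    by (simp add: abs_mult power_abs)
qed

lemma sin_ge_frac:
  assumes "0 \<le> t" "t \<le> pi / 2"
  shows "2 * t / pi \<le> sin t"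
proof (cases "t = 0")
  case False
  have "concave_on {0..pi} sin"
    by (rule f''_le0_imp_concave[where f'=cos and f''="\<lambda>x. - sin x"]) (auto intro!: derivative_eq_intros sin_ge_zero)
  then have "convex_on {0..pi} (\<lambda>x. - sin x)" by (simp add: concave_on_def)
  from convex_onD[OF this, of "2 * t / pi" 0 "pi / 2"] assms
  show ?thesis by (simp add: field_simps)
qed simp

lemma twice_abs_sin_ge:
  assumes "\<bar>t\<bar> \<le> pi / 2"
  shows "\<bar>t\<bar> \<le> 2 * \<bar>sin t\<bar>"
proof -
  have "2 * \<bar>t\<bar> / pi \<le> sin \<bar>t\<bar>" using assms by (intro sin_ge_frac) auto
  moreover have "\<bar>t\<bar> / 2 \<le> 2 * \<bar>t\<bar> / pi"
  proof -
    have "\<bar>t\<bar> * pi \<le> \<bar>t\<bar> * 4" using pi_less_4 by (intro mult_left_mono) auto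
    then show ?thesis by (simp add: field_simps)
  qed
  moreover have "sin \<bar>t\<bar> \<le> \<bar>sin t\<bar>" by (cases "t \<ge> 0") auto
  ultimately show ?thesis by linarith
qed

text \<open>
  The first two claims concern phases at distance at least \<open>\<eta>\<close> from the zero of \<open>c\<close>: there \<open>|c| \<ge> \<eta>\<close>, the
  vector \<open>c w\<close> of squared length about \<open>c\<^sup>2 m / 2\<close> dominates the coordinate \<open>e\<close>, and the speed is that of
  \<open>w\<close> up to small relative errors. The last two concern phases up to \<open>\<pi>/12\<close>, where \<open>e \<ge> 1/2\<close>: there
  the speed is the derivative of \<open>crossing\<close> up to a factor \<open>1 + O(\<tau>)\<close> and a summand \<open>O(m)\<close>, which is
  harmless on a short interval.
\<close>

lemma even_speed_bounds:
  fixes k m :: nat and x t \<eta> :: real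
  assumes m: "m \<ge> 1" and s: "sin x \<noteq> 0" and tau: "1 / (real m * \<bar>sin x\<bar>) \<le> \<tau>" "\<tau> \<le> 1/2"
    and ph: "real m * x / 2 = real k * pi + pi / 2 + t"
  shows "\<lbrakk>0 < \<eta>; \<eta> \<le> \<bar>t\<bar>; \<bar>t\<bar> \<le> pi / 2\<rbrakk> \<Longrightarrow>
      even_speed m x \<le> real m * (sqrt (13/12) + 34 * \<tau> + 10 / (\<eta>\<^sup>2 * sqrt m) + 6 / (\<eta> * sqrt m))" (is "\<lbrakk>_; _; _\<rbrakk> \<Longrightarrow> ?U1")
    "\<lbrakk>0 < \<eta>; \<eta> \<le> \<bar>t\<bar>; \<bar>t\<bar> \<le> pi / 2; 4 \<le> \<eta>\<^sup>2 * real m\<rbrakk> \<Longrightarrow>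
      real m * ((sqrt (13/12) - 34 * \<tau>) * (1 - 4 / (\<eta>\<^sup>2 * real m))) \<le> even_speed m x" (is "\<lbrakk>_; _; _; _\<rbrakk> \<Longrightarrow> ?L1")
    "\<bar>t\<bar> \<le> pi / 12 \<Longrightarrow> even_speed m x \<le> 9/2 * real m + (1 + 4 * \<tau>) * (crossing' (real m / 2) t * (real m / 2))"
    "\<bar>t\<bar> \<le> pi / 12 \<Longrightarrow> (1 - 2 * \<tau>) * (crossing' (real m / 2) t * (real m / 2)) - 3/2 * real m \<le> even_speed m x"
proof -
  have mp: "real m > 0" using m by simp
  define \<tau>' where "\<tau>' = 1 / (real m * \<bar>sin x\<bar>)"
  have t1: "\<tau>' \<le> \<tau>" using tau(1) by (simp only: \<tau>'_def)
  then have "\<tau>' \<le> 1/2" using tau(2) by (rule order_trans)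
  moreover have "0 < \<tau>'" using mp s by (simp add: \<tau>'_def)
  ultimately have t': "\<tau>' \<le> \<tau>" "\<tau>' \<le> 1/2" "0 < \<tau>'" using t1 by blast+
  define a b d where "a = wA m x" and "b = wB m x" and "d = wD m x"
  define y where "y = real m * x / 2"
  define c where "c = 2 * cos y"
  define e where "e = cos (4 * y)"
  define X where "X = - (real m * (4 * cos y * sin (4 * y) - sin y * cos (4 * y)))"
  define q where "q = c\<^sup>2 * a + e\<^sup>2"
  note ps = phase_shift[OF ph, folded y_def]
  have a4: "a \<ge> real m / 4" and d9: "d \<le> 9 * (real m)\<^sup>2 * a"
    and sp: "\<bar>sqrt (a * d - b\<^sup>2) / a - real m * sqrt (13/12)\<bar> \<le> 34 * real m * \<tau>'"
    using w_speed[OF m s] t' unfolding a_def b_def d_def \<tau>'_def by blast+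
  have am: "\<bar>a - real m / 2\<bar> \<le> real m * \<tau>' / 2"
    using w_estimates(1)[OF m s] by (simp only: a_def \<tau>'_def)
  have a: "a > 0" using a4 mp by linarith
  have d: "d \<ge> 0" by (simp add: d_def wD_def sum_nonneg)
  have G: "0 \<le> a * d - b\<^sup>2" unfolding a_def b_def d_def by (rule w_gram_nonneg)
  have c2: "c\<^sup>2 = 4 * (sin t)\<^sup>2" by (simp add: c_def power_mult_distrib ps)
  have e2: "e = cos (4 * t)" by (simp add: e_def ps)
  have e1: "\<bar>e\<bar> \<le> 1" by (simp add: e_def)
  have esq: "e\<^sup>2 \<le> 1" using e1 by (simp add: abs_square_le_1)
  have q0: "q > 0"
  proof (cases "c = 0")
    case True
    then have "sin t = 0" using c2 by simp
    then have "cos (2 * t) = 1" by (simp add: cos_double_sin)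
    then have "cos (2 * (2 * t)) = 1" using cos_double_cos[of "2 * t"] by simp
    then have "e = 1" by (simp add: e2)
    then show ?thesis using True by (simp add: q_def)
  next
    case False
    then show ?thesis using a by (simp add: q_def add_pos_nonneg)
  qed
  have R: "even_speed m x = sqrt (c ^ 4 * (a * d - b\<^sup>2) + (X\<^sup>2 * a - 2 * X * (e * c) * b + (e * c)\<^sup>2 * d)) / q"
  proof -
    define c' e' where "c' = - real m * sin y" and "e' = - 2 * real m * sin (4 * y)"
    have y4: "2 * real m * x = 4 * y" by (simp add: y_def)
    have "even_speed m x = sqrt ((c\<^sup>2 * a + e\<^sup>2) * (c'\<^sup>2 * a + 2 * c * c' * b + c\<^sup>2 * d + e'\<^sup>2)
        - (c * c' * a + c\<^sup>2 * b + e * e')\<^sup>2) / q"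
      unfolding even_speed_def Let_def y4 q_def c_def e_def c'_def e'_def a_def b_def d_def y_def by simp
    moreover have "(c\<^sup>2 * a + e\<^sup>2) * (c'\<^sup>2 * a + 2 * c * c' * b + c\<^sup>2 * d + e'\<^sup>2) - (c * c' * a + c\<^sup>2 * b + e * e')\<^sup>2
      = c ^ 4 * (a * d - b\<^sup>2) + ((c * e' - e * c')\<^sup>2 * a - 2 * (c * e' - e * c') * (e * c) * b + (e * c)\<^sup>2 * d)"
      by (simp add: power2_eq_square power4_eq_xxxx algebra_simps)
    moreover have "c * e' - e * c' = X"
      by (simp add: X_def c_def e_def c'_def e'_def algebra_simps)
    ultimately show ?thesis by simp
  qed
  note B = even_speed_abstract[OF a d G q_def q0 R]
  have da: "sqrt (d / a) \<le> 3 * real m"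
  proof -
    have "d / a \<le> 9 * (real m)\<^sup>2" using d9 a by (simp add: pos_divide_le_eq)
    then have "sqrt (d / a) \<le> sqrt (9 * (real m)\<^sup>2)" by (rule real_sqrt_le_mono)
    also have "\<dots> = 3 * real m" by (simp add: real_sqrt_mult)
    finally show ?thesis .
  qed
  have Y: "\<bar>e * c\<bar> * sqrt d / q \<le> 3/2 * real m" using B(4) da by linarith
  define K where "K = sqrt (a * d - b\<^sup>2) / a"
  have "34 * real m * \<tau>' \<le> 34 * real m * \<tau>" using t'(1) mp by (intro mult_left_mono) auto
  then have spK: "\<bar>K - real m * sqrt (13/12)\<bar> \<le> 34 * real m * \<tau>" using sp by (simp add: K_def)
  have K0: "K \<ge> 0" using G a by (simp add: K_def)
  have K3: "K \<le> 3 * real m"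
  proof -
    have "sqrt (a * d - b\<^sup>2) \<le> sqrt (a * d)" by simp
    also have "\<dots> = sqrt (d / a) * a" using a by (simp add: real_sqrt_mult real_sqrt_divide real_div_sqrt field_simps)
    also have "\<dots> \<le> 3 * real m * a" using da a by (intro mult_right_mono) auto
    finally show ?thesis using a by (simp add: K_def pos_divide_le_eq)
  qed
  have Xabs: "\<bar>X\<bar> = real m * \<bar>4 * sin t * sin (4 * t) + cos t * cos (4 * t)\<bar>"
    unfolding X_def abs_minus_cancel abs_mult[of "real m"] ps(4) by simp
  have X5: "\<bar>X\<bar> \<le> 5 * real m"
  proof -
    have p1: "\<bar>u * v\<bar> \<le> 1" if "\<bar>u\<bar> \<le> 1" "\<bar>v\<bar> \<le> 1" for u v :: real
      unfolding abs_mult using that by (intro mult_le_one) auto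
    have "\<bar>sin t * sin (4 * t)\<bar> \<le> 1" by (intro p1 abs_sin_le_one)
    moreover have "\<bar>cos t * cos (4 * t)\<bar> \<le> 1" by (intro p1 abs_cos_le_one)
    ultimately have "\<bar>4 * sin t * sin (4 * t) + cos t * cos (4 * t)\<bar> \<le> 5" unfolding mult.assoc by linarith
    then show ?thesis unfolding Xabs using mp by simp
  qed
  have sa: "sqrt m / 2 \<le> sqrt a"
  proof -
    have "sqrt (real m / 4) \<le> sqrt a" using a4 by simp
    then show ?thesis by (simp add: real_sqrt_divide)
  qed
  have sm: "sqrt m > 0" using mp by simp
  {
    assume eta: "0 < \<eta>" "\<eta> \<le> \<bar>t\<bar>" "\<bar>t\<bar> \<le> pi / 2"
    have ceta: "\<eta> \<le> \<bar>c\<bar>"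
    proof -
      have "\<bar>c\<bar> = 2 * \<bar>sin t\<bar>"
      proof -
        have "\<bar>c\<bar> = sqrt (c\<^sup>2)" by simp
        also have "c\<^sup>2 = (2 * \<bar>sin t\<bar>)\<^sup>2" by (simp add: c2 power_mult_distrib)
        finally show ?thesis by (simp only: real_sqrt_abs abs_mult abs_abs abs_numeral)
      qed
      then show ?thesis using twice_abs_sin_ge[OF eta(3)] eta by linarith
    qed
    have gen1: "r \<le> p + t + u + w" if "r \<le> k + u + w" "\<bar>k - p\<bar> \<le> t" for r k p t u w :: real
      using that by linarith
    have c2e: "\<eta>\<^sup>2 \<le> c\<^sup>2" using ceta eta by (metis abs_le_square_iff abs_of_pos)
    have qa: "c\<^sup>2 * a \<le> q" by (simp add: q_def)
    then have qe: "\<eta>\<^sup>2 * a \<le> q" using c2e a mult_right_mono[OF c2e, of a] by linarith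
    have T2: "\<bar>X\<bar> * sqrt a / q \<le> 10 * real m / (\<eta>\<^sup>2 * sqrt m)"
    proof -
      have "\<bar>X\<bar> * sqrt a / q \<le> (5 * real m) * sqrt a / (\<eta>\<^sup>2 * a)"
        using X5 qe eta a q0 by (intro frac_le mult_right_mono mult_nonneg_nonneg mult_pos_pos) auto
      also have "\<dots> = 5 * real m / (\<eta>\<^sup>2 * sqrt a)"
        using a eta by (simp add: field_simps)
      also have "\<dots> \<le> 5 * real m / (\<eta>\<^sup>2 * (sqrt m / 2))"
        using sa sm eta a by (intro divide_left_mono mult_left_mono mult_pos_pos) auto
      finally show ?thesis by simp
    qed
    have T3: "\<bar>e * c\<bar> * sqrt d / q \<le> 6 * real m / (\<eta> * sqrt m)"
    proof -
      have "\<bar>e * c\<bar> * sqrt d / q \<le> \<bar>c\<bar> * sqrt d / (c\<^sup>2 * a)"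
      proof (intro frac_le mult_right_mono)
        show "\<bar>e * c\<bar> \<le> \<bar>c\<bar>" using e1 by (simp add: abs_mult mult_left_le_one_le)
        show "0 < c\<^sup>2 * a" using ceta eta a by auto
      qed (use qa d in auto)
      also have "\<dots> = sqrt (d / a) / (\<bar>c\<bar> * sqrt a)"
      proof -
        have gen: "C * r / ((C * C) * (s * s)) = r / s / (C * s)" if "C > 0" "s > 0" for C r s :: real
          using that by (simp add: field_simps)
        have "c\<^sup>2 = \<bar>c\<bar> * \<bar>c\<bar>" "a = sqrt a * sqrt a" using a by (simp_all add: power2_eq_square)
        then have "\<bar>c\<bar> * sqrt d / (c\<^sup>2 * a) = \<bar>c\<bar> * sqrt d / ((\<bar>c\<bar> * \<bar>c\<bar>) * (sqrt a * sqrt a))" by metis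
        also have "\<dots> = sqrt d / sqrt a / (\<bar>c\<bar> * sqrt a)" by (rule gen) (use ceta eta a in auto)
        finally show ?thesis by (simp only: real_sqrt_divide)
      qed
      also have "\<dots> \<le> 3 * real m / (\<eta> * (sqrt m / 2))"
        using da ceta sa eta sm a mp by (intro frac_le mult_mono mult_pos_pos) auto
      finally show ?thesis by simp
    qed
    have "even_speed m x \<le> K + 10 * real m / (\<eta>\<^sup>2 * sqrt m) + 6 * real m / (\<eta> * sqrt m)"
      using B(1) T2 T3 by (simp add: K_def)
    from gen1[OF this spK] have "even_speed m x \<le> real m * sqrt (13/12) + 34 * real m * \<tau> + 10 * real m / (\<eta>\<^sup>2 * sqrt m) + 6 * real m / (\<eta> * sqrt m)" .
    also have "\<dots> = real m * (sqrt (13/12) + 34 * \<tau> + 10 / (\<eta>\<^sup>2 * sqrt m) + 6 / (\<eta> * sqrt m))"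
      by (simp add: distrib_left mult_ac)
    finally show ?U1 .
    assume e4: "4 \<le> \<eta>\<^sup>2 * real m"
    have "c\<^sup>2 * sqrt (a * d - b\<^sup>2) / q = K * (c\<^sup>2 * a / q)" using a by (simp add: K_def)
    moreover have "1 - 4 / (\<eta>\<^sup>2 * real m) \<le> c\<^sup>2 * a / q"
    proof -
      have "c\<^sup>2 * a / q = 1 - e\<^sup>2 / q" using q0 by (simp add: q_def field_simps)
      moreover have "e\<^sup>2 / q \<le> 1 / (\<eta>\<^sup>2 * (real m / 4))"
      proof (intro frac_le esq)
        have "\<eta>\<^sup>2 * (real m / 4) \<le> \<eta>\<^sup>2 * a" using a4 by (intro mult_left_mono) auto
        then show "\<eta>\<^sup>2 * (real m / 4) \<le> q" using qe by linarith
      qed (use eta mp in auto)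
      ultimately show ?thesis by simp
    qed
    moreover have "0 \<le> 1 - 4 / (\<eta>\<^sup>2 * real m)" using e4 eta mp by (simp add: field_simps)
    ultimately have "K * (1 - 4 / (\<eta>\<^sup>2 * real m)) \<le> even_speed m x"
      using B(2) K0 mult_left_mono[of "1 - 4 / (\<eta>\<^sup>2 * real m)" "c\<^sup>2 * a / q" K] by linarith
    moreover have "(real m * (sqrt (13/12) - 34 * \<tau>)) * (1 - 4 / (\<eta>\<^sup>2 * real m)) \<le> K * (1 - 4 / (\<eta>\<^sup>2 * real m))"
    proof (intro mult_right_mono \<open>0 \<le> 1 - 4 / (\<eta>\<^sup>2 * real m)\<close>)
      have "real m * (sqrt (13/12) - 34 * \<tau>) = real m * sqrt (13/12) - 34 * real m * \<tau>"
        by (simp add: right_diff_distrib)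
      then show "real m * (sqrt (13/12) - 34 * \<tau>) \<le> K" using spK by linarith
    qed
    ultimately show ?L1 by (simp only: mult.assoc)
  }
  assume t12: "\<bar>t\<bar> \<le> pi / 12"
  define \<alpha> where "\<alpha> = real m / 2"
  have al: "\<alpha> > 0" using mp by (simp add: \<alpha>_def)
  have c4t: "cos (4 * t) \<ge> 1/2" by (rule cos_4_ge_half[OF t12])
  have q1: "\<alpha> * c\<^sup>2 + e\<^sup>2 > 0" using al c4t by (intro add_nonneg_pos) (auto simp: e2)
  define T where "T = \<bar>X\<bar> * sqrt \<alpha> / (\<alpha> * c\<^sup>2 + e\<^sup>2)"
  have T0: "T \<ge> 0" using al q1 by (simp add: T_def)
  have Tc: "T = crossing' \<alpha> t * (real m / 2)"
  proof -
    have ss: "0 \<le> sin t * sin (4 * t)"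
    proof (cases "t \<ge> 0")
      case True
      then show ?thesis using t12 by (intro mult_nonneg_nonneg sin_ge_zero) auto
    next
      case False
      then have "0 \<le> sin (-t) * sin (4 * (-t))" using t12 by (intro mult_nonneg_nonneg sin_ge_zero) auto
      then show ?thesis by simp
    qed
    have "cos t \<ge> 0" using t12 pi_gt_zero by (intro cos_ge_zero) auto
    then have "\<bar>4 * sin t * sin (4 * t) + cos t * cos (4 * t)\<bar> = 4 * sin t * sin (4 * t) + cos t * cos (4 * t)"
      using ss c4t by (simp add: mult.assoc)
    then have Xa: "\<bar>X\<bar> = real m * (4 * sin t * sin (4 * t) + cos t * cos (4 * t))" by (simp only: Xabs)
    have den: "\<alpha> * c\<^sup>2 + e\<^sup>2 = (cos (4 * t))\<^sup>2 + 4 * \<alpha> * (sin t)\<^sup>2" by (simp add: c2 e2)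
    have num: "2 * cos t * cos (4 * t) + 8 * sin t * sin (4 * t) = 2 * (4 * sin t * sin (4 * t) + cos t * cos (4 * t))"
      by simp
    have gen: "r * N * u / D = u * (2 * N) / D * (r / 2)" for r N u D :: real by simp
    show ?thesis unfolding T_def Xa den crossing'_def num by (rule gen)
  qed
  have rt: "sqrt a \<le> (1 + \<tau>') * sqrt \<alpha>" "(1 - \<tau>') * sqrt \<alpha> \<le> sqrt a"
    and ab: "a \<le> (1 + \<tau>') * \<alpha>" "(1 - \<tau>') * \<alpha> \<le> a"
  proof -
    show ab: "a \<le> (1 + \<tau>') * \<alpha>" "(1 - \<tau>') * \<alpha> \<le> a"
    proof -
      have "(1 + \<tau>') * \<alpha> = real m / 2 + real m * \<tau>' / 2" "(1 - \<tau>') * \<alpha> = real m / 2 - real m * \<tau>' / 2"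
        by (simp_all add: \<alpha>_def distrib_right left_diff_distrib)
      then show "a \<le> (1 + \<tau>') * \<alpha>" "(1 - \<tau>') * \<alpha> \<le> a" using am by linarith+
    qed
    have "a \<le> (1 + \<tau>')\<^sup>2 * \<alpha>"
    proof -
      have "(1 + \<tau>') * \<alpha> * 1 \<le> (1 + \<tau>') * \<alpha> * (1 + \<tau>')" using t' al by (intro mult_left_mono) auto
      then show ?thesis using ab(1) by (simp add: power2_eq_square mult_ac)
    qed
    then have "sqrt a \<le> sqrt ((1 + \<tau>')\<^sup>2 * \<alpha>)" by (rule real_sqrt_le_mono)
    then show "sqrt a \<le> (1 + \<tau>') * sqrt \<alpha>" using t' by (simp add: real_sqrt_mult)
    have "(1 - \<tau>')\<^sup>2 * \<alpha> \<le> a"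
    proof -
      have "(1 - \<tau>') * \<alpha> * (1 - \<tau>') \<le> (1 - \<tau>') * \<alpha> * 1" using t' al by (intro mult_left_mono) auto
      then show ?thesis using ab(2) by (simp add: power2_eq_square mult_ac)
    qed
    then have "sqrt ((1 - \<tau>')\<^sup>2 * \<alpha>) \<le> sqrt a" by (rule real_sqrt_le_mono)
    then show "(1 - \<tau>') * sqrt \<alpha> \<le> sqrt a" using t' by (simp add: real_sqrt_mult)
  qed
  have qlo: "(1 - \<tau>') * (\<alpha> * c\<^sup>2 + e\<^sup>2) \<le> q"
  proof -
    have "(1 - \<tau>') * \<alpha> * c\<^sup>2 \<le> a * c\<^sup>2" using ab by (intro mult_right_mono) auto
    moreover have "0 \<le> \<tau>' * e\<^sup>2" using t' by simp
    ultimately show ?thesis by (simp add: q_def algebra_simps)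
  qed
  have qup: "q \<le> (1 + \<tau>') * (\<alpha> * c\<^sup>2 + e\<^sup>2)"
  proof -
    have "a * c\<^sup>2 \<le> (1 + \<tau>') * \<alpha> * c\<^sup>2" using ab by (intro mult_right_mono) auto
    moreover have "0 \<le> \<tau>' * e\<^sup>2" using t' by simp
    ultimately show ?thesis by (simp add: q_def algebra_simps)
  qed
  have up: "\<bar>X\<bar> * sqrt a / q \<le> (1 + 4 * \<tau>) * T"
  proof -
    have "\<bar>X\<bar> * sqrt a / q \<le> \<bar>X\<bar> * ((1 + \<tau>') * sqrt \<alpha>) / ((1 - \<tau>') * (\<alpha> * c\<^sup>2 + e\<^sup>2))"
      using rt qlo q1 t' al by (intro frac_le mult_left_mono mult_nonneg_nonneg mult_pos_pos) auto
    also have "\<dots> = (1 + \<tau>') / (1 - \<tau>') * T" by (simp add: T_def)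
    also have "\<dots> \<le> (1 + 4 * \<tau>') * T"
    proof (intro mult_right_mono T0)
      have "\<tau>' * \<tau>' \<le> 1/2 * \<tau>'" using t' by (intro mult_right_mono) auto
      then have "1 + \<tau>' \<le> (1 + 4 * \<tau>') * (1 - \<tau>')" by (simp add: algebra_simps)
      then show "(1 + \<tau>') / (1 - \<tau>') \<le> 1 + 4 * \<tau>'" using t' by (simp add: pos_divide_le_eq)
    qed
    also have "\<dots> \<le> (1 + 4 * \<tau>) * T" using t' T0 by (intro mult_right_mono) auto
    finally show ?thesis .
  qed
  have lo: "(1 - 2 * \<tau>) * T \<le> \<bar>X\<bar> * sqrt a / q"
  proof -
    have "(1 - 2 * \<tau>) * T \<le> (1 - 2 * \<tau>') * T" using t' T0 by (intro mult_right_mono) auto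
    also have "\<dots> \<le> (1 - \<tau>') / (1 + \<tau>') * T"
    proof (intro mult_right_mono T0)
      have "(1 - 2 * \<tau>') * (1 + \<tau>') \<le> 1 - \<tau>'" by (simp add: algebra_simps)
      then show "1 - 2 * \<tau>' \<le> (1 - \<tau>') / (1 + \<tau>')" using t' by (simp add: pos_le_divide_eq)
    qed
    also have "\<dots> = \<bar>X\<bar> * ((1 - \<tau>') * sqrt \<alpha>) / ((1 + \<tau>') * (\<alpha> * c\<^sup>2 + e\<^sup>2))" by (simp add: T_def)
    also have "\<dots> \<le> \<bar>X\<bar> * sqrt a / q"
      using rt qup q0 t' a by (intro frac_le mult_left_mono mult_nonneg_nonneg mult_pos_pos) auto
    finally show ?thesis .
  qed
  have gen_up: "r \<le> 9/2 * M + Z" if "r \<le> k + u + w" "u \<le> Z" "w \<le> 3/2 * M" "k \<le> 3 * M" for r k u w M Z :: real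
    using that by argo
  have gen_lo: "Z - 3/2 * M \<le> r" if "u - w \<le> r" "Z \<le> u" "w \<le> 3/2 * M" for r u w M Z :: real
    using that by argo
  show "even_speed m x \<le> 9/2 * real m + (1 + 4 * \<tau>) * (crossing' (real m / 2) t * (real m / 2))"
    unfolding \<alpha>_def[symmetric] Tc[folded \<alpha>_def, symmetric] by (rule gen_up[OF B(1) up Y K3[unfolded K_def]])
  show "(1 - 2 * \<tau>) * (crossing' (real m / 2) t * (real m / 2)) - 3/2 * real m \<le> even_speed m x"
    unfolding \<alpha>_def[symmetric] Tc[folded \<alpha>_def, symmetric] by (rule gen_lo[OF B(3) lo Y])
qed

section \<open>Integrating the speed over one period\<close>

lemma integral_le_primitive:
  fixes f G :: "real \<Rightarrow> real"
  assumes "a \<le> b" and f: "continuous_on {a..b} f"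
    and G: "\<And>x. x \<in> {a..b} \<Longrightarrow> (G has_real_derivative G' x) (at x)"
    and le: "\<And>x. x \<in> {a..b} \<Longrightarrow> f x \<le> G' x"
  shows "integral {a..b} f \<le> G b - G a"
proof -
  have "(G' has_integral (G b - G a)) {a..b}"
    by (rule fundamental_theorem_of_calculus[OF assms(1)])
      (rule has_real_derivative_iff_has_vector_derivative[THEN iffD1, OF DERIV_subset[OF G subset_UNIV]])
  moreover have "(f has_integral integral {a..b} f) {a..b}"
    by (intro integrable_integral integrable_continuous_interval f)
  ultimately show ?thesis using le by (meson has_integral_le)
qed

lemma primitive_le_integral:
  fixes f G :: "real \<Rightarrow> real"
  assumes "a \<le> b" and f: "continuous_on {a..b} f"
    and G: "\<And>x. x \<in> {a..b} \<Longrightarrow> (G has_real_derivative G' x) (at x)"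
    and le: "\<And>x. x \<in> {a..b} \<Longrightarrow> G' x \<le> f x"
  shows "G b - G a \<le> integral {a..b} f"
proof -
  have "(G' has_integral (G b - G a)) {a..b}"
    by (rule fundamental_theorem_of_calculus[OF assms(1)])
      (rule has_real_derivative_iff_has_vector_derivative[THEN iffD1, OF DERIV_subset[OF G subset_UNIV]])
  moreover have "(f has_integral integral {a..b} f) {a..b}"
    by (intro integrable_integral integrable_continuous_interval f)
  ultimately show ?thesis using le by (meson has_integral_le)
qed

lemma integral_le_const_bound:
  fixes f :: "real \<Rightarrow> real"
  assumes "a \<le> b" "continuous_on {a..b} f" "\<And>x. x \<in> {a..b} \<Longrightarrow> f x \<le> c"
  shows "integral {a..b} f \<le> c * (b - a)"
  using integral_le_primitive[of a b f "\<lambda>x. c * x" "\<lambda>_. c"] assms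
  by (auto intro!: derivative_eq_intros simp: right_diff_distrib)

lemma const_bound_le_integral:
  fixes f :: "real \<Rightarrow> real"
  assumes "a \<le> b" "continuous_on {a..b} f" "\<And>x. x \<in> {a..b} \<Longrightarrow> c \<le> f x"
  shows "c * (b - a) \<le> integral {a..b} f"
  using primitive_le_integral[of a b f "\<lambda>x. c * x" "\<lambda>_. c"] assms
  by (auto intro!: derivative_eq_intros simp: right_diff_distrib)

lemma crossing_minus: "crossing \<alpha> (- t) = - crossing \<alpha> t"
  by (simp add: crossing_def arctan_minus[symmetric])

text \<open>
  The argument of the arctangent is at least \<open>1 / (2 \<epsilon>\<^sup>2)\<close>, because \<open>\<surd>m = 1 / \<epsilon>\<^sup>3\<close>.
\<close>

lemma crossing_lower:
  assumes m: "real m * \<epsilon> ^ 6 = 1" and e: "0 < \<epsilon>" "\<epsilon> \<le> 1/4"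
  shows "pi / 2 - 2 * \<epsilon>\<^sup>2 \<le> crossing (real m / 2) \<epsilon>"
proof -
  have e12: "\<bar>\<epsilon>\<bar> \<le> pi / 12" using e pi_gt3 by simp
  have m0: "real m > 0" using m e by (cases "m = 0") auto
  define y where "y = 2 * sqrt (real m / 2) * sin \<epsilon> / cos (4 * \<epsilon>)"
  have c: "cos (4 * \<epsilon>) \<ge> 1/2" by (rule cos_4_ge_half[OF e12])
  have s: "\<epsilon> \<le> 2 * sin \<epsilon>"
    using twice_abs_sin_ge[of \<epsilon>] e pi_gt3 sin_gt_zero[of \<epsilon>] by simp
  have "1 / \<epsilon> ^ 3 = sqrt (real m)"
  proof -
    have "real m = (1 / \<epsilon> ^ 3)\<^sup>2" using m e by (simp add: field_simps power2_eq_square power_add[symmetric])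
    then show ?thesis using e by simp
  qed
  moreover have "sqrt (real m) / 2 \<le> sqrt (real m / 2)"
  proof -
    have "sqrt (real m / 4) \<le> sqrt (real m / 2)" by simp
    then show ?thesis by (simp add: real_sqrt_divide)
  qed
  ultimately have r: "1 / (2 * \<epsilon> ^ 3) \<le> sqrt (real m / 2)" by (simp add: field_simps)
  have "1 / (2 * \<epsilon>\<^sup>2) = 1 / (2 * \<epsilon> ^ 3) * \<epsilon> / 1" using e by (simp add: power3_eq_cube power2_eq_square)
  also have "\<dots> \<le> sqrt (real m / 2) * (2 * sin \<epsilon>) / cos (4 * \<epsilon>)"
    using r s c e by (intro frac_le mult_mono) auto
  also have "\<dots> = y" by (simp add: y_def)
  finally have y: "1 / (2 * \<epsilon>\<^sup>2) \<le> y" .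
  have e0: "1 / (2 * \<epsilon>\<^sup>2) > 0" using e by simp
  then have y0: "y > 0" using y by (rule less_le_trans)
  have "1 / y \<le> 1 / (1 / (2 * \<epsilon>\<^sup>2))"
    by (rule divide_left_mono[OF y _ mult_pos_pos[OF y0 e0]]) simp
  then have iy: "1 / y \<le> 2 * \<epsilon>\<^sup>2" by simp
  have "arctan (1 / y) = pi / 2 - arctan y" using arctan_inverse[of y] y0 by (simp add: sgn_if inverse_eq_divide)
  moreover have "arctan (1 / y) \<le> 1 / y"
    using arctan_le_self[of "1 / y"] y0 by simp
  ultimately show ?thesis using iy by (simp add: crossing_def y_def)
qed

text \<open>
  End points of the periods of \<open>cos\<^sup>2 (m x / 2)\<close>.
\<close>

definition period :: "nat \<Rightarrow> nat \<Rightarrow> real" where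
  "period m k = 2 * pi * real k / real m"

lemma period_Suc: "period m (Suc k) = period m k + 2 * pi / real m"
  by (simp add: period_def distrib_left add_divide_distrib)

text \<open>
  The period is split at phase distance \<open>\<epsilon>\<close> from the zero of \<open>c\<close>. The two outer pieces make up almost all of
  the length \<open>2 \<pi> / m\<close> and contribute \<open>2 \<surd>(13/12)\<close>; the inner piece contributes the
  increment of \<open>crossing\<close>, which is nearly \<open>\<pi>\<close>. The choice \<open>m \<epsilon>\<^sup>6 = 1\<close> balances the errors \<open>1 / (\<epsilon>\<^sup>2 \<surd>m)\<close> outside
  and \<open>O(m)\<close> times the length \<open>4 \<epsilon> / m\<close> inside.
\<close>

lemma even_period_integral:
  fixes m k :: nat and \<tau> \<epsilon> :: real
  assumes m: "real m * \<epsilon> ^ 6 = 1" and e: "0 < \<epsilon>" "\<epsilon> \<le> 1/4" and t: "\<tau> \<le> 1/40"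
    and tau: "\<And>x. x \<in> {period m k .. period m (Suc k)} \<Longrightarrow> sin x \<noteq> 0 \<and> 1 / (real m * \<bar>sin x\<bar>) \<le> \<tau>"
    and cont: "continuous_on {period m k .. period m (Suc k)} (even_speed m)"
  shows "integral {period m k .. period m (Suc k)} (even_speed m) / pi \<le> 1 + 2 * sqrt (13/12) + 72 * \<tau> + 38 * \<epsilon>"
    "1 + 2 * sqrt (13/12) - 72 * \<tau> - 38 * \<epsilon> \<le> integral {period m k .. period m (Suc k)} (even_speed m) / pi"
proof -
  have m0: "real m > 0" using m e by (cases "m = 0") auto
  then have m1: "m \<ge> 1" by simp
  define s where "s = sqrt (13/12)"
  have s1: "1 \<le> s" "s \<le> 105/100"
    unfolding s_def by (rule real_le_rsqrt, simp) (rule real_le_lsqrt, simp_all add: power2_eq_square)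
  define \<theta> where "\<theta> = real k * pi + pi / 2"
  define x0 x1 x2 x3 where "x0 = period m k" and "x1 = (\<theta> - \<epsilon>) * 2 / real m" and "x2 = (\<theta> + \<epsilon>) * 2 / real m" and "x3 = period m (Suc k)"
  have x0: "x0 = (\<theta> - pi / 2) * 2 / real m" by (simp add: x0_def period_def \<theta>_def)
  have x3: "x3 = (\<theta> + pi / 2) * 2 / real m" by (simp add: x3_def period_def \<theta>_def algebra_simps)
  have ep: "\<epsilon> \<le> pi / 12" "\<epsilon> \<le> pi / 2" using e pi_gt3 by linarith+
  have ord: "x0 \<le> x1" "x1 \<le> x2" "x2 \<le> x3"
    unfolding x0 x1_def x2_def x3 using e ep m0 by (intro divide_right_mono mult_right_mono; simp)+
  have T: "real m * x / 2 = real k * pi + pi / 2 + (real m * x / 2 - \<theta>)" for x by (simp add: \<theta>_def)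
  have Tm: "x \<le> A * 2 / real m \<longleftrightarrow> real m * x / 2 \<le> A" "A * 2 / real m \<le> x \<longleftrightarrow> A \<le> real m * x / 2" for x A
    using m0 by (auto simp: field_simps)
  have tau0: "0 \<le> \<tau>"
  proof -
    have "sin x0 \<noteq> 0 \<and> 1 / (real m * \<bar>sin x0\<bar>) \<le> \<tau>" using tau[of x0] ord by (simp add: x0_def x3_def)
    moreover have "0 \<le> 1 / (real m * \<bar>sin x0\<bar>)" using m0 by simp
    ultimately show ?thesis by linarith
  qed
  have sm: "sqrt (real m) = 1 / \<epsilon> ^ 3"
  proof -
    have "real m = (1 / \<epsilon> ^ 3)\<^sup>2" using m e by (simp add: field_simps power2_eq_square power_add[symmetric])
    then show ?thesis using e by simp
  qed
  have rm: "real m = 1 / \<epsilon> ^ 6" using m e by (simp add: field_simps)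
  have p10: "10 / (\<epsilon>\<^sup>2 * sqrt (real m)) = 10 * \<epsilon>" unfolding sm using e by (simp add: power2_eq_square power3_eq_cube)
  have p6: "6 / (\<epsilon> * sqrt (real m)) = 6 * \<epsilon>\<^sup>2" unfolding sm using e by (simp add: power2_eq_square power3_eq_cube)
  have p4: "4 / (\<epsilon>\<^sup>2 * real m) = 4 * \<epsilon> ^ 4" unfolding rm using e by (simp add: eval_nat_numeral)
  have e2: "\<epsilon>\<^sup>2 \<le> \<epsilon> / 4" using e by (simp add: power2_eq_square mult_left_le)
  have e4: "\<epsilon> ^ 4 \<le> \<epsilon> / 64"
  proof -
    have "\<epsilon> ^ 3 \<le> (1/4) ^ 3" using e by (intro power_mono) auto
    then have "\<epsilon> * \<epsilon> ^ 3 \<le> \<epsilon> * (1/4) ^ 3" using e by (intro mult_left_mono) auto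
    then show ?thesis by (simp add: eval_nat_numeral)
  qed
  have big: "4 \<le> \<epsilon>\<^sup>2 * real m"
  proof -
    have "4 * \<epsilon> ^ 4 \<le> 1" using e4 e by linarith
    then have "4 \<le> 1 / \<epsilon> ^ 4" using e by (simp add: pos_le_divide_eq)
    also have "\<dots> = \<epsilon>\<^sup>2 * real m" unfolding rm using e by (simp add: eval_nat_numeral)
    finally show ?thesis .
  qed
  let ?f = "even_speed m"
  have c1: "continuous_on {x0..x1} ?f" and c2: "continuous_on {x1..x2} ?f" and c3: "continuous_on {x2..x3} ?f"
    using ord by (auto intro!: continuous_on_subset[OF cont] simp: x0_def x3_def)
  have c13: "continuous_on {x1..x3} ?f" using ord by (auto intro!: continuous_on_subset[OF cont] simp: x0_def x3_def)
  have split: "integral {x0..x3} ?f = integral {x0..x1} ?f + (integral {x1..x2} ?f + integral {x2..x3} ?f)"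
  proof -
    have "integral {x0..x1} ?f + integral {x1..x3} ?f = integral {x0..x3} ?f"
      using ord cont by (intro Henstock_Kurzweil_Integration.integral_combine integrable_continuous_interval) (auto simp: x0_def x3_def)
    moreover have "integral {x1..x2} ?f + integral {x2..x3} ?f = integral {x1..x3} ?f"
      using ord c13 by (intro Henstock_Kurzweil_Integration.integral_combine integrable_continuous_interval) auto
    ultimately show ?thesis by simp
  qed
  have tx: "sin x \<noteq> 0" "1 / (real m * \<bar>sin x\<bar>) \<le> \<tau>" if "x \<in> {x0..x3}" for x
    using tau[of x] that by (auto simp: x0_def x3_def)
  have t2: "\<tau> \<le> 1/2" using t by linarith
  define U where "U = s + 34 * \<tau> + 10 * \<epsilon> + 6 * \<epsilon>\<^sup>2"
  define L where "L = (s - 34 * \<tau>) * (1 - 4 * \<epsilon> ^ 4)"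
  have phase: "real m * x / 2 - \<theta> \<in> {A..B}" if "x \<in> {(\<theta> + A) * 2 / real m .. (\<theta> + B) * 2 / real m}" for x A B
    using that Tm[of x "\<theta> + B"] Tm(2)[of "\<theta> + A" x] by auto
  have side: "real m * L \<le> ?f x \<and> ?f x \<le> real m * U" if x: "x \<in> {x0..x1} \<union> {x2..x3}" for x
  proof -
    let ?t = "real m * x / 2 - \<theta>"
    have "?t \<in> {- (pi / 2) .. - \<epsilon>} \<or> ?t \<in> {\<epsilon> .. pi / 2}"
      using x phase[of x "- (pi / 2)" "- \<epsilon>"] phase[of x \<epsilon> "pi / 2"] unfolding x0 x1_def x2_def x3 by auto
    then have "\<epsilon> \<le> \<bar>?t\<bar>" "\<bar>?t\<bar> \<le> pi / 2" using e by auto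
    moreover have "x \<in> {x0..x3}" using x ord by auto
    ultimately show ?thesis
      using even_speed_bounds(1)[OF m1 tx(1) tx(2) t2 T, of x \<epsilon>] even_speed_bounds(2)[OF m1 tx(1) tx(2) t2 T, of x \<epsilon>] e big
      unfolding p10 p6 p4 by (simp add: U_def L_def s_def)
  qed
  have midt: "\<bar>real m * x / 2 - \<theta>\<bar> \<le> pi / 12" if x: "x \<in> {x1..x2}" for x
  proof -
    have "real m * x / 2 - \<theta> \<in> {- \<epsilon>..\<epsilon>}"
      by (rule phase) (use x in \<open>simp add: x1_def x2_def\<close>)
    then have "\<bar>real m * x / 2 - \<theta>\<bar> \<le> \<epsilon>" unfolding atLeastAtMost_iff by linarith
    then show ?thesis using ep(1) by (rule order_trans)
  qed
  let ?cr = "\<lambda>x. crossing (real m / 2) (real m * x / 2 - \<theta>)"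
  have crd: "(?cr has_real_derivative crossing' (real m / 2) (real m * x / 2 - \<theta>) * (real m / 2)) (at x)"
    if x: "x \<in> {x1..x2}" for x
  proof (rule DERIV_chain2[where f="crossing (real m / 2)" and g="\<lambda>x. real m * x / 2 - \<theta>"])
    show "(crossing (real m / 2) has_real_derivative crossing' (real m / 2) (real m * x / 2 - \<theta>)) (at (real m * x / 2 - \<theta>))"
      using m0 by (intro crossing_deriv midt x) simp
    show "((\<lambda>x. real m * x / 2 - \<theta>) has_real_derivative real m / 2) (at x)"
      by (auto intro!: derivative_eq_intros)
  qed
  have cre: "?cr x2 = crossing (real m / 2) \<epsilon>" "?cr x1 = - crossing (real m / 2) \<epsilon>"
  proof -
    have "real m * x2 / 2 - \<theta> = \<epsilon>" "real m * x1 / 2 - \<theta> = - \<epsilon>"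
      using m0 by (simp_all add: x1_def x2_def field_simps)
    then show "?cr x2 = crossing (real m / 2) \<epsilon>" "?cr x1 = - crossing (real m / 2) \<epsilon>"
      by (simp_all only: crossing_minus)
  qed
  have x21: "x2 - x1 = 4 * \<epsilon> / real m" by (simp add: x1_def x2_def diff_divide_distrib[symmetric])
  have sl: "(x1 - x0) + (x3 - x2) = (2 * pi - 4 * \<epsilon>) / real m"
    unfolding x0 x1_def x2_def x3 using m0 by (simp add: field_simps)
  have ring1: "(A * x + T * C) - (A * y + T * (- C)) = A * (x - y) + T * (2 * C)"
    and ring2: "T * (2 * C) - A * (x - y) = (T * C - A * x) - (T * (- C) - A * y)" for A T C x y :: real
    by (simp_all add: algebra_simps)
  have mid_up: "integral {x1..x2} ?f \<le> 18 * \<epsilon> + (1 + 4 * \<tau>) * pi"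
  proof -
    have "integral {x1..x2} ?f \<le> (9/2 * real m * x2 + (1 + 4 * \<tau>) * ?cr x2) - (9/2 * real m * x1 + (1 + 4 * \<tau>) * ?cr x1)"
    proof (rule integral_le_primitive[OF ord(2) c2])
      fix x assume x: "x \<in> {x1..x2}"
      show "((\<lambda>x. 9/2 * real m * x + (1 + 4 * \<tau>) * ?cr x) has_real_derivative
        9/2 * real m + (1 + 4 * \<tau>) * (crossing' (real m / 2) (real m * x / 2 - \<theta>) * (real m / 2))) (at x)"
        by (rule DERIV_add[OF DERIV_cmult_Id DERIV_cmult[OF crd[OF x]]])
      have "x \<in> {x0..x3}" using x ord by auto
      then show "?f x \<le> 9/2 * real m + (1 + 4 * \<tau>) * (crossing' (real m / 2) (real m * x / 2 - \<theta>) * (real m / 2))"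
        by (intro even_speed_bounds(3)[OF m1 tx(1) tx(2) t2 T] midt x)
    qed
    also have "\<dots> = 9/2 * real m * (x2 - x1) + (1 + 4 * \<tau>) * (2 * crossing (real m / 2) \<epsilon>)"
      unfolding cre by (rule ring1)
    also have "\<dots> \<le> 18 * \<epsilon> + (1 + 4 * \<tau>) * pi"
    proof (intro add_mono mult_left_mono)
      show "9/2 * real m * (x2 - x1) \<le> 18 * \<epsilon>" unfolding x21 using m0 by simp
      show "2 * crossing (real m / 2) \<epsilon> \<le> pi" unfolding crossing_def
        using arctan_ubound[of "2 * sqrt (real m / 2) * sin \<epsilon> / cos (4 * \<epsilon>)"] by linarith
    qed (use tau0 in simp)
    finally show ?thesis .
  qed
  \<comment> \<open>The loss \<open>4 \<epsilon>\<^sup>2\<close> is the part of the half circle missed by \<open>crossing\<close>.\<close>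
  have mid_lo: "(1 - 2 * \<tau>) * (pi - 4 * \<epsilon>\<^sup>2) - 6 * \<epsilon> \<le> integral {x1..x2} ?f"
  proof -
    have "(1 - 2 * \<tau>) * (pi - 4 * \<epsilon>\<^sup>2) - 6 * \<epsilon> \<le> (1 - 2 * \<tau>) * (2 * crossing (real m / 2) \<epsilon>) - 3/2 * real m * (x2 - x1)"
    proof (intro diff_mono mult_left_mono)
      show "pi - 4 * \<epsilon>\<^sup>2 \<le> 2 * crossing (real m / 2) \<epsilon>" using crossing_lower[OF m e] by simp
      show "3/2 * real m * (x2 - x1) \<le> 6 * \<epsilon>" unfolding x21 using m0 by simp
    qed (use t in simp)
    also have "\<dots> = ((1 - 2 * \<tau>) * ?cr x2 - 3/2 * real m * x2) - ((1 - 2 * \<tau>) * ?cr x1 - 3/2 * real m * x1)"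
      unfolding cre by (rule ring2)
    also have "\<dots> \<le> integral {x1..x2} ?f"
    proof (rule primitive_le_integral[OF ord(2) c2])
      fix x assume x: "x \<in> {x1..x2}"
      show "((\<lambda>x. (1 - 2 * \<tau>) * ?cr x - 3/2 * real m * x) has_real_derivative
        (1 - 2 * \<tau>) * (crossing' (real m / 2) (real m * x / 2 - \<theta>) * (real m / 2)) - 3/2 * real m) (at x)"
        by (rule DERIV_diff[OF DERIV_cmult[OF crd[OF x]] DERIV_cmult_Id])
      have "x \<in> {x0..x3}" using x ord by auto
      then show "(1 - 2 * \<tau>) * (crossing' (real m / 2) (real m * x / 2 - \<theta>) * (real m / 2)) - 3/2 * real m \<le> ?f x"
        by (intro even_speed_bounds(4)[OF m1 tx(1) tx(2) t2 T] midt x)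
    qed
    finally show ?thesis .
  qed
  have U0: "0 \<le> U" using s1 tau0 e by (simp add: U_def)
  have "integral {x0..x1} ?f \<le> real m * U * (x1 - x0)" "integral {x2..x3} ?f \<le> real m * U * (x3 - x2)"
    using side by (intro integral_le_const_bound ord c1 c3; simp)+
  then have "integral {x0..x1} ?f + integral {x2..x3} ?f \<le> real m * U * ((x1 - x0) + (x3 - x2))"
    by (simp add: distrib_left)
  also have "\<dots> = U * (2 * pi - 4 * \<epsilon>)" unfolding sl using m0 by simp
  also have "\<dots> \<le> U * (2 * pi)" using U0 e by (intro mult_left_mono) auto
  finally have "integral {x0..x3} ?f \<le> U * (2 * pi) + (18 * \<epsilon> + (1 + 4 * \<tau>) * pi)"
    using mid_up unfolding split by linarith
  also have "18 * \<epsilon> \<le> 6 * \<epsilon> * pi"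
  proof -
    have "6 * \<epsilon> * 3 \<le> 6 * \<epsilon> * pi" using e pi_gt3 by (intro mult_left_mono) auto
    then show ?thesis by simp
  qed
  also have "U * (2 * pi) + (6 * \<epsilon> * pi + (1 + 4 * \<tau>) * pi) = (2 * U + 6 * \<epsilon> + 1 + 4 * \<tau>) * pi"
    by (simp add: algebra_simps)
  finally have "integral {x0..x3} ?f / pi \<le> 2 * U + 6 * \<epsilon> + 1 + 4 * \<tau>" by (simp add: pos_divide_le_eq)
  also have "\<dots> \<le> 1 + 2 * s + 72 * \<tau> + 38 * \<epsilon>" unfolding U_def using e2 e by argo
  finally show "integral {period m k .. period m (Suc k)} (even_speed m) / pi \<le> 1 + 2 * sqrt (13/12) + 72 * \<tau> + 38 * \<epsilon>"
    by (simp add: x0_def x3_def s_def)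
  define B where "B = s - 34 * \<tau>"
  have B: "0 \<le> B" "B \<le> 2" using s1 t tau0 unfolding B_def by argo+
  have "real m * L * (x1 - x0) \<le> integral {x0..x1} ?f" "real m * L * (x3 - x2) \<le> integral {x2..x3} ?f"
    using side by (intro const_bound_le_integral ord c1 c3; simp)+
  then have "real m * L * ((x1 - x0) + (x3 - x2)) \<le> integral {x0..x1} ?f + integral {x2..x3} ?f"
    by (simp add: distrib_left)
  moreover have "real m * L * ((x1 - x0) + (x3 - x2)) = L * (2 * pi - 4 * \<epsilon>)" unfolding sl using m0 by simp
  moreover have "B * (2 * pi - 5 * \<epsilon>) \<le> L * (2 * pi - 4 * \<epsilon>)"
  proof -
    have "\<epsilon> ^ 4 * (8 * pi) \<le> \<epsilon> / 64 * (8 * 4)" using e4 e pi_less_4 by (intro mult_mono) auto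
    moreover have "0 \<le> \<epsilon> ^ 4 * \<epsilon>" using e by simp
    moreover have "(1 - 4 * \<epsilon> ^ 4) * (2 * pi - 4 * \<epsilon>) = 2 * pi - 4 * \<epsilon> - \<epsilon> ^ 4 * (8 * pi) + 16 * (\<epsilon> ^ 4 * \<epsilon>)"
      by (simp add: algebra_simps)
    ultimately have "2 * pi - 5 * \<epsilon> \<le> (1 - 4 * \<epsilon> ^ 4) * (2 * pi - 4 * \<epsilon>)" using e by linarith
    then have "B * (2 * pi - 5 * \<epsilon>) \<le> B * ((1 - 4 * \<epsilon> ^ 4) * (2 * pi - 4 * \<epsilon>))" using B by (intro mult_left_mono)
    then show ?thesis by (simp add: L_def B_def mult.assoc)
  qed
  moreover have "2 * B * pi - 10 * \<epsilon> \<le> B * (2 * pi - 5 * \<epsilon>)"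
  proof -
    have "B * (5 * \<epsilon>) \<le> 2 * (5 * \<epsilon>)" using B e by (intro mult_right_mono) auto
    then show ?thesis by (simp add: algebra_simps)
  qed
  moreover have "pi - 2 * \<tau> * pi - \<epsilon> \<le> (1 - 2 * \<tau>) * (pi - 4 * \<epsilon>\<^sup>2)"
  proof -
    have "(1 - 2 * \<tau>) * (4 * \<epsilon>\<^sup>2) \<le> 1 * (4 * \<epsilon>\<^sup>2)" using tau0 by (intro mult_right_mono) auto
    then have "(1 - 2 * \<tau>) * (4 * \<epsilon>\<^sup>2) \<le> \<epsilon>" using e2 by linarith
    then show ?thesis by (simp add: algebra_simps)
  qed
  ultimately have lo: "2 * B * pi + pi - 2 * \<tau> * pi - 17 * \<epsilon> \<le> integral {x0..x3} ?f"
    using mid_lo unfolding split by linarith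
  have "17 * \<epsilon> \<le> 38 * \<epsilon> * pi"
  proof -
    have "38 * \<epsilon> * 3 \<le> 38 * \<epsilon> * pi" using e pi_gt3 by (intro mult_left_mono) auto
    then show ?thesis using e by linarith
  qed
  then have "(2 * B + 1 - 2 * \<tau> - 38 * \<epsilon>) * pi \<le> integral {x0..x3} ?f"
    using lo by (simp add: algebra_simps)
  then have "2 * B + 1 - 2 * \<tau> - 38 * \<epsilon> \<le> integral {x0..x3} ?f / pi" by (simp add: pos_le_divide_eq)
  moreover have "1 + 2 * s - 72 * \<tau> - 38 * \<epsilon> \<le> 2 * B + 1 - 2 * \<tau> - 38 * \<epsilon>"
    unfolding B_def using tau0 by argo
  ultimately show "1 + 2 * sqrt (13/12) - 72 * \<tau> - 38 * \<epsilon> \<le> integral {period m k .. period m (Suc k)} (even_speed m) / pi"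
    by (simp add: x0_def x3_def s_def)
qed

section \<open>Expected zeros of the block polynomial in one period\<close>

text \<open>
  The \<open>k\<close>-th derivative of \<open>cos (f x)\<close>.
\<close>

definition dcos :: "nat \<Rightarrow> real \<Rightarrow> real \<Rightarrow> real" where
  "dcos k f x = f ^ k * cos (f * x + real k * (pi / 2))"

lemma dcos_deriv: "(dcos k f has_real_derivative dcos (Suc k) f x) (at x)"
proof -
  have "cos (f * x + real (Suc k) * (pi / 2)) = cos ((f * x + real k * (pi / 2)) + pi / 2)"
    by (rule arg_cong[of _ _ cos]) (simp add: field_simps)
  also have "\<dots> = - sin (f * x + real k * (pi / 2))" by (simp add: cos_add)
  finally have "dcos (Suc k) f x = f ^ k * (- (f * sin (f * x + real k * (pi / 2))))" by (simp add: dcos_def)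
  then show ?thesis unfolding dcos_def[abs_def] by (auto intro!: derivative_eq_intros)
qed

lemma dcos_bound:
  assumes "0 \<le> f" "f \<le> \<Omega>"
  shows "\<bar>dcos k f x\<bar> \<le> \<Omega> ^ k"
proof -
  have "\<bar>dcos k f x\<bar> \<le> f ^ k * 1"
    unfolding dcos_def abs_mult using assms by (intro mult_mono) auto
  also have "\<dots> \<le> \<Omega> ^ k * 1" using assms by (intro mult_right_mono power_mono) auto
  finally show ?thesis by simp
qed

lemma dcos_0: "dcos 0 f x = cos (f * x)"
  by (simp add: dcos_def)

lemma dcos_1: "dcos (Suc 0) f x = - f * sin (f * x)"
  by (simp add: dcos_def cos_add)

text \<open>
  The \<open>k\<close>-th derivative of the coefficient function of \<open>a\<^sub>i\<close> once the two blocks are identified.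
\<close>

definition block_deriv :: "nat \<Rightarrow> nat \<Rightarrow> nat \<Rightarrow> real \<Rightarrow> real" where
  "block_deriv n k i x = (if i < block_len n then dcos k (real i) x + dcos k (real (i + block_len n)) x else dcos k (real n) x)"

lemma block_len_even: "even n \<Longrightarrow> n = 2 * block_len n"
  by (auto simp: block_len_def elim!: evenE)

lemma block_len_odd: "odd n \<Longrightarrow> Suc n = 2 * block_len n"
proof -
  assume "odd n"
  then obtain k where k: "n = 2 * k + 1" by (rule oddE)
  have "\<lceil>real n / 2\<rceil> = int k + 1" by (rule ceiling_unique) (simp_all add: k)
  then show ?thesis by (simp add: block_len_def k nat_add_distrib)
qed

lemma block_deriv_0_block:
  assumes "i < block_len n"
  shows "block_deriv n 0 i x = 2 * cos (real (block_len n) * x / 2) * cos (wfreq (block_len n) i * x)"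
proof -
  let ?m = "real (block_len n)"
  have "real i * x = wfreq (block_len n) i * x - ?m * x / 2" "(real i + ?m) * x = wfreq (block_len n) i * x + ?m * x / 2"
    by (simp_all add: wfreq_def algebra_simps)
  then show ?thesis using assms by (simp add: block_deriv_def dcos_0 cos_add cos_diff)
qed

text \<open>
  The derivative in factorised form; it agrees with the termwise one because derivatives are unique.
\<close>

lemma block_deriv_1_block:
  assumes "i < block_len n"
  defines "m \<equiv> block_len n"
  shows "block_deriv n (Suc 0) i x = (- real m * sin (real m * x / 2)) * cos (wfreq m i * x)
     + 2 * cos (real m * x / 2) * (- wfreq m i * sin (wfreq m i * x))"
proof (rule DERIV_unique)
  show "(block_deriv n 0 i has_real_derivative block_deriv n (Suc 0) i x) (at x)"
    unfolding block_deriv_def[abs_def] using assms(1) by (auto intro!: DERIV_add dcos_deriv)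
  have "block_deriv n 0 i = (\<lambda>x. 2 * cos (real m * x / 2) * cos (wfreq m i * x))"
    unfolding m_def by (rule ext) (rule block_deriv_0_block[OF assms(1)])
  then show "(block_deriv n 0 i has_real_derivative (- real m * sin (real m * x / 2)) * cos (wfreq m i * x)
     + 2 * cos (real m * x / 2) * (- wfreq m i * sin (wfreq m i * x))) (at x)"
    by (auto intro!: derivative_eq_intros)
qed

lemma zcount_mult_le: "zcount (\<lambda>x. f x * g x) A \<le> zcount f A + zcount g A"
proof -
  have "{x \<in> A. f x * g x = 0} = {x \<in> A. f x = 0} \<union> {x \<in> A. g x = 0}" by auto
  then show ?thesis unfolding zcount_def by (simp add: emeasure_subadditive)
qed

text \<open>
  The free coefficients of one polynomial. Over them the polynomial is a Gaussian sum whose coefficient functions are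
  the \<open>block_deriv n 0 i\<close>.
\<close>

locale block_setup = gaussian_family M "free_indices n" \<xi> \<sigma>
  for M :: "'a measure" and n :: nat and \<xi> :: "nat \<Rightarrow> 'a \<Rightarrow> real" and \<sigma> :: real +
  assumes n1: "n \<ge> 1"
begin

abbreviation "m \<equiv> block_len n"
abbreviation "I \<equiv> free_indices n"

lemma m1: "m \<ge> 1"
  using n1 block_len_even[of n] block_len_odd[of n] by (cases "even n") linarith+

lemma m0: "real m > 0" using m1 by simp

lemma I_even: "even n \<Longrightarrow> I = insert n {..<m}" "even n \<Longrightarrow> n \<notin> {..<m}"
  using block_len_even[of n] m1 by (auto simp: free_indices_def)

lemma I_odd: "odd n \<Longrightarrow> I = {..<m}"
  by (simp add: free_indices_def)

lemma card_I: "card I \<le> 2 * m"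
  using m1 by (cases "even n") (auto simp: I_even(1) I_odd card_insert_if)

lemma zero_in_I: "0 \<in> I"
  using m1 by (simp add: free_indices_def)

lemma I_le: "i \<in> I \<Longrightarrow> \<not> i < m \<Longrightarrow> n = 2 * m"
  using block_len_even[of n] by (auto simp: free_indices_def split: if_splits)

lemma block_deriv_deriv: "(block_deriv n k i has_real_derivative block_deriv n (Suc k) i x) (at x)"
  unfolding block_deriv_def[abs_def] by (auto intro!: DERIV_add dcos_deriv)

lemma block_deriv_bound:
  assumes "i \<in> I"
  shows "\<bar>block_deriv n k i x\<bar> \<le> 2 * (2 * real m) ^ k"
proof (cases "i < m")
  case True
  have "\<bar>dcos k (real i) x\<bar> \<le> (2 * real m) ^ k" "\<bar>dcos k (real (i + m)) x\<bar> \<le> (2 * real m) ^ k"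
    using True by (intro dcos_bound; simp)+
  then show ?thesis using True by (simp add: block_deriv_def)
next
  case False
  then have "real n = 2 * real m" using I_le[OF assms] by simp
  then have "\<bar>dcos k (real n) x\<bar> \<le> (2 * real m) ^ k" by (intro dcos_bound) auto
  moreover have "0 \<le> (2 * real m) ^ k" by simp
  ultimately show ?thesis using False by (simp add: block_deriv_def)
qed

sublocale V: gaussian_curve M "free_indices n" \<xi> \<sigma> "block_deriv n 0" "block_deriv n (Suc 0)" "block_deriv n (Suc (Suc 0))" "2 * (2 * real m) ^ 2"
proof
  fix i :: nat and x :: real assume i: "i \<in> free_indices n"
  show "\<bar>block_deriv n (Suc (Suc 0)) i x\<bar> \<le> 2 * (2 * real m) ^ 2"
    using block_deriv_bound[OF i, of "Suc (Suc 0)" x] by (simp only: numeral_2_eq_2)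
qed (simp_all add: block_deriv_deriv)

text \<open>
  The polynomial in which the second block of coefficients has been replaced by the first.
\<close>

definition block_poly :: "'a \<Rightarrow> real \<Rightarrow> real" where
  "block_poly \<omega> x = lin (\<lambda>i. block_deriv n 0 i x) \<omega>"

lemma block_poly_path: "V.path \<omega> = block_poly \<omega>"
  by (simp add: fun_eq_iff V.path_def block_poly_def)

lemma zcount_block_poly_measurable[measurable]:
  "(\<lambda>\<omega>. zcount (block_poly \<omega>) {p..q}) \<in> borel_measurable M"
  "(\<lambda>\<omega>. zcount (block_poly \<omega>) {p<..<q}) \<in> borel_measurable M"
  using V.zcount_path_measurable(1,2)[of p q] by (simp_all only: block_poly_path)

text \<open>
  Over a piece of phase length \<open>\<pi>/256\<close> the cosine \<open>cos (m x / 2)\<close> cannot be below \<open>1/256\<close> in absolute value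
  at both end points, so at one of them the coefficient function of \<open>a\<^sub>0\<close>, which is twice its square, gives the
  polynomial enough variance for \<open>expected_zeros_short\<close>.
\<close>

lemma expected_zeros_piece:
  assumes p: "q - p = 2 * pi / (256 * real m)"
  shows "(\<integral>\<^sup>+\<omega>. zcount (block_poly \<omega>) {p..q} \<partial>M) \<le> ennreal (65600 * sqrt m)"
proof -
  define t where "t = pi / 256"
  have len: "real m * q / 2 = real m * p / 2 + t"
    using p m0 by (simp add: t_def field_simps)
  have pq: "p \<le> q" using p m0 by (metis diff_ge_0_iff_ge divide_nonneg_nonneg less_imp_le mult_nonneg_nonneg of_nat_0_le_iff pi_ge_zero zero_le_numeral)
  have "2 * t / pi \<le> sin t" by (rule sin_ge_frac) (auto simp: t_def)
  then have st: "1 / 128 \<le> sin t" by (simp add: t_def)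
  let ?a = "real m * p / 2"
  have "sin t = sin (?a + t) * cos ?a - cos (?a + t) * sin ?a"
    using sin_diff[of "?a + t" ?a] by simp
  also have "\<dots> \<le> \<bar>cos ?a\<bar> + \<bar>cos (?a + t)\<bar>"
  proof -
    have "\<bar>sin (?a + t) * cos ?a\<bar> \<le> 1 * \<bar>cos ?a\<bar>" "\<bar>cos (?a + t) * sin ?a\<bar> \<le> \<bar>cos (?a + t)\<bar> * 1"
      unfolding abs_mult by (intro mult_right_mono mult_left_mono; simp)+
    then show ?thesis by linarith
  qed
  finally have "1 / 256 \<le> \<bar>cos (real m * p / 2)\<bar> \<or> 1 / 256 \<le> \<bar>cos (real m * q / 2)\<bar>"
    using st unfolding len by linarith
  then obtain z0 where z0: "z0 \<in> {p..q}" "1 / 256 \<le> \<bar>cos (real m * z0 / 2)\<bar>" using pq by auto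
  have "(1 / 256)\<^sup>2 \<le> \<bar>cos (real m * z0 / 2)\<bar>\<^sup>2" using z0(2) by (intro power_mono) auto
  then have c2: "1 / 65536 \<le> (cos (real m * z0 / 2))\<^sup>2" by (simp add: power2_eq_square)
  have V0: "block_deriv n 0 0 z0 = 2 * (cos (real m * z0 / 2))\<^sup>2"
    using block_deriv_0_block[of 0 n z0] m1 by (simp add: wfreq_def power2_eq_square)
  have "(block_deriv n 0 0 z0)\<^sup>2 \<le> ip (\<lambda>i. block_deriv n 0 i z0) (\<lambda>i. block_deriv n 0 i z0)"
    unfolding ip_def power2_eq_square by (rule member_le_sum[OF zero_in_I]) (auto simp: fin)
  then have "sqrt ((block_deriv n 0 0 z0)\<^sup>2) \<le> sqrt (ip (\<lambda>i. block_deriv n 0 i z0) (\<lambda>i. block_deriv n 0 i z0))"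
    by (rule real_sqrt_le_mono)
  moreover have "1 / 32768 \<le> sqrt ((block_deriv n 0 0 z0)\<^sup>2)"
    using c2 unfolding real_sqrt_abs V0 by simp
  ultimately have beta: "1 / 32768 \<le> sqrt (ip (\<lambda>i. block_deriv n 0 i z0) (\<lambda>i. block_deriv n 0 i z0))" by linarith
  have "(\<integral>\<^sup>+\<omega>. zcount (\<lambda>x. lin (\<lambda>i. block_deriv n 0 i x) \<omega>) {p..q} \<partial>M)
     \<le> ennreal (2 * real (card I) / sqrt m + sqrt m + 2 / (1 / 32768))"
  proof (rule expected_zeros_short[where \<Omega>="2 * real m"])
    show "(q - p) * (2 * real m) \<le> 1 / 16" unfolding p using m0 pi_less_4 by (simp add: field_simps)
  qed (use block_deriv_deriv block_deriv_bound z0 beta m0 in auto)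
  also have "\<dots> \<le> ennreal (65600 * sqrt m)"
  proof (rule ennreal_leI)
    have "2 * real (card I) / sqrt m \<le> 2 * (2 * real m) / sqrt m"
      using card_I m0 by (intro divide_right_mono mult_left_mono) (auto simp: of_nat_mono[of "card I" "2 * m", simplified])
    also have "\<dots> = 4 * (real m / sqrt m)" by simp
    also have "\<dots> = 4 * sqrt m" by (simp only: real_div_sqrt[OF of_nat_0_le_iff])
    finally have "2 * real (card I) / sqrt m \<le> 4 * sqrt m" .
    moreover have "1 \<le> sqrt m" using m1 by simp
    moreover have two: "2 / (1 / 32768) = (65536::real)" by simp
    ultimately show "2 * real (card I) / sqrt m + sqrt m + 2 / (1 / 32768) \<le> 65600 * sqrt m"
      unfolding two by argo
  qed
  finally show ?thesis by (simp add: block_poly_def[abs_def])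
qed

text \<open>
  A bound for arbitrary periods, obtained from 256 pieces.
\<close>

lemma expected_zeros_period_crude:
  "(\<integral>\<^sup>+\<omega>. zcount (block_poly \<omega>) {period m k .. period m (Suc k)} \<partial>M) \<le> ennreal (17 * 10 ^ 6 * sqrt m)"
proof -
  define h where "h = 2 * pi / (256 * real m)"
  have h: "h > 0" using m0 by (simp add: h_def)
  define y where "y = (\<lambda>j::nat. period m k + real j * h)"
  have y256: "y 256 = period m (Suc k)" using m0 by (simp add: y_def period_Suc h_def)
  have cover: "{period m k .. y N} \<subseteq> (\<Union>j<N. {y j .. y (Suc j)})" if "N > 0" for N
    using that
  proof (induction N)
    case (Suc N)
    show ?case
    proof (cases "N = 0")
      case False
      have "{period m k .. y (Suc N)} \<subseteq> {period m k .. y N} \<union> {y N .. y (Suc N)}" by auto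
      then show ?thesis using Suc.IH False by (auto simp: lessThan_Suc)
    qed (auto simp: y_def lessThan_Suc)
  qed simp
  have "zcount (block_poly \<omega>) {period m k .. period m (Suc k)} \<le> (\<Sum>j<256. zcount (block_poly \<omega>) {y j .. y (Suc j)})" for \<omega>
    using zcount_mono[OF cover[of 256], of "block_poly \<omega>"] zcount_UN_le[of "{..<256}" "block_poly \<omega>" "\<lambda>j. {y j .. y (Suc j)}"]
    by (simp add: y256)
  then have "(\<integral>\<^sup>+\<omega>. zcount (block_poly \<omega>) {period m k .. period m (Suc k)} \<partial>M)
    \<le> (\<integral>\<^sup>+\<omega>. (\<Sum>j<256. zcount (block_poly \<omega>) {y j .. y (Suc j)}) \<partial>M)" by (intro nn_integral_mono)
  also have "\<dots> = (\<Sum>j<256. \<integral>\<^sup>+\<omega>. zcount (block_poly \<omega>) {y j .. y (Suc j)} \<partial>M)" by (rule nn_integral_sum) measurable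
  also have "\<dots> \<le> (\<Sum>j<256::nat. ennreal (65600 * sqrt m))"
  proof (intro sum_mono expected_zeros_piece)
    fix j
    have "y (Suc j) - y j = h" by (simp add: y_def distrib_right)
    then show "y (Suc j) - y j = 2 * pi / (256 * real m)" by (simp only: h_def)
  qed
  also have "\<dots> = ennreal (\<Sum>j<256::nat. 65600 * sqrt m)" by (rule sum_ennreal) simp
  also have "\<dots> \<le> ennreal (17 * 10 ^ 6 * sqrt m)" by (rule ennreal_leI) simp
  finally show ?thesis .
qed

text \<open>
  In the orthonormal coordinates given by the free coefficients, the curve is \<open>(c w, e)\<close>.
\<close>

lemma expected_zeros_period_even:
  assumes ev: "even n" and m: "real m * \<epsilon> ^ 6 = 1" and e: "0 < \<epsilon>" "\<epsilon> \<le> 1/4" and t: "\<tau> \<le> 1/40"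
    and tau: "\<And>x. x \<in> {period m k .. period m (Suc k)} \<Longrightarrow> sin x \<noteq> 0 \<and> 1 / (real m * \<bar>sin x\<bar>) \<le> \<tau>"
  shows "(\<integral>\<^sup>+\<omega>. zcount (block_poly \<omega>) {period m k .. period m (Suc k)} \<partial>M) \<le> ennreal (1 + 2 * sqrt (13/12) + 72 * \<tau> + 38 * \<epsilon>)"
    "ennreal (1 + 2 * sqrt (13/12) - 72 * \<tau> - 38 * \<epsilon>) \<le> (\<integral>\<^sup>+\<omega>. zcount (block_poly \<omega>) {period m k <..< period m (Suc k)} \<partial>M)"
proof -
  have nr: "real n = 2 * real m"
    using arg_cong[OF block_len_even[OF ev], of real] by simp
  have Vn: "block_deriv n 0 n x = cos (2 * real m * x)" "block_deriv n (Suc 0) n x = - 2 * real m * sin (2 * real m * x)" for x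
    using I_even(2)[OF ev] by (simp_all add: block_deriv_def dcos_0 dcos_1 nr)
  have sumI: "(\<Sum>i\<in>I. g i) = g n + (\<Sum>i<m. g i)" for g :: "nat \<Rightarrow> real"
    using I_even[OF ev] by simp
  let ?c = "\<lambda>x. 2 * cos (real m * x / 2)" and ?c' = "\<lambda>x. - real m * sin (real m * x / 2)"
  let ?e = "\<lambda>x. cos (2 * real m * x)" and ?e' = "\<lambda>x. - 2 * real m * sin (2 * real m * x)"
  have ip00: "ip (V.v x) (V.v x) = (?c x)\<^sup>2 * wA m x + (?e x)\<^sup>2" for x
    unfolding ip_def sumI Vn wA_def sum_distrib_left
    by (simp add: block_deriv_0_block power2_eq_square mult_ac)
  have ip01: "ip (V.v x) (V.v1 x) = ?c x * ?c' x * wA m x + (?c x)\<^sup>2 * wB m x + ?e x * ?e' x" for x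
  proof -
    have "ip (V.v x) (V.v1 x) = ?e x * ?e' x + (\<Sum>i<m. ?c x * ?c' x * (cos (wfreq m i * x))\<^sup>2
        + (?c x)\<^sup>2 * (cos (wfreq m i * x) * (- wfreq m i * sin (wfreq m i * x))))"
      unfolding ip_def sumI Vn
      by (intro arg_cong2[where f="(+)"] sum.cong refl)
         (simp add: block_deriv_0_block block_deriv_1_block power2_eq_square algebra_simps)
    then show ?thesis by (simp only: wA_def wB_def sum.distrib sum_distrib_left add_ac)
  qed
  have ip11: "ip (V.v1 x) (V.v1 x) = (?c' x)\<^sup>2 * wA m x + 2 * ?c x * ?c' x * wB m x + (?c x)\<^sup>2 * wD m x + (?e' x)\<^sup>2" for x
  proof -
    have sq: "(p * w + c * w') * (p * w + c * w') = p\<^sup>2 * w\<^sup>2 + 2 * c * p * (w * w') + c\<^sup>2 * w'\<^sup>2" for p w c w' :: real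
      by (simp add: power2_eq_square algebra_simps)
    have "ip (V.v1 x) (V.v1 x) = (?e' x)\<^sup>2 + (\<Sum>i<m. (?c' x)\<^sup>2 * (cos (wfreq m i * x))\<^sup>2
        + 2 * ?c x * ?c' x * (cos (wfreq m i * x) * (- wfreq m i * sin (wfreq m i * x)))
        + (?c x)\<^sup>2 * (- wfreq m i * sin (wfreq m i * x))\<^sup>2)"
      unfolding ip_def sumI Vn
    proof (intro arg_cong2[where f="(+)"] sum.cong refl)
      fix i assume "i \<in> {..<m}"
      then have "i < m" by simp
      show "block_deriv n (Suc 0) i x * block_deriv n (Suc 0) i x = (?c' x)\<^sup>2 * (cos (wfreq m i * x))\<^sup>2
        + 2 * ?c x * ?c' x * (cos (wfreq m i * x) * (- wfreq m i * sin (wfreq m i * x)))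
        + (?c x)\<^sup>2 * (- wfreq m i * sin (wfreq m i * x))\<^sup>2"
        unfolding block_deriv_1_block[OF \<open>i < m\<close>] by (rule sq)
    qed (simp add: power2_eq_square)
    then show ?thesis by (simp only: wA_def wB_def wD_def sum.distrib sum_distrib_left add_ac)
  qed
  have rate: "V.rate x = even_speed m x" for x
    unfolding V.rate_def gram_def ip00 ip01 ip11 even_speed_def Let_def ..
  have pos: "ip (V.v x) (V.v x) > 0" for x
  proof (rule ccontr)
    assume "\<not> ip (V.v x) (V.v x) > 0"
    then have "ip (V.v x) (V.v x) = 0" using ip_nonneg[of "V.v x"] by linarith
    then have z: "\<And>i. i \<in> I \<Longrightarrow> block_deriv n 0 i x = 0" by (simp add: ip_self_eq_0)
    have c0: "cos (real m * x / 2) = 0"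
      using z[OF zero_in_I] block_deriv_0_block[of 0 n x] m1 by (simp add: wfreq_def)
    have "cos (2 * (real m * x / 2)) = -1" unfolding cos_double_cos c0 by simp
    then have "cos (2 * (2 * (real m * x / 2))) = 1" unfolding cos_double_cos[of "2 * (real m * x / 2)"] by simp
    then have "cos (2 * real m * x) = 1" by (simp add: mult.assoc)
    then show False using z[of n] I_even(1)[OF ev] by (simp add: Vn)
  qed
  have cont: "continuous_on A (even_speed m)" for A
    using V.rate_continuous[of A] pos by (simp only: rate[abs_def] fun_eq_iff)
  have lt: "period m k < period m (Suc k)" using m0 by (simp add: period_Suc)
  have "V.rate = even_speed m" by (rule ext) (rule rate)
  then have rI: "integral A V.rate = integral A (even_speed m)" for A by (simp only:)
  have "(\<integral>\<^sup>+\<omega>. zcount (block_poly \<omega>) {period m k .. period m (Suc k)} \<partial>M) \<le> ennreal (integral {period m k .. period m (Suc k)} (even_speed m) / pi)"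
    using V.expected_zeros_upper[OF pos lt] by (simp only: block_poly_path rI)
  also have "\<dots> \<le> ennreal (1 + 2 * sqrt (13/12) + 72 * \<tau> + 38 * \<epsilon>)"
    by (intro ennreal_leI even_period_integral(1)[OF m e t tau cont])
  finally show "(\<integral>\<^sup>+\<omega>. zcount (block_poly \<omega>) {period m k .. period m (Suc k)} \<partial>M) \<le> ennreal (1 + 2 * sqrt (13/12) + 72 * \<tau> + 38 * \<epsilon>)" .
  have "ennreal (1 + 2 * sqrt (13/12) - 72 * \<tau> - 38 * \<epsilon>) \<le> ennreal (integral {period m k .. period m (Suc k)} (even_speed m) / pi)"
    by (intro ennreal_leI even_period_integral(2)[OF m e t tau cont])
  also have "\<dots> \<le> (\<integral>\<^sup>+\<omega>. zcount (block_poly \<omega>) {period m k <..< period m (Suc k)} \<partial>M)"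
    using V.expected_zeros_lower[OF pos lt] by (simp only: block_poly_path rI)
  finally show "ennreal (1 + 2 * sqrt (13/12) - 72 * \<tau> - 38 * \<epsilon>) \<le> (\<integral>\<^sup>+\<omega>. zcount (block_poly \<omega>) {period m k <..< period m (Suc k)} \<partial>M)" .
qed

text \<open>
  The polynomial is \<open>c W\<close>. The factor \<open>c\<close> has exactly one zero in the period, which almost surely is not a zero
  of \<open>W\<close>, and the curve of \<open>W\<close> is \<open>w\<close>.
\<close>

lemma expected_zeros_period_odd:
  assumes od: "odd n" and t: "\<tau> \<le> 1/40"
    and tau: "\<And>x. x \<in> {period m k .. period m (Suc k)} \<Longrightarrow> sin x \<noteq> 0 \<and> 1 / (real m * \<bar>sin x\<bar>) \<le> \<tau>"
  shows "(\<integral>\<^sup>+\<omega>. zcount (block_poly \<omega>) {period m k .. period m (Suc k)} \<partial>M) \<le> ennreal (1 + 2 * sqrt (13/12) + 72 * \<tau>)"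
    "ennreal (1 + 2 * sqrt (13/12) - 72 * \<tau>) \<le> (\<integral>\<^sup>+\<omega>. zcount (block_poly \<omega>) {period m k <..< period m (Suc k)} \<partial>M)"
proof -
  note I = I_odd[OF od]
  interpret W: gaussian_curve M "free_indices n" \<xi> \<sigma> "\<lambda>i. dcos 0 (wfreq m i)" "\<lambda>i. dcos (Suc 0) (wfreq m i)"
    "\<lambda>i. dcos (Suc (Suc 0)) (wfreq m i)" "(2 * real m) ^ 2"
  proof
    fix i :: nat and x :: real assume i: "i \<in> free_indices n"
    have "\<bar>dcos (Suc (Suc 0)) (wfreq m i) x\<bar> \<le> (2 * real m) ^ Suc (Suc 0)"
      using i I by (intro dcos_bound) (auto simp: wfreq_def)
    then show "\<bar>dcos (Suc (Suc 0)) (wfreq m i) x\<bar> \<le> (2 * real m) ^ 2" by (simp only: numeral_2_eq_2)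
  qed (simp_all add: dcos_deriv)
  have tx: "sin x \<noteq> 0" "1 / (real m * \<bar>sin x\<bar>) \<le> \<tau>" "1 / (real m * \<bar>sin x\<bar>) \<le> 1/2"
    if "x \<in> {period m k .. period m (Suc k)}" for x
    using tau[OF that] t by auto
  have ip00: "ip (W.v x) (W.v x) = wA m x" for x
    unfolding ip_def by (simp add: I wA_def dcos_0 power2_eq_square)
  have ip01: "ip (W.v x) (W.v1 x) = wB m x" for x
    unfolding ip_def by (simp add: I wB_def dcos_0 dcos_1)
  have ip11: "ip (W.v1 x) (W.v1 x) = wD m x" for x
    unfolding ip_def by (simp add: I wD_def dcos_1 power2_eq_square)
  have rate: "W.rate x = sqrt (wA m x * wD m x - (wB m x)\<^sup>2) / wA m x" for x
    unfolding W.rate_def gram_def ip00 ip01 ip11 ..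
  have pos: "ip (W.v x) (W.v x) > 0" if "x \<in> {period m k .. period m (Suc k)}" for x
  proof -
    have "real m / 4 \<le> wA m x" using w_speed(1)[OF m1 tx(1,3)[OF that]] .
    then show ?thesis using m0 unfolding ip00 by linarith
  qed
  have lt: "period m k < period m (Suc k)" using m0 by (simp add: period_Suc)
  have len: "period m (Suc k) - period m k = 2 * pi / real m" by (simp add: period_Suc)
  have speed: "\<bar>W.rate x - real m * sqrt (13/12)\<bar> \<le> real m * (34 * \<tau>)" if x: "x \<in> {period m k .. period m (Suc k)}" for x
  proof -
    have "\<bar>W.rate x - real m * sqrt (13/12)\<bar> \<le> 34 * real m * (1 / (real m * \<bar>sin x\<bar>))"
      unfolding rate by (rule w_speed(3)[OF m1 tx(1,3)[OF x]])
    also have "\<dots> \<le> 34 * real m * \<tau>" using tx(2)[OF x] by (intro mult_left_mono) auto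
    finally show ?thesis by (simp add: mult_ac)
  qed
  have cont: "continuous_on {period m k .. period m (Suc k)} W.rate" by (rule W.rate_continuous[OF pos])
  have lin_fac: "block_poly \<omega> x = 2 * cos (real m * x / 2) * W.path \<omega> x" for \<omega> x
  proof -
    have "block_deriv n 0 i x * \<xi> i \<omega> = 2 * cos (real m * x / 2) * (dcos 0 (wfreq m i) x * \<xi> i \<omega>)" if "i \<in> I" for i
      using that by (simp add: I block_deriv_0_block dcos_0)
    then show ?thesis unfolding block_poly_def W.path_def lin_def sum_distrib_left by (intro sum.cong refl)
  qed
  define z where "z = (2 * real k + 1) * pi / real m"
  have z: "period m k < z" "z < period m (Suc k)"
    unfolding z_def period_def using m0 pi_gt_zero by (simp_all add: divide_strict_right_mono algebra_simps)
  have cz: "2 * cos (real m * x / 2) = 0 \<longleftrightarrow> x = z" if x: "x \<in> {period m k .. period m (Suc k)}" for x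
  proof -
    define y where "y = real m * x / 2 - real k * pi"
    have y: "0 \<le> y" "y \<le> pi"
      using x m0 by (auto simp: y_def period_def field_simps)
    have "cos (real m * x / 2) = cos (real k * pi + y)" by (simp add: y_def)
    also have "\<dots> = (-1) ^ k * cos y" by (simp add: cos_add cos_npi sin_npi)
    finally have c: "cos (real m * x / 2) = 0 \<longleftrightarrow> cos y = 0" by simp
    have "cos y = 0 \<longleftrightarrow> y = pi / 2"
    proof
      assume "cos y = 0"
      then have "cos y = cos (pi / 2)" by simp
      then show "y = pi / 2" using cos_inj_pi[OF y, of "pi / 2"] by simp
    next
      assume "y = pi / 2"
      then show "cos y = 0" by (simp only: cos_pi_half)
    qed
    also have "\<dots> \<longleftrightarrow> x = z"
    proof -
      have "x = z \<longleftrightarrow> x * real m = (2 * real k + 1) * pi"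
        unfolding z_def using m0 by (intro eq_divide_eq[THEN trans]) simp
      moreover have "(2 * real k + 1) * pi = 2 * (real k * pi) + pi" by (simp add: distrib_right)
      moreover have "real m * x / 2 = x * real m / 2" by (simp add: mult.commute)
      ultimately show ?thesis unfolding y_def by argo
    qed
    finally show ?thesis using c by simp
  qed
  have zc: "zcount (\<lambda>x. 2 * cos (real m * x / 2)) {period m k .. period m (Suc k)} \<le> 1"
  proof -
    have "zcount (\<lambda>x. 2 * cos (real m * x / 2)) {period m k .. period m (Suc k)} \<le> emeasure (count_space UNIV) {z}"
      unfolding zcount_def using cz by (intro emeasure_mono) auto
    then show ?thesis by simp
  qed
  have "(\<integral>\<^sup>+\<omega>. zcount (block_poly \<omega>) {period m k .. period m (Suc k)} \<partial>M)
    \<le> (\<integral>\<^sup>+\<omega>. 1 + zcount (W.path \<omega>) {period m k .. period m (Suc k)} \<partial>M)"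
  proof (rule nn_integral_mono)
    fix \<omega>
    have "zcount (block_poly \<omega>) {period m k .. period m (Suc k)} = zcount (\<lambda>x. 2 * cos (real m * x / 2) * W.path \<omega> x) {period m k .. period m (Suc k)}"
      by (simp only: lin_fac[abs_def])
    also have "\<dots> \<le> zcount (\<lambda>x. 2 * cos (real m * x / 2)) {period m k .. period m (Suc k)} + zcount (W.path \<omega>) {period m k .. period m (Suc k)}"
      by (rule zcount_mult_le)
    also have "\<dots> \<le> 1 + zcount (W.path \<omega>) {period m k .. period m (Suc k)}" using zc by (rule add_right_mono)
    finally show "zcount (block_poly \<omega>) {period m k .. period m (Suc k)} \<le> 1 + zcount (W.path \<omega>) {period m k .. period m (Suc k)}" .
  qed
  also have "\<dots> = 1 + (\<integral>\<^sup>+\<omega>. zcount (W.path \<omega>) {period m k .. period m (Suc k)} \<partial>M)"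
    by (subst nn_integral_add) (auto simp: emeasure_space_1)
  also have "(\<integral>\<^sup>+\<omega>. zcount (W.path \<omega>) {period m k .. period m (Suc k)} \<partial>M) \<le> ennreal (integral {period m k .. period m (Suc k)} W.rate / pi)"
    by (rule W.expected_zeros_upper[OF pos lt])
  also have "\<dots> \<le> ennreal (2 * sqrt (13/12) + 68 * \<tau>)"
  proof (rule ennreal_leI)
    have "integral {period m k .. period m (Suc k)} W.rate \<le> (real m * (sqrt (13/12) + 34 * \<tau>)) * (period m (Suc k) - period m k)"
    proof (rule integral_le_const_bound[OF less_imp_le[OF lt] cont])
      fix x assume "x \<in> {period m k .. period m (Suc k)}"
      from speed[OF this] show "W.rate x \<le> real m * (sqrt (13/12) + 34 * \<tau>)" unfolding distrib_left by linarith
    qed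
    also have "\<dots> = (2 * sqrt (13/12) + 68 * \<tau>) * pi" unfolding len using m0 by (simp add: field_simps)
    finally show "integral {period m k .. period m (Suc k)} W.rate / pi \<le> 2 * sqrt (13/12) + 68 * \<tau>" by (simp add: pos_divide_le_eq)
  qed
  finally have up: "(\<integral>\<^sup>+\<omega>. zcount (block_poly \<omega>) {period m k .. period m (Suc k)} \<partial>M) \<le> 1 + ennreal (2 * sqrt (13/12) + 68 * \<tau>)"
    by (simp add: add_left_mono)
  have tau0: "0 \<le> \<tau>"
  proof -
    have "0 \<le> 1 / (real m * \<bar>sin (period m k)\<bar>)" by simp
    also have "\<dots> \<le> \<tau>" using tx(2)[of "period m k"] lt by simp
    finally show ?thesis .
  qed
  have "1 + ennreal (2 * sqrt (13/12) + 68 * \<tau>) = ennreal (1 + (2 * sqrt (13/12) + 68 * \<tau>))"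
    using tau0 by (subst ennreal_plus) auto
  also have "\<dots> \<le> ennreal (1 + 2 * sqrt (13/12) + 72 * \<tau>)" using tau0 by (intro ennreal_leI) simp
  finally show "(\<integral>\<^sup>+\<omega>. zcount (block_poly \<omega>) {period m k .. period m (Suc k)} \<partial>M) \<le> ennreal (1 + 2 * sqrt (13/12) + 72 * \<tau>)"
    using up by (rule order_trans[rotated])
  have AEz: "AE \<omega> in M. W.path \<omega> z \<noteq> 0"
    unfolding W.path_def using z by (intro AE_lin_nonzero pos) auto
  have "1 + (\<integral>\<^sup>+\<omega>. zcount (W.path \<omega>) {period m k <..< period m (Suc k)} \<partial>M)
    = (\<integral>\<^sup>+\<omega>. 1 + zcount (W.path \<omega>) {period m k <..< period m (Suc k)} \<partial>M)"
    by (subst nn_integral_add) (auto simp: emeasure_space_1)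
  also have "\<dots> \<le> (\<integral>\<^sup>+\<omega>. zcount (block_poly \<omega>) {period m k <..< period m (Suc k)} \<partial>M)"
  proof (rule nn_integral_mono_AE, use AEz in eventually_elim)
    fix \<omega> assume w: "W.path \<omega> z \<noteq> 0"
    let ?P = "{period m k <..< period m (Suc k)}"
    have "{z} \<inter> {x \<in> ?P. W.path \<omega> x = 0} = {}" using w by auto
    then have "emeasure (count_space UNIV) {z} + zcount (W.path \<omega>) ?P
      = emeasure (count_space UNIV) ({z} \<union> {x \<in> ?P. W.path \<omega> x = 0})"
      unfolding zcount_def by (intro plus_emeasure) auto
    also have "\<dots> \<le> zcount (block_poly \<omega>) ?P"
      unfolding zcount_def using z cz[of z] by (intro emeasure_mono) (auto simp: lin_fac)
    finally show "1 + zcount (W.path \<omega>) ?P \<le> zcount (block_poly \<omega>) ?P" by simp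
  qed
  finally have lo: "1 + (\<integral>\<^sup>+\<omega>. zcount (W.path \<omega>) {period m k <..< period m (Suc k)} \<partial>M) \<le> (\<integral>\<^sup>+\<omega>. zcount (block_poly \<omega>) {period m k <..< period m (Suc k)} \<partial>M)" .
  have s1: "1 \<le> sqrt (13/12)" by (rule real_le_rsqrt) simp
  have "ennreal (1 + 2 * sqrt (13/12) - 72 * \<tau>) \<le> ennreal (1 + (2 * sqrt (13/12) - 68 * \<tau>))"
    using tau0 by (intro ennreal_leI) simp
  also have "\<dots> = 1 + ennreal (2 * sqrt (13/12) - 68 * \<tau>)"
  proof -
    have "0 \<le> 2 * sqrt (13/12) - 68 * \<tau>" using s1 t by argo
    from ennreal_plus[OF zero_le_one this] show ?thesis by simp
  qed
  also have "ennreal (2 * sqrt (13/12) - 68 * \<tau>) \<le> ennreal (integral {period m k .. period m (Suc k)} W.rate / pi)"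
  proof (rule ennreal_leI)
    have "(2 * sqrt (13/12) - 68 * \<tau>) * pi = (real m * (sqrt (13/12) - 34 * \<tau>)) * (period m (Suc k) - period m k)"
      unfolding len using m0 by (simp add: field_simps)
    also have "\<dots> \<le> integral {period m k .. period m (Suc k)} W.rate"
    proof (rule const_bound_le_integral[OF less_imp_le[OF lt] cont])
      fix x assume "x \<in> {period m k .. period m (Suc k)}"
      from speed[OF this] show "real m * (sqrt (13/12) - 34 * \<tau>) \<le> W.rate x" unfolding right_diff_distrib by linarith
    qed
    finally show "2 * sqrt (13/12) - 68 * \<tau> \<le> integral {period m k .. period m (Suc k)} W.rate / pi" by (simp add: pos_le_divide_eq)
  qed
  also have "\<dots> \<le> (\<integral>\<^sup>+\<omega>. zcount (W.path \<omega>) {period m k <..< period m (Suc k)} \<partial>M)"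
    by (rule W.expected_zeros_lower[OF pos lt])
  finally have "ennreal (1 + 2 * sqrt (13/12) - 72 * \<tau>) \<le> 1 + (\<integral>\<^sup>+\<omega>. zcount (W.path \<omega>) {period m k <..< period m (Suc k)} \<partial>M)"
    by (simp add: add_left_mono)
  then show "ennreal (1 + 2 * sqrt (13/12) - 72 * \<tau>) \<le> (\<integral>\<^sup>+\<omega>. zcount (block_poly \<omega>) {period m k <..< period m (Suc k)} \<partial>M)"
    using lo by (rule order_trans)
qed

end

section \<open>Summation over the periods\<close>

lemma sin_far_from_zero:
  assumes "0 < a" "a \<le> pi / 2" "a \<le> x" "x \<le> pi - a"
  shows "2 * a / pi \<le> sin x"
proof (cases "x \<le> pi / 2")
  case True
  have "2 * a / pi \<le> 2 * x / pi" using assms by (intro divide_right_mono) auto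
  also have "\<dots> \<le> sin x" using assms True by (intro sin_ge_frac) auto
  finally show ?thesis .
next
  case False
  have "2 * a / pi \<le> 2 * (pi - x) / pi" using assms by (intro divide_right_mono) auto
  also have "\<dots> \<le> sin (pi - x)" using assms False by (intro sin_ge_frac) auto
  finally show ?thesis by simp
qed

text \<open>
  The periods on which the estimates for \<open>w\<close> hold with relative error \<open>\<epsilon>\<close>.
\<close>

definition good_periods :: "nat \<Rightarrow> real \<Rightarrow> nat set" where
  "good_periods m \<epsilon> = {k. k < m \<and> (\<forall>x \<in> {period m k .. period m (Suc k)}. sin x \<noteq> 0 \<and> 1 / (real m * \<bar>sin x\<bar>) \<le> \<epsilon>)}"

text \<open>
  With \<open>r\<close> about \<open>1/\<epsilon>\<close>, a period at least \<open>r\<close> periods away from \<open>0\<close>, \<open>\<pi>\<close> and \<open>2\<pi>\<close> satisfies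
  \<open>|sin x| \<ge> 4 r / m\<close> throughout, hence is good.
\<close>

lemma card_bad_periods:
  assumes m: "m \<ge> 1" and e: "0 < \<epsilon>" "\<epsilon> \<le> 1"
  shows "real (card ({..<m} - good_periods m \<epsilon>)) \<le> 11 / \<epsilon>"
proof -
  have m0: "real m > 0" using m by simp
  define r where "r = nat \<lceil>1 / \<epsilon>\<rceil>"
  have r: "1 / \<epsilon> \<le> real r" "real r \<le> 1 / \<epsilon> + 1"
    using e by (simp_all add: r_def real_nat_ceiling_ge)
  have r1: "r \<ge> 1"
  proof -
    have "1 \<le> 1 / \<epsilon>" using e by simp
    then have "1 \<le> real r" using r(1) by linarith
    then show ?thesis by simp
  qed
  define a where "a = 2 * pi * real r / real m"
  have a0: "a > 0" using r1 m0 by (simp add: a_def)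
  have good_if: "sin x \<noteq> 0 \<and> 1 / (real m * \<bar>sin x\<bar>) \<le> \<epsilon>" if s: "2 * a / pi \<le> \<bar>sin x\<bar>" for x
  proof -
    have s0: "2 * a / pi > 0" using a0 by simp
    then have p: "0 < \<bar>sin x\<bar>" using s by linarith
    have "1 / (real m * \<bar>sin x\<bar>) \<le> 1 / (real m * (2 * a / pi))"
      using s s0 m0 p by (intro divide_left_mono mult_left_mono mult_pos_pos) auto
    also have "\<dots> = 1 / (4 * real r)" using m0 by (simp add: a_def)
    also have "\<dots> \<le> 1 / (1 / \<epsilon>)" using r(1) r1 e by (intro divide_left_mono mult_pos_pos) auto
    finally show ?thesis using p by simp
  qed
  have scale: "2 * pi * u / real m \<le> 2 * pi * v / real m" if "u \<le> v" for u v
    using that m0 by (intro divide_right_mono mult_left_mono) auto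
  have half: "2 * pi * (real m / 2 - v) / real m = pi - 2 * pi * v / real m" for v
    using m0 by (simp add: field_simps)
  have A: "k \<in> good_periods m \<epsilon>" if k: "r \<le> k" "2 * (k + 1 + r) \<le> m" for k
    unfolding good_periods_def
  proof (intro CollectI conjI ballI[OF good_if])
    show "k < m" using k by presburger
    fix x assume x: "x \<in> {period m k .. period m (Suc k)}"
    have "real (2 * (k + 1 + r)) \<le> real m" using k(2) by (simp only: of_nat_le_iff)
    then have kr: "real (Suc k) \<le> real m / 2 - real r" by simp
    have "a \<le> x" using x scale[of "real r" "real k"] k(1) by (simp add: a_def period_def)
    moreover have "x \<le> pi - a"
      using x scale[OF kr] unfolding half by (simp add: a_def period_def)
    ultimately have "2 * a / pi \<le> sin x" using a0 by (intro sin_far_from_zero) auto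
    then show "2 * a / pi \<le> \<bar>sin x\<bar>" by linarith
  qed
  have B: "k \<in> good_periods m \<epsilon>" if k: "m + 2 * r \<le> 2 * k" "k + 1 + r \<le> m" for k
    unfolding good_periods_def
  proof (intro CollectI conjI ballI[OF good_if])
    show "k < m" using k by linarith
    fix x assume x: "x \<in> {period m k .. period m (Suc k)}"
    have "real (m + 2 * r) \<le> real (2 * k)" using k(1) by (simp only: of_nat_le_iff)
    then have kr: "real m / 2 - (- real r) \<le> real k" by simp
    have "real (k + 1 + r) \<le> real m" using k(2) by (simp only: of_nat_le_iff)
    then have kr2: "real (Suc k) \<le> real m / 2 - (real r - real m / 2)" by simp
    have "pi + a \<le> x" using x scale[OF kr] unfolding half by (simp add: a_def period_def)
    moreover have "x \<le> 2 * pi - a"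
      using x scale[OF kr2] m0 unfolding half by (simp add: a_def period_def right_diff_distrib diff_divide_distrib)
    ultimately have "2 * a / pi \<le> sin (x - pi)" using a0 by (intro sin_far_from_zero) auto
    also have "\<dots> \<le> \<bar>sin x\<bar>" by (simp add: sin_diff)
    finally show "2 * a / pi \<le> \<bar>sin x\<bar>" .
  qed
  have sub: "{..<m} - good_periods m \<epsilon> \<subseteq> {..<r} \<union> {m div 2 - (r + 1) .. m div 2 + r} \<union> {m - r ..< m}"
  proof
    fix k assume k: "k \<in> {..<m} - good_periods m \<epsilon>"
    then have "k < m" "\<not> (r \<le> k \<and> 2 * (k + 1 + r) \<le> m)" "\<not> (m + 2 * r \<le> 2 * k \<and> k + 1 + r \<le> m)"
      using A B by auto
    note cases = this
    show "k \<in> {..<r} \<union> {m div 2 - (r + 1) .. m div 2 + r} \<union> {m - r ..< m}"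
    proof (cases "k < r \<or> m - r \<le> k")
      case True
      then show ?thesis using cases(1) by auto
    next
      case False
      then have rk: "r \<le> k" "k + 1 + r \<le> m" by linarith+
      define d where "d = m div 2"
      have d: "2 * d \<le> m" "m < 2 * d + 2" unfolding d_def by linarith+
      have "m < 2 * (k + 1 + r)" "2 * k < m + 2 * r" using cases(2,3) rk by simp_all
      then have "m < 2 * k + 2 + 2 * r" "2 * k < m + 2 * r" by simp_all
      then have "d \<le> k + (r + 1)" "k \<le> d + r" using d by linarith+
      then show ?thesis by (auto simp: d_def[symmetric] le_diff_conv)
    qed
  qed
  have "card ({..<m} - good_periods m \<epsilon>) \<le> card ({..<r} \<union> {m div 2 - (r + 1) .. m div 2 + r} \<union> {m - r ..< m})"
    by (rule card_mono[OF _ sub]) auto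
  also have "\<dots> \<le> card {..<r} + card {m div 2 - (r + 1) .. m div 2 + r} + card {m - r ..< m}"
    by (rule order_trans[OF card_Un_le add_right_mono[OF card_Un_le]])
  also have "\<dots> \<le> r + (2 * r + 2) + r" by simp
  finally have "real (card ({..<m} - good_periods m \<epsilon>)) \<le> real (r + (2 * r + 2) + r)" by (simp only: of_nat_le_iff)
  also have "\<dots> = 4 * real r + 2" by simp
  also have "\<dots> \<le> 4 * (1 / \<epsilon>) + 6" using r(2) by linarith
  also have "\<dots> \<le> 11 / \<epsilon>"
  proof -
    have "1 \<le> 1 / \<epsilon>" using e by simp
    moreover have "11 / \<epsilon> = 11 * (1 / \<epsilon>)" by simp
    ultimately show ?thesis by linarith
  qed
  finally show ?thesis .
qed

context block_setup
begin

lemma expected_zeros_good_period: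
  assumes m: "real m * \<epsilon> ^ 6 = 1" and e: "0 < \<epsilon>" "\<epsilon> \<le> 1/40" and k: "k \<in> good_periods m \<epsilon>"
  shows "(\<integral>\<^sup>+\<omega>. zcount (block_poly \<omega>) {period m k .. period m (Suc k)} \<partial>M) \<le> ennreal (1 + 2 * sqrt (13/12) + 110 * \<epsilon>)"
    "ennreal (1 + 2 * sqrt (13/12) - 110 * \<epsilon>) \<le> (\<integral>\<^sup>+\<omega>. zcount (block_poly \<omega>) {period m k <..< period m (Suc k)} \<partial>M)"
proof -
  have tau: "\<And>x. x \<in> {period m k .. period m (Suc k)} \<Longrightarrow> sin x \<noteq> 0 \<and> 1 / (real m * \<bar>sin x\<bar>) \<le> \<epsilon>"
    using k unfolding good_periods_def by blast
  have e4: "\<epsilon> \<le> 1/4" using e by linarith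
  have u: "ennreal (1 + 2 * sqrt (13/12) + 72 * \<epsilon> + 38 * \<epsilon>) \<le> ennreal (1 + 2 * sqrt (13/12) + 110 * \<epsilon>)"
    "ennreal (1 + 2 * sqrt (13/12) + 72 * \<epsilon>) \<le> ennreal (1 + 2 * sqrt (13/12) + 110 * \<epsilon>)"
    "ennreal (1 + 2 * sqrt (13/12) - 110 * \<epsilon>) \<le> ennreal (1 + 2 * sqrt (13/12) - 72 * \<epsilon> - 38 * \<epsilon>)"
    "ennreal (1 + 2 * sqrt (13/12) - 110 * \<epsilon>) \<le> ennreal (1 + 2 * sqrt (13/12) - 72 * \<epsilon>)"
    using e by (intro ennreal_leI; simp)+
  show "(\<integral>\<^sup>+\<omega>. zcount (block_poly \<omega>) {period m k .. period m (Suc k)} \<partial>M) \<le> ennreal (1 + 2 * sqrt (13/12) + 110 * \<epsilon>)"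
    using expected_zeros_period_even(1)[OF _ m e(1) e4 e(2) tau] expected_zeros_period_odd(1)[OF _ e(2) tau] u
    by (cases "even n") (blast intro: order_trans)+
  show "ennreal (1 + 2 * sqrt (13/12) - 110 * \<epsilon>) \<le> (\<integral>\<^sup>+\<omega>. zcount (block_poly \<omega>) {period m k <..< period m (Suc k)} \<partial>M)"
    using expected_zeros_period_even(2)[OF _ m e(1) e4 e(2) tau] expected_zeros_period_odd(2)[OF _ e(2) tau] u
    by (cases "even n") (blast intro: order_trans)+
qed

text \<open>
  The good periods contribute \<open>m\<close> times the main term with error \<open>O(m \<epsilon>) = O(\<epsilon>\<^sup>-\<^sup>5)\<close>. The bad ones, of
  which there are \<open>O(1/\<epsilon>)\<close>, contribute \<open>O(\<surd>m) = O(\<epsilon>\<^sup>-\<^sup>3)\<close> each. For the lower bound they are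
  dropped.
\<close>

lemma expected_zeros_bounds:
  assumes m: "real m * \<epsilon> ^ 6 = 1" and e: "0 < \<epsilon>" "\<epsilon> \<le> 1/40"
  shows "(\<integral>\<^sup>+\<omega>. zcount (block_poly \<omega>) {0<..<2 * pi} \<partial>M) \<le> ennreal (real m * (1 + 2 * sqrt (13/12)) + 2 * 10 ^ 8 * (1 / \<epsilon>) ^ 5)"
    "ennreal (real m * (1 + 2 * sqrt (13/12)) - 2 * 10 ^ 8 * (1 / \<epsilon>) ^ 5) \<le> (\<integral>\<^sup>+\<omega>. zcount (block_poly \<omega>) {0<..<2 * pi} \<partial>M)"
proof -
  define s where "s = 1 + 2 * sqrt (13/12)"
  have "1 \<le> sqrt (13/12)" by (rule real_le_rsqrt) simp
  moreover have "sqrt (13/12) \<le> 3/2" by (rule real_le_lsqrt) (simp_all add: power2_eq_square)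
  ultimately have s: "3 \<le> s" "s \<le> 4" by (auto simp: s_def)
  define E where "E = 1 / \<epsilon>"
  have E: "E \<ge> 40" using e by (simp add: E_def field_simps)
  have mE: "real m = E ^ 6" using m e by (simp add: E_def field_simps power_divide)
  have sm: "sqrt m = E ^ 3"
  proof -
    have "real m = (E ^ 3)\<^sup>2" unfolding mE by (simp add: power_mult[symmetric])
    then have "sqrt m = \<bar>E ^ 3\<bar>" by (simp only: real_sqrt_abs)
    then show ?thesis using E by simp
  qed
  let ?G = "good_periods m \<epsilon>" and ?P = "\<lambda>k. {period m k .. period m (Suc k)}" and ?Q = "\<lambda>k. {period m k <..< period m (Suc k)}"
  let ?C = "17 * 10 ^ 6 * sqrt m"
  have G: "?G \<subseteq> {..<m}" "finite ?G" by (auto simp: good_periods_def intro: finite_subset[of _ "{..<m}"])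
  have bad: "real (card ({..<m} - ?G)) \<le> 11 * E"
    using card_bad_periods[OF m1 e(1)] e(2) by (simp add: E_def)
  have cG: "real (card ?G) = real m - real (card ({..<m} - ?G))"
    using G card_Diff_subset[OF G(2) G(1)] card_mono[OF _ G(1)] by (simp add: of_nat_diff)
  have cover: "{0<..<2 * pi} \<subseteq> (\<Union>k<m. ?P k)"
  proof
    fix x assume x: "x \<in> {0<..<2 * pi}"
    define u where "u = x * real m / (2 * pi)"
    have u: "0 \<le> u" "u < real m" using x m0 by (auto simp: u_def pos_divide_less_eq)
    define k where "k = nat \<lfloor>u\<rfloor>"
    have k: "real k \<le> u" "u \<le> real (Suc k)" unfolding k_def using u by linarith+
    then have "k < m" using u by linarith
    moreover have "x = 2 * pi * u / real m" using m0 by (simp add: u_def)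
    then have "x \<in> ?P k" using k m0 by (auto simp: period_def intro!: divide_right_mono mult_left_mono simp del: of_nat_Suc)
    ultimately show "x \<in> (\<Union>k<m. ?P k)" by blast
  qed
  have "(\<integral>\<^sup>+\<omega>. zcount (block_poly \<omega>) {0<..<2 * pi} \<partial>M) \<le> (\<integral>\<^sup>+\<omega>. (\<Sum>k<m. zcount (block_poly \<omega>) (?P k)) \<partial>M)"
    by (intro nn_integral_mono order_trans[OF zcount_mono[OF cover] zcount_UN_le]) simp
  also have "\<dots> = (\<Sum>k<m. \<integral>\<^sup>+\<omega>. zcount (block_poly \<omega>) (?P k) \<partial>M)" by (rule nn_integral_sum) measurable
  also have "\<dots> = (\<Sum>k\<in>?G. \<integral>\<^sup>+\<omega>. zcount (block_poly \<omega>) (?P k) \<partial>M) + (\<Sum>k\<in>{..<m} - ?G. \<integral>\<^sup>+\<omega>. zcount (block_poly \<omega>) (?P k) \<partial>M)"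
    using sum.subset_diff[OF G(1), of "\<lambda>k. \<integral>\<^sup>+\<omega>. zcount (block_poly \<omega>) (?P k) \<partial>M"] by (simp add: add.commute)
  also have "\<dots> \<le> (\<Sum>k\<in>?G. ennreal (s + 110 * \<epsilon>)) + (\<Sum>k\<in>{..<m} - ?G. ennreal ?C)"
    unfolding s_def by (intro add_mono sum_mono expected_zeros_good_period(1)[OF m e] expected_zeros_period_crude)
  also have "\<dots> = ennreal (\<Sum>k\<in>?G. s + 110 * \<epsilon>) + ennreal (\<Sum>k\<in>{..<m} - ?G. ?C)"
    using s e by (intro arg_cong2[where f="(+)"] sum_ennreal) auto
  also have "\<dots> = ennreal ((\<Sum>k\<in>?G. s + 110 * \<epsilon>) + (\<Sum>k\<in>{..<m} - ?G. ?C))"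
    using s e by (intro ennreal_plus[symmetric] sum_nonneg) auto
  also have "\<dots> \<le> ennreal (real m * s + 2 * 10 ^ 8 * E ^ 5)"
  proof (rule ennreal_leI)
    have "(\<Sum>k\<in>?G. s + 110 * \<epsilon>) = real (card ?G) * (s + 110 * \<epsilon>)" by simp
    also have "\<dots> \<le> real m * (s + 110 * \<epsilon>)" using cG s e by (intro mult_right_mono) auto
    also have "\<dots> = real m * s + 110 * E ^ 5"
    proof -
      have "real m * \<epsilon> = E ^ 5" unfolding mE using e by (simp add: E_def power_divide eval_nat_numeral)
      then show ?thesis by (simp add: distrib_left)
    qed
    finally have 1: "(\<Sum>k\<in>?G. s + 110 * \<epsilon>) \<le> real m * s + 110 * E ^ 5" .
    have "(\<Sum>k\<in>{..<m} - ?G. ?C) = real (card ({..<m} - ?G)) * ?C" by simp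
    also have "\<dots> \<le> (11 * E) * ?C" using bad by (intro mult_right_mono) auto
    also have "\<dots> = 187 * 10 ^ 6 * E ^ 4" unfolding sm by (simp add: eval_nat_numeral)
    also have "\<dots> \<le> 187 * 10 ^ 6 * E ^ 5" using E by (intro mult_left_mono power_increasing) auto
    finally have 2: "(\<Sum>k\<in>{..<m} - ?G. ?C) \<le> 187 * 10 ^ 6 * E ^ 5" .
    have "0 \<le> E ^ 5" using E by simp
    then show "(\<Sum>k\<in>?G. s + 110 * \<epsilon>) + (\<Sum>k\<in>{..<m} - ?G. ?C) \<le> real m * s + 2 * 10 ^ 8 * E ^ 5"
      by (intro order_trans[OF add_mono[OF 1 2]]) simp
  qed
  finally show "(\<integral>\<^sup>+\<omega>. zcount (block_poly \<omega>) {0<..<2 * pi} \<partial>M) \<le> ennreal (real m * (1 + 2 * sqrt (13/12)) + 2 * 10 ^ 8 * (1 / \<epsilon>) ^ 5)"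
    by (simp only: s_def E_def)
  have mono: "period m i \<le> period m j" if "i \<le> j" for i j
    using that m0 by (auto simp: period_def intro!: divide_right_mono mult_left_mono)
  have disj: "disjoint_family_on ?Q ?G"
  proof (unfold disjoint_family_on_def, intro ballI impI)
    fix i j :: nat assume "i \<noteq> j"
    then have "Suc i \<le> j \<or> Suc j \<le> i" by linarith
    then show "?Q i \<inter> ?Q j = {}" using mono[of "Suc i" j] mono[of "Suc j" i] by fastforce
  qed
  have inside: "(\<Union>k\<in>?G. ?Q k) \<subseteq> {0<..<2 * pi}"
  proof (intro UN_least subsetI)
    fix k x assume k: "k \<in> ?G" and x: "x \<in> ?Q k"
    have "Suc k \<le> m" using k G(1) by auto
    then have "period m (Suc k) \<le> period m m" by (rule mono)
    moreover have "period m m = 2 * pi" "0 \<le> period m k" using m0 by (simp_all add: period_def)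
    ultimately show "x \<in> {0<..<2 * pi}" using x by auto
  qed
  have "ennreal (real m * s - 2 * 10 ^ 8 * E ^ 5) \<le> ennreal (\<Sum>k\<in>?G. s - 110 * \<epsilon>)"
  proof (rule ennreal_leI)
    have se: "0 \<le> s - 110 * \<epsilon>" "s - 110 * \<epsilon> \<le> 4" using s e by linarith+
    have "(\<Sum>k\<in>?G. s - 110 * \<epsilon>) = (real m - real (card ({..<m} - ?G))) * (s - 110 * \<epsilon>)" using cG by simp
    also have "\<dots> = real m * s - 110 * (real m * \<epsilon>) - real (card ({..<m} - ?G)) * (s - 110 * \<epsilon>)"
      by (simp add: algebra_simps)
    also have "real m * \<epsilon> = E ^ 5" unfolding mE using e by (simp add: E_def power_divide eval_nat_numeral)
    finally have 1: "(\<Sum>k\<in>?G. s - 110 * \<epsilon>) = real m * s - 110 * E ^ 5 - real (card ({..<m} - ?G)) * (s - 110 * \<epsilon>)" .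
    have "real (card ({..<m} - ?G)) * (s - 110 * \<epsilon>) \<le> (11 * E) * 4" using bad se E by (intro mult_mono) auto
    also have "\<dots> = 44 * E ^ 1" by simp
    also have "\<dots> \<le> 44 * E ^ 5" using E by (intro mult_left_mono power_increasing) auto
    finally have 2: "real (card ({..<m} - ?G)) * (s - 110 * \<epsilon>) \<le> 44 * E ^ 5" .
    have "110 * E ^ 5 + 44 * E ^ 5 \<le> 2 * 10 ^ 8 * E ^ 5" using E by simp
    moreover have "x - c \<le> x - p - y" if "p + q \<le> c" "y \<le> q" for x c p q y :: real
      using that by linarith
    ultimately show "real m * s - 2 * 10 ^ 8 * E ^ 5 \<le> (\<Sum>k\<in>?G. s - 110 * \<epsilon>)"
      unfolding 1 using 2 by blast
  qed
  also have "\<dots> = (\<Sum>k\<in>?G. ennreal (s - 110 * \<epsilon>))"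
    using s e by (intro sum_ennreal[symmetric]) linarith
  also have "\<dots> \<le> (\<Sum>k\<in>?G. \<integral>\<^sup>+\<omega>. zcount (block_poly \<omega>) (?Q k) \<partial>M)"
    unfolding s_def by (intro sum_mono expected_zeros_good_period(2)[OF m e])
  also have "\<dots> = (\<integral>\<^sup>+\<omega>. (\<Sum>k\<in>?G. zcount (block_poly \<omega>) (?Q k)) \<partial>M)" by (rule nn_integral_sum[symmetric]) measurable
  also have "\<dots> \<le> (\<integral>\<^sup>+\<omega>. zcount (block_poly \<omega>) {0<..<2 * pi} \<partial>M)"
    by (intro nn_integral_mono) (simp only: zcount_UN_disjoint[OF G(2) disj], intro zcount_mono inside)
  finally show "ennreal (real m * (1 + 2 * sqrt (13/12)) - 2 * 10 ^ 8 * (1 / \<epsilon>) ^ 5) \<le> (\<integral>\<^sup>+\<omega>. zcount (block_poly \<omega>) {0<..<2 * pi} \<partial>M)"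
    by (simp only: s_def E_def)
qed

end

text \<open>
  Both sides are \<open>0\<close> when there are infinitely many zeros.
\<close>

lemma num_zeros_zcount: "real (num_zeros n c) = enn2real (zcount (cos_poly n c) {0<..<2 * pi})"
  by (cases "finite {x \<in> {0<..<2 * pi}. cos_poly n c x = 0}")
     (simp_all add: num_zeros_def zcount_def emeasure_count_space_finite emeasure_count_space_infinite enn2real_of_nat)

lemma cos_poly_continuous: "continuous_on A (cos_poly n c)"
  unfolding cos_poly_def[abs_def] by (intro continuous_intros)

lemma cos_poly_eq_lin:
  assumes n: "n \<ge> 1" and eq: "\<And>j. j < block_len n \<Longrightarrow> c j = c (j + block_len n)"
  shows "cos_poly n c x = (\<Sum>i\<in>free_indices n. block_deriv n 0 i x * c i)"
proof -
  define m where "m = block_len n"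
  have two: "(\<Sum>j<2 * m. c j * cos (real j * x)) = (\<Sum>i<m. block_deriv n 0 i x * c i)"
  proof -
    have "(\<Sum>j<2 * m. c j * cos (real j * x)) = (\<Sum>j<m. c j * cos (real j * x)) + (\<Sum>j<m. c (j + m) * cos (real (j + m) * x))"
      using sum.nat_group[of "\<lambda>j. c j * cos (real j * x)" m 2]
      by (simp add: numeral_2_eq_2 mult_2 sum.shift_bounds_nat_ivl[of _ 0 m m, simplified] atLeast0LessThan[symmetric] add.commute)
    also have "\<dots> = (\<Sum>i<m. block_deriv n 0 i x * c i)"
      unfolding sum.distrib[symmetric]
      by (intro sum.cong refl) (simp add: block_deriv_def dcos_0 m_def[symmetric] eq[folded m_def, symmetric] algebra_simps)
    finally show ?thesis .
  qed
  show ?thesis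
  proof (cases "even n")
    case True
    have nm: "n = 2 * m" using block_len_even[OF True] by (simp only: m_def)
    have fI: "free_indices n = insert n {..<m}" using True by (simp add: free_indices_def m_def)
    have ni: "n \<notin> {..<m}" using nm n by auto
    have "cos_poly n c x = c n * cos (real n * x) + (\<Sum>j<2 * m. c j * cos (real j * x))"
      unfolding cos_poly_def lessThan_Suc_atMost[symmetric] sum.lessThan_Suc nm[symmetric] by simp
    also have "c n * cos (real n * x) = block_deriv n 0 n x * c n" using ni by (simp add: block_deriv_def dcos_0 m_def)
    also have "block_deriv n 0 n x * c n + (\<Sum>j<2 * m. c j * cos (real j * x)) = (\<Sum>i\<in>free_indices n. block_deriv n 0 i x * c i)"
      unfolding two fI using ni by simp
    finally show ?thesis .
  next
    case False
    have "Suc n = 2 * m" using block_len_odd[OF False] by (simp only: m_def)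
    then have "cos_poly n c x = (\<Sum>j<2 * m. c j * cos (real j * x))"
      unfolding cos_poly_def lessThan_Suc_atMost[symmetric] by simp
    then show ?thesis unfolding two using False by (simp add: free_indices_def m_def)
  qed
qed

text \<open>
  Almost surely the two blocks agree, so that the polynomial is \<open>block_poly\<close>, and the number of zeros is
  finite because its expectation is. Measurability is needed for the polynomial with its original coefficients, since the
  blocks may differ on a null set.
\<close>

lemma (in block_setup) expected_num_zeros:
  assumes m: "real m * \<epsilon> ^ 6 = 1" and e: "0 < \<epsilon>" "\<epsilon> \<le> 1/40"
    and meas: "\<And>j. j \<le> n \<Longrightarrow> \<xi> j \<in> borel_measurable M"
    and eq: "\<And>j. j < m \<Longrightarrow> AE \<omega> in M. \<xi> j \<omega> = \<xi> (j + m) \<omega>"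
  shows "\<bar>expectation (\<lambda>\<omega>. real (num_zeros n (\<lambda>j. \<xi> j \<omega>))) - real m * (1 + 2 * sqrt (13/12))\<bar> \<le> 2 * 10 ^ 8 * (1 / \<epsilon>) ^ 5"
proof -
  let ?Z = "\<lambda>\<omega>. zcount (cos_poly n (\<lambda>j. \<xi> j \<omega>)) {0<..<2 * pi}"
  have [measurable]: "?Z \<in> borel_measurable M"
  proof (rule measurable_zcount[OF cos_poly_continuous sigma_compact_interval(2)])
    show "(\<lambda>\<omega>. cos_poly n (\<lambda>j. \<xi> j \<omega>) x) \<in> borel_measurable M" for x
      unfolding cos_poly_def using meas by (intro borel_measurable_sum borel_measurable_times) auto
  qed
  have "AE \<omega> in M. \<forall>j. j < m \<longrightarrow> \<xi> j \<omega> = \<xi> (j + m) \<omega>"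
  proof (subst AE_all_countable, intro allI)
    show "AE \<omega> in M. j < m \<longrightarrow> \<xi> j \<omega> = \<xi> (j + m) \<omega>" for j
      using eq[of j] by (cases "j < m") auto
  qed
  then have ae: "AE \<omega> in M. ?Z \<omega> = zcount (block_poly \<omega>) {0<..<2 * pi}"
  proof eventually_elim
    case (elim \<omega>)
    then have "cos_poly n (\<lambda>j. \<xi> j \<omega>) x = block_poly \<omega> x" for x
      using cos_poly_eq_lin[OF n1, of "\<lambda>j. \<xi> j \<omega>" x] by (simp add: block_poly_def lin_def)
    then have "cos_poly n (\<lambda>j. \<xi> j \<omega>) = block_poly \<omega>" by (rule ext)
    then show ?case by (simp only:)
  qed
  then have Zf: "(\<integral>\<^sup>+\<omega>. ?Z \<omega> \<partial>M) = (\<integral>\<^sup>+\<omega>. zcount (block_poly \<omega>) {0<..<2 * pi} \<partial>M)" by (rule nn_integral_cong_AE)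
  let ?T = "real m * (1 + 2 * sqrt (13/12))" and ?D = "2 * 10 ^ 8 * (1 / \<epsilon>) ^ 5"
  note up = expected_zeros_bounds(1)[OF m e, folded Zf] and lo = expected_zeros_bounds(2)[OF m e, folded Zf]
  have fin: "(\<integral>\<^sup>+\<omega>. ?Z \<omega> \<partial>M) < \<top>" using up by (rule le_less_trans) simp
  then have "AE \<omega> in M. ?Z \<omega> \<noteq> \<infinity>" by (intro nn_integral_PInf_AE) (auto simp: less_top)
  then have "(\<integral>\<^sup>+\<omega>. ?Z \<omega> \<partial>M) = (\<integral>\<^sup>+\<omega>. ennreal (enn2real (?Z \<omega>)) \<partial>M)"
    by (intro nn_integral_cong_AE) (auto simp: less_top)
  then have "expectation (\<lambda>\<omega>. enn2real (?Z \<omega>)) = enn2real (\<integral>\<^sup>+\<omega>. ?Z \<omega> \<partial>M)"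
    by (subst integral_eq_nn_integral) auto
  then have E: "expectation (\<lambda>\<omega>. real (num_zeros n (\<lambda>j. \<xi> j \<omega>))) = enn2real (\<integral>\<^sup>+\<omega>. ?Z \<omega> \<partial>M)"
    by (simp only: num_zeros_zcount)
  have T0: "0 \<le> ?T" by simp
  have D0: "0 \<le> ?D" using e by simp
  have "enn2real (\<integral>\<^sup>+\<omega>. ?Z \<omega> \<partial>M) \<le> ?T + ?D"
    using up T0 D0 by (intro enn2real_leI) auto
  moreover have "?T - ?D \<le> enn2real (\<integral>\<^sup>+\<omega>. ?Z \<omega> \<partial>M)"
  proof (cases "0 \<le> ?T - ?D")
    case True
    have "enn2real (ennreal (?T - ?D)) \<le> enn2real (\<integral>\<^sup>+\<omega>. ?Z \<omega> \<partial>M)" using lo fin by (rule enn2real_mono)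
    then show ?thesis using True by simp
  next
    case False
    then show ?thesis using enn2real_nonneg[of "\<integral>\<^sup>+\<omega>. ?Z \<omega> \<partial>M"] by linarith
  qed
  ultimately show ?thesis unfolding E by linarith
qed

theorem theorem2p3:
  fixes \<sigma> :: real
    and M :: "nat \<Rightarrow> 'a measure"
    and a :: "nat \<Rightarrow> nat \<Rightarrow> 'a \<Rightarrow> real"
  assumes "\<sigma> > 0"
    and "\<And>n. prob_space (M n)"
    and "\<And>n j. j \<le> n \<Longrightarrow> a n j \<in> borel_measurable (M n)"
    and "\<And>n. prob_space.indep_vars (M n) (\<lambda>_. borel) (a n) (free_indices n)"
    and "\<And>n j. j \<in> free_indices n \<Longrightarrow> distributed (M n) lborel (a n j) (normal_density 0 \<sigma>)"
    and "\<And>n j. j < block_len n \<Longrightarrow> AE \<omega> in M n. a n j \<omega> = a n (j + block_len n) \<omega>"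
  shows "(\<lambda>n. prob_space.expectation (M n) (\<lambda>\<omega>. real (num_zeros n (\<lambda>j. a n j \<omega>)))
              - (real n / 2 + sqrt 13 / (2 * sqrt 3) * real n))
           \<in> O(\<lambda>n. real n powr (5 / 6))"
proof (rule bigoI)
  show "\<forall>\<^sub>F n in sequentially. norm (prob_space.expectation (M n) (\<lambda>\<omega>. real (num_zeros n (\<lambda>j. a n j \<omega>)))
              - (real n / 2 + sqrt 13 / (2 * sqrt 3) * real n)) \<le> (2 * 10 ^ 8 + 4) * norm (real n powr (5 / 6))"
    \<comment> \<open>This threshold makes \<open>\<epsilon> \<le> 1/40\<close> below.\<close>
    using eventually_ge_at_top[of "2 * 40 ^ 6 :: nat"]
  proof eventually_elim
    case (elim n)
    define m where "m = block_len n"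
    have nm: "n \<le> 2 * m" "2 * m \<le> Suc n"
      using block_len_even[of n] block_len_odd[of n] unfolding m_def by (cases "even n"; linarith)+
    have n1: "n \<ge> 1" using elim by simp
    have mb: "40 ^ 6 \<le> m" using elim nm(1) by linarith
    have mn: "m \<le> n" using nm(2) n1 by linarith
    have m0: "real m > 0" using mb by simp
    interpret prob_space "M n" by (rule assms(2))
    interpret B: block_setup "M n" n "a n" \<sigma>
      by unfold_locales (use assms n1 in \<open>auto simp: free_indices_def\<close>)
    \<comment> \<open>With this choice the error \<open>\<epsilon>\<^sup>-\<^sup>5\<close> equals \<open>m\<close> to the power \<open>5/6\<close>.\<close>
    define \<epsilon> where "\<epsilon> = real m powr (- 1 / 6)"
    have e0: "\<epsilon> > 0" using m0 by (simp add: \<epsilon>_def)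
    have "\<epsilon> ^ 6 = real m powr (-1)" using m0 by (simp add: \<epsilon>_def powr_power)
    then have me: "real m * \<epsilon> ^ 6 = 1" using m0 by (simp add: powr_minus)
    have "\<epsilon> \<le> (40 ^ 6) powr (- 1 / 6)"
      unfolding \<epsilon>_def using mb by (intro powr_mono2') (auto simp: of_nat_mono[of "40 ^ 6" m, simplified])
    also have "(40 ^ 6 :: real) powr (- 1 / 6) = 1 / 40"
    proof -
      have "(40::real) powr 6 = 40 ^ 6" by (rule powr_numeral) simp
      then have "(40 ^ 6 :: real) powr (- 1 / 6) = (40 powr 6) powr (- 1 / 6)" by (simp only:)
      also have "\<dots> = 40 powr (6 * (- 1 / 6))" by (rule powr_powr)
      also have "\<dots> = 40 powr (-1)" by (rule arg_cong[of _ _ "(powr) 40"]) simp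
      finally show ?thesis by (simp add: powr_minus_divide)
    qed
    finally have e1: "\<epsilon> \<le> 1 / 40" .
    have p5: "(1 / \<epsilon>) ^ 5 \<le> real n powr (5 / 6)"
    proof -
      have "1 / \<epsilon> = real m powr (1 / 6)" using m0 by (simp add: \<epsilon>_def powr_minus_divide)
      then have "(1 / \<epsilon>) ^ 5 = real m powr (5 / 6)" using m0 by (simp add: powr_power)
      also have "\<dots> \<le> real n powr (5 / 6)" using mn by (intro powr_mono2) auto
      finally show ?thesis .
    qed
    let ?E = "expectation (\<lambda>\<omega>. real (num_zeros n (\<lambda>j. a n j \<omega>)))"
    have main: "\<bar>?E - real m * (1 + 2 * sqrt (13/12))\<bar> \<le> 2 * 10 ^ 8 * (1 / \<epsilon>) ^ 5"
      by (rule B.expected_num_zeros[folded m_def, OF me e0 e1]) (use assms(3,6) in \<open>auto simp: m_def\<close>)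
    have sq: "sqrt 13 / (2 * sqrt 3) = sqrt (13/12)"
    proof -
      have "sqrt 12 = sqrt (2\<^sup>2 * 3)" by simp
      also have "\<dots> = 2 * sqrt 3" by (simp only: real_sqrt_mult real_sqrt_abs abs_numeral)
      finally show ?thesis by (simp add: real_sqrt_divide)
    qed
    define s where "s = 1 + 2 * sqrt (13/12)"
    have "sqrt (13/12) \<le> 3/2" by (rule real_le_lsqrt) (simp_all add: power2_eq_square)
    then have s: "0 \<le> s" "s \<le> 4" by (auto simp: s_def)
    have tgt: "real n / 2 + sqrt 13 / (2 * sqrt 3) * real n = real n / 2 * s"
      unfolding sq s_def by (simp add: algebra_simps)
    have "real n \<le> real (2 * m)" "real (2 * m) \<le> real (Suc n)" using nm by (simp_all only: of_nat_le_iff)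
    then have "\<bar>real m - real n / 2\<bar> \<le> 1/2" by simp
    then have "\<bar>real m - real n / 2\<bar> * s \<le> 1/2 * 4" using s by (intro mult_mono) auto
    moreover have "\<bar>real m * s - real n / 2 * s\<bar> = \<bar>real m - real n / 2\<bar> * s"
      using s(1) by (simp only: left_diff_distrib[symmetric] abs_mult abs_of_nonneg)
    ultimately have dm: "\<bar>real m * s - real n / 2 * s\<bar> \<le> 2" by linarith
    have "1 \<le> real n powr (5 / 6)" using n1 by (intro ge_one_powr_ge_zero) auto
    moreover have "2 * 10 ^ 8 * (1 / \<epsilon>) ^ 5 \<le> 2 * 10 ^ 8 * real n powr (5 / 6)" using p5 by (intro mult_left_mono) auto
    ultimately have "\<bar>?E - real n / 2 * s\<bar> \<le> (2 * 10 ^ 8 + 4) * real n powr (5 / 6)"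
      using main dm unfolding s_def[symmetric] distrib_right by linarith
    then show ?case unfolding tgt by simp
  qed
qed

end
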